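(* Let $\mathcal{H}=\mathcal{H}_1\otimes\mathcal{H}_2$ with $\mathcal{H}_1=\mathcal{H}_2=L^2(\mathbb{R}^d)$, let $\vec\varphi=\varphi_1\otimes\varphi_2\in\mathcal{H}\setminus\{0\}$ with $\varphi_1,\varphi_2\in L^2(\mathbb{R}^d)$, and for $j=1,2$ let $m_j\in L^1(\mathbb{R}^{2d})\cap L^\infty(\mathbb{R}^{2d})$ be positive functions such that $$\int_{\mathbb{R}^{2d}}m_j(x_j,\omega_j)\,dx_j\,d\omega_j=\frac{1}{\|\varphi_j\|^2},\qquad j=1,2.$$ For $x=(x_1,x_2)$, $\omega=(\omega_1,\omega_2)\in\mathbb{R}^{2d}$ put $m(x,\omega)=m_1(x_1,\omega_1)m_2(x_2,\omega_2)$ and $$F(x,\omega)=\pi(x,\omega)\vec\varphi=\pi(x_1,\omega_1)\varphi_1\otimes\pi(x_2,\omega_2)\varphi_2 .$$ Let $F_j(x_j,\omega_j)=\pi(x_j,\omega_j)\varphi_j$. Then the operator $M_{m,F,F}$ on $\mathcal{H}$ is a density operator, and its partial trace with respect to $\mathcal{H}_j$ is the density operator $M_{m_j,F_j,F_j}$ on $\mathcal{H}_j$, $j=1,2$.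
   Context: For $x,\omega\in\mathbb{R}^n$, $\pi(x,\omega)=M_\omega T_x$ on $L^2(\mathbb{R}^n)$, where $T_xf(t)=f(t-x)$ and $M_\omega f(t)=e^{2\pi i\omega\cdot t}f(t)$. $\mathcal{H}=L^2(\mathbb{R}^d)\otimes L^2(\mathbb{R}^d)$ is identified with $L^2(\mathbb{R}^{2d})$ via $(f_1\otimes f_2)(t_1,t_2)=f_1(t_1)f_2(t_2)$. Given a measure space $(X,\mu)$, weakly measurable $F,G:X\to\mathcal{K}$ into a Hilbert space and measurable $m:X\to\mathbb{C}$, the multiplier $M_{m,F,G}$ is weakly defined by $\langle M_{m,F,G}f,g\rangle=\int_Xm(x)\langle f,F(x)\rangle\langle G(x),g\rangle\,d\mu(x)$, $f,g\in\mathcal{K}$. Here $X=\mathbb{R}^{4d}$ (for $M_{m,F,F}$), respectively $X=\mathbb{R}^{2d}$ (for $M_{m_j,F_j,F_j}$), with Lebesgue measure. A density operator on a Hilbert space $\mathcal{K}$ is a non-negative self-adjoint trace class operator $\rho$ on $\mathcal{K}$ with $\mathrm{Tr}_{\mathcal{K}}(\rho)=1$. The partial trace with respect to $\mathcal{H}_1$ is the continuous linear map $T:\mathcal{S}_1(\mathcal{H}_1\otimes\mathcal{H}_2)\to\mathcal{S}_1(\mathcal{H}_1)$ ($\mathcal{S}_1$ denoting trace class operators) with $T(A_1\otimes A_2)=A_1\,\mathrm{Tr}_{\mathcal{H}_2}(A_2)$ for $A_j\in\mathcal{S}_1(\mathcal{H}_j)$; the partial trace with respect to $\mathcal{H}_2$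 is defined analogously. *)

theory Defs
  imports "HOL-Analysis.Analysis"
begin

section \<open>Complex inner product spaces\<close>

text \<open>Inner products are linear in the first and antilinear in the second argument. Norm and
  topology are those of the underlying real inner product space (real part of \<open>cinner\<close>).\<close>

class scaleC =
  fixes scaleC :: "complex \<Rightarrow> 'a \<Rightarrow> 'a" (infixr "*\<^sub>C" 75)

class cinner =
  fixes cinner :: "'a \<Rightarrow> 'a \<Rightarrow> complex"

class complex_inner = real_inner + scaleC + cinner +
  assumes scaleC_add_right: "c *\<^sub>C (f + g) = c *\<^sub>C f + c *\<^sub>C g"
    and scaleC_add_left: "(a + b) *\<^sub>C f = a *\<^sub>C f + b *\<^sub>C f"
    and scaleC_scaleC: "a *\<^sub>C b *\<^sub>C f = (a * b) *\<^sub>C f"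
    and scaleC_of_real: "complex_of_real r *\<^sub>C f = r *\<^sub>R f"
    and cinner_commute: "cinner f g = cnj (cinner g f)"
    and cinner_add_left: "cinner (f + g) h = cinner f h + cinner g h"
    and cinner_scaleC_left: "cinner (c *\<^sub>C f) g = c * cinner f g"
    and inner_eq_Re_cinner: "inner f g = Re (cinner f g)"

lemma scaleC_one: "1 *\<^sub>C f = (f :: 'a :: complex_inner)"
  using scaleC_of_real[of 1 f] by simp

interpretation complex_vector: vector_space "scaleC :: complex \<Rightarrow> 'a \<Rightarrow> 'a :: complex_inner"
  by unfold_locales (simp_all add: scaleC_add_right scaleC_add_left scaleC_scaleC scaleC_one)

lemma cinner_self: "cinner f f = complex_of_real ((norm (f :: 'a :: complex_inner))\<^sup>2)"
proof -
  have "Im (cinner f f) = 0"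
    using arg_cong[OF cinner_commute[of f f], of Im] by simp
  moreover have "Re (cinner f f) = (norm f)\<^sup>2"
    by (simp add: inner_eq_Re_cinner[symmetric] power2_norm_eq_inner)
  ultimately show ?thesis by (simp add: complex_eq_iff)
qed


section \<open>Operators, trace and density operators\<close>

definition bounded_clinear :: "('h::complex_inner \<Rightarrow> 'h) \<Rightarrow> bool" where
  "bounded_clinear A \<longleftrightarrow> bounded_linear A \<and> (\<forall>c f. A (c *\<^sub>C f) = c *\<^sub>C A f)"

definition cadjoint :: "('h::complex_inner \<Rightarrow> 'h) \<Rightarrow> 'h \<Rightarrow> 'h" where
  "cadjoint A = (THE B. \<forall>f g. cinner (A f) g = cinner f (B g))"

definition selfadjoint :: "('h::complex_inner \<Rightarrow> 'h) \<Rightarrow> bool" where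
  "selfadjoint A \<longleftrightarrow> (\<forall>f g. cinner (A f) g = cinner f (A g))"

definition nonneg_operator :: "('h::complex_inner \<Rightarrow> 'h) \<Rightarrow> bool" where
  "nonneg_operator A \<longleftrightarrow> bounded_clinear A \<and> selfadjoint A \<and> (\<forall>f. 0 \<le> Re (cinner (A f) f))"

text \<open>\<open>|A|\<close>, the non-negative square root of \<open>A\<^sup>* A\<close>.\<close>

definition abs_op :: "('h::complex_inner \<Rightarrow> 'h) \<Rightarrow> 'h \<Rightarrow> 'h" where
  "abs_op A = (THE B. nonneg_operator B \<and> B \<circ> B = cadjoint A \<circ> A)"

definition is_onb :: "'h::complex_inner set \<Rightarrow> bool" where
  "is_onb E \<longleftrightarrow> (\<forall>e\<in>E. norm e = 1) \<and> (\<forall>e\<in>E. \<forall>e'\<in>E. e \<noteq> e' \<longrightarrow> cinner e e' = 0)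
     \<and> closure (complex_vector.span E) = UNIV"

definition trace_class :: "('h::complex_inner \<Rightarrow> 'h) set" where
  "trace_class = {A. bounded_clinear A \<and>
     (\<exists>E. is_onb E \<and> (\<lambda>e. cinner (abs_op A e) e) summable_on E)}"

text \<open>The trace and the trace norm do not depend on the orthonormal basis, so one is chosen.\<close>

definition trace :: "('h::complex_inner \<Rightarrow> 'h) \<Rightarrow> complex" where
  "trace A = (\<Sum>\<^sub>\<infinity>e\<in>(SOME E. is_onb E). cinner (A e) e)"

definition trace_norm :: "('h::complex_inner \<Rightarrow> 'h) \<Rightarrow> real" where
  "trace_norm A = Re (trace (abs_op A))"

definition density_operator :: "('h::complex_inner \<Rightarrow> 'h) \<Rightarrow> bool" where
  "density_operator \<rho> \<longleftrightarrow> nonneg_operator \<rho> \<and> \<rho> \<in> trace_class \<and> trace \<rho> = 1"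


section \<open>Multipliers\<close>

definition weakly_measurable :: "'x measure \<Rightarrow> ('x \<Rightarrow> 'h::complex_inner) \<Rightarrow> bool" where
  "weakly_measurable \<mu> F \<longleftrightarrow> (\<forall>f. (\<lambda>x. cinner f (F x)) \<in> borel_measurable \<mu>)"

text \<open>Integrability is demanded explicitly because the Bochner integral of a non-integrable
  function is \<open>0\<close> by convention.\<close>

definition is_multiplier ::
  "'x measure \<Rightarrow> ('x \<Rightarrow> complex) \<Rightarrow> ('x \<Rightarrow> 'h::complex_inner) \<Rightarrow> ('x \<Rightarrow> 'h) \<Rightarrow> ('h \<Rightarrow> 'h) \<Rightarrow> bool" where
  "is_multiplier \<mu> m F G M \<longleftrightarrow>
     m \<in> borel_measurable \<mu> \<and> weakly_measurable \<mu> F \<and> weakly_measurable \<mu> G \<and>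
     (\<forall>f g. integrable \<mu> (\<lambda>x. m x * cinner f (F x) * cinner (G x) g) \<and>
            cinner (M f) g = (\<integral>x. m x * cinner f (F x) * cinner (G x) g \<partial>\<mu>))"

definition multiplier ::
  "'x measure \<Rightarrow> ('x \<Rightarrow> complex) \<Rightarrow> ('x \<Rightarrow> 'h::complex_inner) \<Rightarrow> ('x \<Rightarrow> 'h) \<Rightarrow> 'h \<Rightarrow> 'h" where
  "multiplier \<mu> m F G = (THE M. is_multiplier \<mu> m F G M)"


section \<open>The Hilbert space of square integrable functions\<close>

definition square_integrable :: "('a::euclidean_space \<Rightarrow> complex) \<Rightarrow> bool" where
  "square_integrable f \<longleftrightarrow>
     f \<in> borel_measurable lborel \<and> integrable lborel (\<lambda>t. (cmod (f t))\<^sup>2)"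

lemma borel_measurable_cnj [measurable]: "cnj \<in> borel_measurable borel"
  by (intro borel_measurable_continuous_onI continuous_intros)

lemma square_integrable_measurable:
  "square_integrable f \<Longrightarrow> f \<in> borel_measurable borel"
  by (simp add: square_integrable_def)

lemma square_integrable_zero: "square_integrable (\<lambda>_. 0)"
  by (simp add: square_integrable_def)

lemma square_integrable_add:
  assumes "square_integrable f" "square_integrable g"
  shows "square_integrable (\<lambda>t. f t + g t)"
proof -
  note [measurable] = assms[THEN square_integrable_measurable]
  have *: "(cmod (f t + g t))\<^sup>2 \<le> 2 * (cmod (f t))\<^sup>2 + 2 * (cmod (g t))\<^sup>2" for t
  proof -
    have "(cmod (f t + g t))\<^sup>2 \<le> (cmod (f t) + cmod (g t))\<^sup>2"
      by (intro power_mono norm_triangle_ineq) simp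
    also have "\<dots> \<le> 2 * (cmod (f t))\<^sup>2 + 2 * (cmod (g t))\<^sup>2"
      using zero_le_power2[of "cmod (f t) - cmod (g t)"] by (simp add: power2_eq_square algebra_simps)
    finally show ?thesis .
  qed
  have "integrable lborel (\<lambda>t. (cmod (f t + g t))\<^sup>2)"
    by (rule Bochner_Integration.integrable_bound[of _ "\<lambda>t. 2 * (cmod (f t))\<^sup>2 + 2 * (cmod (g t))\<^sup>2"])
       (use assms * in \<open>auto simp: square_integrable_def\<close>)
  then show ?thesis by (simp add: square_integrable_def)
qed

lemma square_integrable_scale:
  assumes "square_integrable f"
  shows "square_integrable (\<lambda>t. c * f t)"
  using assms by (auto simp: square_integrable_def norm_mult power_mult_distrib)

lemma integrable_square_integrable_mult:
  assumes "square_integrable f" "square_integrable g"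
  shows "integrable lborel (\<lambda>t. f t * cnj (g t))"
proof -
  note [measurable] = assms[THEN square_integrable_measurable]
  have *: "cmod (f t * cnj (g t)) \<le> (cmod (f t))\<^sup>2 + (cmod (g t))\<^sup>2" for t
  proof -
    have "2 * (cmod (f t) * cmod (g t)) \<le> (cmod (f t))\<^sup>2 + (cmod (g t))\<^sup>2"
      using zero_le_power2[of "cmod (f t) - cmod (g t)"] by (simp add: power2_eq_square algebra_simps)
    moreover have "0 \<le> cmod (f t) * cmod (g t)" by simp
    ultimately show ?thesis unfolding norm_mult complex_mod_cnj by linarith
  qed
  have **: "norm (f t * cnj (g t)) \<le> norm ((cmod (f t))\<^sup>2 + (cmod (g t))\<^sup>2)" for t
    using * [of t] by simp
  show ?thesis
    by (rule Bochner_Integration.integrable_bound[of _ "\<lambda>t. (cmod (f t))\<^sup>2 + (cmod (g t))\<^sup>2"])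
       (use assms ** in \<open>auto simp: square_integrable_def\<close>)
qed

text \<open>Borel measurable representatives suffice: every Lebesgue measurable function agrees
  almost everywhere with a Borel measurable one.\<close>

definition L2_rel :: "('a::euclidean_space \<Rightarrow> complex) \<Rightarrow> ('a \<Rightarrow> complex) \<Rightarrow> bool" where
  "L2_rel f g \<longleftrightarrow> square_integrable f \<and> square_integrable g \<and> (AE t in lborel. f t = g t)"

quotient_type (overloaded) 'a L2 = "'a::euclidean_space \<Rightarrow> complex" / partial: L2_rel
proof (rule part_equivpI)
  show "\<exists>f::'a \<Rightarrow> complex. L2_rel f f"
    by (rule exI[of _ "\<lambda>_. 0"]) (simp add: L2_rel_def square_integrable_zero)
  show "symp (L2_rel :: ('a \<Rightarrow> complex) \<Rightarrow> _)"
    by (rule sympI) (auto simp: L2_rel_def eq_commute)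
  show "transp (L2_rel :: ('a \<Rightarrow> complex) \<Rightarrow> _)"
    by (rule transpI) (auto simp: L2_rel_def)
qed

instantiation L2 :: (euclidean_space) complex_inner
begin

lift_definition zero_L2 :: "'a L2" is "\<lambda>_. 0"
  by (simp add: L2_rel_def square_integrable_zero)

lift_definition plus_L2 :: "'a L2 \<Rightarrow> 'a L2 \<Rightarrow> 'a L2" is "\<lambda>f g t. f t + g t"
  by (auto simp: L2_rel_def intro: square_integrable_add)

lift_definition scaleC_L2 :: "complex \<Rightarrow> 'a L2 \<Rightarrow> 'a L2" is "\<lambda>c f t. c * f t"
  by (auto simp: L2_rel_def intro: square_integrable_scale)

lift_definition cinner_L2 :: "'a L2 \<Rightarrow> 'a L2 \<Rightarrow> complex" is
  "\<lambda>f g. \<integral>t. f t * cnj (g t) \<partial>lborel"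
  by (rule integral_cong_AE)
     (auto simp: L2_rel_def square_integrable_def)

definition scaleR_L2 :: "real \<Rightarrow> 'a L2 \<Rightarrow> 'a L2" where
  "scaleR_L2 r f = complex_of_real r *\<^sub>C f"

definition uminus_L2 :: "'a L2 \<Rightarrow> 'a L2" where
  "uminus_L2 f = (-1) *\<^sub>C f"

definition minus_L2 :: "'a L2 \<Rightarrow> 'a L2 \<Rightarrow> 'a L2" where
  "minus_L2 f g = f + - g"

definition inner_L2 :: "'a L2 \<Rightarrow> 'a L2 \<Rightarrow> real" where
  "inner_L2 f g = Re (cinner f g)"

definition norm_L2 :: "'a L2 \<Rightarrow> real" where
  "norm_L2 f = sqrt (inner f f)"

definition sgn_L2 :: "'a L2 \<Rightarrow> 'a L2" where
  "sgn_L2 f = inverse (norm f) *\<^sub>R f"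

definition dist_L2 :: "'a L2 \<Rightarrow> 'a L2 \<Rightarrow> real" where
  "dist_L2 f g = norm (f - g)"

definition uniformity_L2 :: "('a L2 \<times> 'a L2) filter" where
  "uniformity_L2 = (INF e\<in>{0<..}. principal {(f, g). dist f g < e})"

definition open_L2 :: "'a L2 set \<Rightarrow> bool" where
  "open_L2 U \<longleftrightarrow> (\<forall>f\<in>U. \<forall>\<^sub>F (f', g) in uniformity. f' = f \<longrightarrow> g \<in> U)"

instance
proof
  fix f g h :: "'a L2" and a b c :: complex and r s :: real
  show scC: "c *\<^sub>C (f + g) = c *\<^sub>C f + c *\<^sub>C g"
    for c :: complex and f g :: "'a L2"
    by transfer (auto simp: L2_rel_def algebra_simps intro!: square_integrable_add square_integrable_scale)
  show scCl: "(a + b) *\<^sub>C f = a *\<^sub>C f + b *\<^sub>C f" for a b :: complex and f :: "'a L2"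
    by transfer (auto simp: L2_rel_def algebra_simps intro!: square_integrable_add square_integrable_scale)
  show scCC: "a *\<^sub>C b *\<^sub>C f = (a * b) *\<^sub>C f" for a b :: complex and f :: "'a L2"
    by transfer (auto simp: L2_rel_def algebra_simps intro!: square_integrable_scale)
  have sc1: "1 *\<^sub>C f = f" for f :: "'a L2"
    by transfer (auto simp: L2_rel_def)
  show "complex_of_real r *\<^sub>C f = r *\<^sub>R f"
    by (simp add: scaleR_L2_def)
  show "f + g + h = f + (g + h)"
    by transfer (auto simp: L2_rel_def algebra_simps intro!: square_integrable_add)
  show "f + g = g + f"
    by transfer (auto simp: L2_rel_def algebra_simps intro!: square_integrable_add)
  show "0 + f = f"
    by transfer (auto simp: L2_rel_def)
  show "- f + f = 0"
    unfolding uminus_L2_def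
    by transfer (auto simp: L2_rel_def intro: square_integrable_zero)
  show "f - g = f + - g" by (simp add: minus_L2_def)
  show "r *\<^sub>R (f + g) = r *\<^sub>R f + r *\<^sub>R g" by (simp add: scaleR_L2_def scC)
  show "(r + s) *\<^sub>R f = r *\<^sub>R f + s *\<^sub>R f" by (simp add: scaleR_L2_def scCl)
  show "r *\<^sub>R s *\<^sub>R f = (r * s) *\<^sub>R f" by (simp add: scaleR_L2_def scCC)
  show "1 *\<^sub>R f = f" by (simp add: scaleR_L2_def sc1)
  show "dist f g = norm (f - g)" by (simp add: dist_L2_def)
  show "sgn f = inverse (norm f) *\<^sub>R f" by (simp add: sgn_L2_def)
  show "uniformity = (INF e\<in>{0<..}. principal {(f :: 'a L2, g). dist f g < e})"
    by (simp add: uniformity_L2_def)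
  show "open U \<longleftrightarrow> (\<forall>f\<in>U. \<forall>\<^sub>F (f', g) in uniformity. f' = f \<longrightarrow> g \<in> U)" for U :: "'a L2 set"
    by (simp add: open_L2_def)
  show comm: "cinner f g = cnj (cinner g f)" for f g :: "'a L2"
    by transfer (simp del: Bochner_Integration.integral_cnj
        add: Bochner_Integration.integral_cnj [symmetric] mult.commute)
  show add: "cinner (f + g) h = cinner f h + cinner g h" for f g h :: "'a L2"
    by transfer (simp add: L2_rel_def algebra_simps integrable_square_integrable_mult)
  show scale: "cinner (c *\<^sub>C f) g = c * cinner f g" for c :: complex and f g :: "'a L2"
    by transfer (simp add: L2_rel_def mult.assoc)
  show "inner f g = Re (cinner f g)" by (simp add: inner_L2_def)
  show "inner f g = inner g f"
    unfolding inner_L2_def using comm[of f g] by simp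
  show "inner (f + g) h = inner f h + inner g h"
    by (simp add: inner_L2_def add)
  show "inner (r *\<^sub>R f) g = r * inner f g"
    by (simp add: inner_L2_def scaleR_L2_def scale)
  have self: "(\<integral>t. u t * cnj (u t) \<partial>lborel) = complex_of_real (\<integral>t. (cmod (u t))\<^sup>2 \<partial>lborel)"
    for u :: "'a \<Rightarrow> complex"
    by (simp only: complex_norm_square[symmetric] integral_complex_of_real)
  have Reself: "Re (\<integral>t. u t * cnj (u t) \<partial>lborel) = (\<integral>t. (cmod (u t))\<^sup>2 \<partial>lborel)"
    for u :: "'a \<Rightarrow> complex"
    by (simp only: self Re_complex_of_real)
  show "0 \<le> inner f f"
    unfolding inner_L2_def by transfer (simp add: Reself)
  show "(inner f f = 0) = (f = 0)"
    unfolding inner_L2_def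
    by transfer (auto simp: Reself L2_rel_def square_integrable_zero square_integrable_def
        integral_nonneg_eq_0_iff_AE)
  show "norm f = sqrt (inner f f)" by (simp add: norm_L2_def)
qed

end


section \<open>Time-frequency shifts\<close>

lift_definition translation :: "'a::euclidean_space \<Rightarrow> 'a L2 \<Rightarrow> 'a L2" is
  "\<lambda>x f t. f (t - x)"
proof -
  fix x :: 'a and f g :: "'a \<Rightarrow> complex"
  assume rel: "L2_rel f g"
  have sq: "square_integrable (\<lambda>t. u (t - x))" if "square_integrable u" for u :: "'a \<Rightarrow> complex"
  proof -
    note [measurable] = that[THEN square_integrable_measurable]
    have "integrable (distr lborel borel ((+) (- x))) (\<lambda>t. (cmod (u t))\<^sup>2)"
      using that by (simp add: lborel_distr_plus square_integrable_def)
    then have "integrable lborel (\<lambda>t. (cmod (u (- x + t)))\<^sup>2)"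
      by (subst (asm) integrable_distr_eq) auto
    then show ?thesis by (simp add: square_integrable_def algebra_simps)
  qed
  have "square_integrable f" "square_integrable g" using rel by (auto simp: L2_rel_def)
  note [measurable] = this[THEN square_integrable_measurable]
  have "AE t in distr lborel borel ((+) (- x)). f t = g t"
    using rel by (simp only: lborel_distr_plus L2_rel_def)
  then have "AE t in lborel. f (- x + t) = g (- x + t)"
    by (subst (asm) AE_distr_iff) auto
  then show "L2_rel (\<lambda>t. f (t - x)) (\<lambda>t. g (t - x))"
    using rel sq by (auto simp: L2_rel_def algebra_simps)
qed

lift_definition modulation :: "'a::euclidean_space \<Rightarrow> 'a L2 \<Rightarrow> 'a L2" is
  "\<lambda>\<omega> f t. exp (2 * complex_of_real pi * \<i> * complex_of_real (inner \<omega> t)) * f t"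
proof -
  fix \<omega> :: 'a and f g :: "'a \<Rightarrow> complex"
  let ?e = "\<lambda>t. exp (2 * complex_of_real pi * \<i> * complex_of_real (inner \<omega> t))"
  have [measurable]: "?e \<in> borel_measurable borel"
    by (intro borel_measurable_continuous_onI continuous_intros)
  have [simp]: "cmod (?e t) = 1" for t by simp
  assume "L2_rel f g"
  then show "L2_rel (\<lambda>t. ?e t * f t) (\<lambda>t. ?e t * g t)"
    by (auto simp: L2_rel_def square_integrable_def norm_mult)
qed

definition tf_shift :: "'a::euclidean_space \<Rightarrow> 'a \<Rightarrow> 'a L2 \<Rightarrow> 'a L2" where
  "tf_shift x \<omega> f = modulation \<omega> (translation x f)"


section \<open>Tensor products and partial traces\<close>

text \<open>The Hilbert tensor product of \<open>L2\<close> over \<open>'a\<close> and \<open>L2\<close> over \<open>'b\<close> is identified with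
  \<open>L2\<close> over \<open>'a \<times> 'b\<close>.\<close>

lift_definition tensor :: "'a::euclidean_space L2 \<Rightarrow> 'b::euclidean_space L2 \<Rightarrow> ('a \<times> 'b) L2"
  (infixr "\<otimes>" 70) is
  "\<lambda>f g (s, t). f s * g t"
proof -
  fix f f' :: "'a \<Rightarrow> complex" and g g' :: "'b \<Rightarrow> complex"
  assume rel: "L2_rel f f'" "L2_rel g g'"
  have sq: "square_integrable (\<lambda>(s, t). u s * v t)"
    if "square_integrable u" "square_integrable v" for u :: "'a \<Rightarrow> complex" and v :: "'b \<Rightarrow> complex"
  proof -
    note [measurable] = that[THEN square_integrable_measurable]
    have "integrable (lborel \<Otimes>\<^sub>M lborel) (\<lambda>(s, t). (cmod (u s))\<^sup>2 * (cmod (v t))\<^sup>2)"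
      by (rule lborel_pair.Fubini_integrable)
         (use that in \<open>auto simp: square_integrable_def\<close>)
    moreover have "(\<lambda>(s, t). u s * v t) \<in> borel_measurable (borel :: ('a \<times> 'b) measure)"
      by (simp flip: borel_prod)
    ultimately show ?thesis
      by (simp add: square_integrable_def lborel_prod norm_mult power_mult_distrib case_prod_beta')
  qed
  have "square_integrable f" "square_integrable f'" "square_integrable g" "square_integrable g'"
    using rel by (auto simp: L2_rel_def)
  note [measurable] = this[THEN square_integrable_measurable]
  have "AE p in lborel \<Otimes>\<^sub>M lborel. f (fst p) * g (snd p) = f' (fst p) * g' (snd p)"
  proof (rule lborel_pair.AE_pair_measure)
    show "{p \<in> space (lborel \<Otimes>\<^sub>M lborel). f (fst p) * g (snd p) = f' (fst p) * g' (snd p)}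
        \<in> sets (lborel \<Otimes>\<^sub>M lborel)" by measurable
    have "AE s in lborel. f s = f' s" "AE t in lborel. g t = g' t"
      using rel by (auto simp: L2_rel_def)
    then show "AE s in lborel. AE t in lborel. f (fst (s, t)) * g (snd (s, t)) = f' (fst (s, t)) * g' (snd (s, t))"
      by auto
  qed
  note this[unfolded lborel_prod]
  then show "L2_rel (\<lambda>(s, t). f s * g t) (\<lambda>(s, t). f' s * g' t)"
    using rel sq by (auto simp: L2_rel_def case_prod_beta')
qed

definition tensor_op ::
  "('a::euclidean_space L2 \<Rightarrow> 'a L2) \<Rightarrow> ('b::euclidean_space L2 \<Rightarrow> 'b L2) \<Rightarrow> ('a \<times> 'b) L2 \<Rightarrow> ('a \<times> 'b) L2" where
  "tensor_op A B = (THE C. bounded_clinear C \<and> (\<forall>f g. C (f \<otimes> g) = A f \<otimes> B g))"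

text \<open>Linear maps between spaces of trace class operators, continuous with respect to the trace
  norms. Operators are represented as functions, so values outside \<open>trace_class\<close> are pinned by
  extensionality.\<close>

definition continuous_linear_on_trace_class ::
  "(('h::complex_inner \<Rightarrow> 'h) \<Rightarrow> ('k::complex_inner \<Rightarrow> 'k)) \<Rightarrow> bool" where
  "continuous_linear_on_trace_class T \<longleftrightarrow>
     T \<in> trace_class \<rightarrow>\<^sub>E trace_class \<and>
     (\<forall>A\<in>trace_class. \<forall>B\<in>trace_class. T (\<lambda>f. A f + B f) = (\<lambda>f. T A f + T B f)) \<and>
     (\<forall>A\<in>trace_class. \<forall>c. T (\<lambda>f. c *\<^sub>C A f) = (\<lambda>f. c *\<^sub>C T A f)) \<and>
     (\<forall>A\<in>trace_class. \<forall>\<epsilon>>0. \<exists>\<delta>>0. \<forall>B\<in>trace_class.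
        trace_norm (\<lambda>f. B f - A f) < \<delta> \<longrightarrow> trace_norm (\<lambda>f. T B f - T A f) < \<epsilon>)"

definition partial_trace_1 ::
  "(('a::euclidean_space \<times> 'b::euclidean_space) L2 \<Rightarrow> ('a \<times> 'b) L2) \<Rightarrow> 'a L2 \<Rightarrow> 'a L2" where
  "partial_trace_1 = (THE T. continuous_linear_on_trace_class T \<and>
     (\<forall>A\<in>trace_class. \<forall>B\<in>trace_class. T (tensor_op A B) = (\<lambda>f. trace B *\<^sub>C A f)))"

definition partial_trace_2 ::
  "(('a::euclidean_space \<times> 'b::euclidean_space) L2 \<Rightarrow> ('a \<times> 'b) L2) \<Rightarrow> 'b L2 \<Rightarrow> 'b L2" where
  "partial_trace_2 = (THE T. continuous_linear_on_trace_class T \<and>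
     (\<forall>A\<in>trace_class. \<forall>B\<in>trace_class. T (tensor_op A B) = (\<lambda>g. trace A *\<^sub>C B g)))"

end

theory Submission
  imports Defs
begin

text \<open>
  The phase space shifts of \<open>\<phi>1 \<otimes> \<phi>2\<close> are products of shifts of \<open>\<phi>1\<close> and \<open>\<phi>2\<close>. Hence, tested against
  product vectors, the integral defining \<open>M\<^bsub>m,F,F\<^esub>\<close> factorizes by Fubini's theorem
  (\<open>integral_regroup_product\<close>), and as product vectors are total (\<open>tensor_dense\<close>),
  \<open>M\<^bsub>m,F,F\<^esub> = M\<^bsub>m1,F1,F1\<^esub> \<otimes> M\<^bsub>m2,F2,F2\<^esub>\<close>. A multiplier with non-negative integrable symbol \<open>w\<close> and
  window family \<open>F\<close> of constant norm \<open>c\<close> is non-negative with trace \<open>c\<^sup>2 \<integral> w\<close>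
  (\<open>density_operator_multiplier\<close>). So all three operators are density operators, and the partial trace
  of a tensor product, one factor times the trace of the other, is the remaining factor.

  Most of the work is to show that the objects involved exist and are unique. The absolute value of an
  operator requires the existence (\<open>ex_sqrt_nonneg\<close>) and uniqueness (\<open>sqrt_nonneg_unique\<close>) of square
  roots of non-negative operators. Trace class operators are then handled through the series
  \<open>A f = \<Sum>\<^sub>i \<langle>f, x\<^sub>i\<rangle> y\<^sub>i\<close> with \<open>\<Sum>\<^sub>i \<parallel>x\<^sub>i\<parallel> \<parallel>y\<^sub>i\<parallel> < \<infinity>\<close>: the factorizations \<open>A = W |A|\<close> and \<open>|A| = W' A\<close>
  with contractions \<open>W\<close>, \<open>W'\<close> (\<open>douglas_factorization\<close>) show that these series characterize trace class
  operators and that the trace norm is the least value of \<open>\<Sum>\<^sub>i \<parallel>x\<^sub>i\<parallel> \<parallel>y\<^sub>i\<parallel>\<close>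
  (\<open>nuclear_rep_trace_class\<close>, \<open>trace_class_nuclear_rep\<close>). The partial trace
  \<open>A \<mapsto> \<Sum>\<^sub>e J\<^sub>e\<^sup>* A J\<^sub>e\<close>, \<open>J\<^sub>e f = f \<otimes> e\<close>, acts on such series term by term and is a contraction for the trace
  norm (\<open>nuclear_rep_ptr\<close>); it is the only continuous linear map with the prescribed values on tensor
  products because finite combinations of rank one operators between product vectors are dense
  (\<open>partial_trace_unique\<close>). All of this needs the completeness of \<open>L\<^sup>2\<close> (\<open>L2_Cauchy_convergent\<close>), and
  interchanging the trace with the integral over phase space uses that orthonormal bases of \<open>L\<^sup>2\<close> are
  countable (\<open>countable_onb\<close>).\<close>

section \<open>Hilbert spaces\<close>

class complex_hilbert = complex_inner + banach

lemma cinner_add_right: "cinner f (g + h) = cinner f g + cinner f (h :: 'h :: complex_inner)"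
  by (metis cinner_add_left cinner_commute complex_cnj_add)

lemma cinner_scaleC_right: "cinner f (c *\<^sub>C g) = cnj c * cinner f (g :: 'h :: complex_inner)"
  by (metis cinner_scaleC_left cinner_commute complex_cnj_mult)

lemma scaleR_scaleC: "r *\<^sub>R (f :: 'h :: complex_inner) = complex_of_real r *\<^sub>C f"
  by (simp add: scaleC_of_real)

lemma cinner_zero_left [simp]: "cinner 0 (f :: 'h :: complex_inner) = 0"
  using cinner_add_left[of 0 0 f] by simp

lemma cinner_zero_right [simp]: "cinner (f :: 'h :: complex_inner) 0 = 0"
  using cinner_add_right[of f 0 0] by simp

lemma cinner_minus_left [simp]: "cinner (- f) g = - cinner f (g :: 'h :: complex_inner)"
  using cinner_add_left[of f "- f" g] by (simp add: add_eq_0_iff)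

lemma cinner_minus_right [simp]: "cinner f (- g) = - cinner f (g :: 'h :: complex_inner)"
  using cinner_add_right[of f g "- g"] by (simp add: add_eq_0_iff)

lemma cinner_diff_left: "cinner (f - g) h = cinner f h - cinner g (h :: 'h :: complex_inner)"
  using cinner_add_left[of f "- g" h] by simp

lemma cinner_diff_right: "cinner h (f - g) = cinner h f - cinner h (g :: 'h :: complex_inner)"
  using cinner_add_right[of h f "- g"] by simp

lemma cinner_sum_left: "cinner (\<Sum>i\<in>I. x i) g = (\<Sum>i\<in>I. cinner (x i) (g :: 'h :: complex_inner))"
  by (induction I rule: infinite_finite_induct) (auto simp: cinner_add_left)

lemma cinner_sum_right: "cinner g (\<Sum>i\<in>I. x i) = (\<Sum>i\<in>I. cinner g (x i :: 'h :: complex_inner))"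
  by (induction I rule: infinite_finite_induct) (auto simp: cinner_add_right)

lemmas cinner_linear = cinner_add_left cinner_add_right cinner_diff_left cinner_diff_right
  cinner_scaleC_left cinner_scaleC_right cinner_sum_left cinner_sum_right

lemma cinner_eq_zero_commute: "cinner f g = 0 \<longleftrightarrow> cinner g (f :: 'h :: complex_inner) = 0"
  by (metis cinner_commute complex_cnj_zero_iff)

lemma cmod_cinner_commute: "cmod (cinner f g) = cmod (cinner g (f :: 'h :: complex_inner))"
  by (metis cinner_commute complex_mod_cnj)

lemma cinner_self_eq_zero [simp]: "cinner f f = 0 \<longleftrightarrow> (f :: 'h :: complex_inner) = 0"
  by (simp add: cinner_self)

lemma norm_scaleC [simp]: "norm (c *\<^sub>C (f :: 'h :: complex_inner)) = cmod c * norm f"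
proof -
  have "complex_of_real ((norm (c *\<^sub>C f))\<^sup>2) = c * cnj c * cinner f f"
    unfolding cinner_self[symmetric] by (simp add: cinner_linear)
  also have "\<dots> = complex_of_real ((cmod c * norm f)\<^sup>2)"
    by (simp add: cinner_self complex_norm_square[symmetric] power_mult_distrib)
  finally have "(norm (c *\<^sub>C f))\<^sup>2 = (cmod c * norm f)\<^sup>2"
    by (simp only: of_real_eq_iff)
  then show ?thesis by (simp add: power2_eq_iff_nonneg)
qed

lemma ex_unimodular: "\<exists>u. cmod u = 1 \<and> u * z = complex_of_real (cmod z)"
proof (cases "z = 0")
  case False
  then have "cnj z / complex_of_real (cmod z) * z = complex_of_real (cmod z)"
    using complex_norm_square[of z] by (simp add: field_simps power2_eq_square)
  moreover have "cmod (cnj z / complex_of_real (cmod z)) = 1"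
    using False by (simp add: norm_divide)
  ultimately show ?thesis by blast
qed (auto intro: exI[of _ 1])

lemma cmod_cinner_le: "cmod (cinner f g) \<le> norm f * norm (g :: 'h :: complex_inner)"
proof -
  obtain u where u: "cmod u = 1" "u * cinner f g = complex_of_real (cmod (cinner f g))"
    using ex_unimodular by blast
  have "cmod (cinner f g) = inner (u *\<^sub>C f) g"
    by (simp add: inner_eq_Re_cinner cinner_linear u)
  also have "\<dots> \<le> norm (u *\<^sub>C f) * norm g"
    by (rule norm_cauchy_schwarz)
  finally show ?thesis by (simp add: u)
qed

lemma bounded_linear_cinner_left: "bounded_linear (\<lambda>f. cinner f (g :: 'h :: complex_inner))"
  by (rule bounded_linear_intro[where K = "norm g"])
     (auto simp: cinner_linear scaleR_scaleC scaleR_conv_of_real cmod_cinner_le)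

lemma bounded_linear_cinner_right: "bounded_linear (cinner (f :: 'h :: complex_inner))"
  by (rule bounded_linear_intro[where K = "norm f"])
     (auto simp: cinner_linear scaleR_scaleC scaleR_conv_of_real mult.commute[of _ "norm f"] cmod_cinner_le)

lemma bounded_linear_scaleC: "bounded_linear (scaleC c :: 'h :: complex_inner \<Rightarrow> 'h)"
  by (rule bounded_linear_intro[where K = "cmod c"])
     (auto simp: scaleC_add_right scaleR_scaleC scaleC_scaleC mult.commute)

lemma bounded_linear_scaleC_left: "bounded_linear (\<lambda>c. c *\<^sub>C (f :: 'h :: complex_inner))"
  by (rule bounded_linear_intro[where K = "norm f"])
     (auto simp: scaleC_add_left scaleR_scaleC scaleC_scaleC scaleR_conv_of_real)

lemmas tendsto_scaleC_right [tendsto_intros] = bounded_linear.tendsto[OF bounded_linear_scaleC]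

lemma eq_by_cinner_right: "(\<And>g. cinner f g = cinner f' g) \<Longrightarrow> f = (f' :: 'h :: complex_inner)"
  by (metis cinner_diff_left cinner_self_eq_zero right_minus_eq)

lemma eq_by_cinner_left: "(\<And>g. cinner g f = cinner g f') \<Longrightarrow> f = (f' :: 'h :: complex_inner)"
  by (metis cinner_diff_right cinner_self_eq_zero right_minus_eq)

definition orthonormal :: "'h::complex_inner set \<Rightarrow> bool" where
  "orthonormal E \<longleftrightarrow> (\<forall>e\<in>E. norm e = 1) \<and> (\<forall>e\<in>E. \<forall>e'\<in>E. e \<noteq> e' \<longrightarrow> cinner e e' = 0)"

lemma orthonormal_cinner:
  "orthonormal E \<Longrightarrow> e \<in> E \<Longrightarrow> e' \<in> E \<Longrightarrow> cinner e e' = (if e = e' then 1 else 0)"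
  by (auto simp: orthonormal_def cinner_self)

lemma cinner_orthonormal_sum:
  assumes "orthonormal E" "F \<subseteq> E" "finite F" "e \<in> F"
  shows "cinner (\<Sum>e'\<in>F. c e' *\<^sub>C e') e = c e"
proof -
  have "cinner (\<Sum>e'\<in>F. c e' *\<^sub>C e') e = (\<Sum>e'\<in>F. if e' = e then c e' else 0)"
    unfolding cinner_linear
    by (intro sum.cong refl) (use assms in \<open>auto simp: orthonormal_cinner subset_iff\<close>)
  then show ?thesis using assms by simp
qed

lemma norm_orthonormal_sum:
  assumes "orthonormal E" "F \<subseteq> E" "finite F"
  shows "(norm (\<Sum>e\<in>F. c e *\<^sub>C e))\<^sup>2 = (\<Sum>e\<in>F. (cmod (c e))\<^sup>2)"
proof -
  have "complex_of_real ((norm (\<Sum>e\<in>F. c e *\<^sub>C e))\<^sup>2)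
      = (\<Sum>e\<in>F. cnj (c e) * cinner (\<Sum>e'\<in>F. c e' *\<^sub>C e') e)"
    unfolding cinner_self[symmetric] by (subst cinner_sum_right) (simp add: cinner_scaleC_right)
  also have "\<dots> = (\<Sum>e\<in>F. complex_of_real ((cmod (c e))\<^sup>2))"
    by (intro sum.cong refl)
       (simp add: cinner_orthonormal_sum[OF assms] complex_norm_square mult.commute del: of_real_power)
  finally show ?thesis by (simp only: of_real_sum[symmetric] of_real_eq_iff)
qed

lemma bessel_finite:
  assumes "orthonormal E" "F \<subseteq> E" "finite F"
  shows "(\<Sum>e\<in>F. (cmod (cinner f e))\<^sup>2) \<le> (norm f)\<^sup>2"
proof -
  let ?p = "\<Sum>e\<in>F. cinner f e *\<^sub>C e" and ?s = "\<Sum>e\<in>F. (cmod (cinner f e))\<^sup>2"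
  have p: "(norm ?p)\<^sup>2 = ?s" by (rule norm_orthonormal_sum[OF assms])
  have fp: "cinner f ?p = complex_of_real ?s"
    by (simp add: cinner_linear complex_norm_square mult.commute del: of_real_power)
  have "?s \<le> norm f * norm ?p"
    using cmod_cinner_le[of f ?p] unfolding fp
    by (simp add: sum_nonneg del: of_real_sum of_real_power)
  then have "norm ?p * norm ?p \<le> norm f * norm ?p" using p by (simp add: power2_eq_square)
  then have "norm ?p \<le> norm f" by (cases "norm ?p = 0") (auto simp: mult_le_cancel_right)
  then show ?thesis unfolding p[symmetric] by (simp add: power_mono)
qed

lemma bessel_summable:
  assumes "orthonormal E"
  shows "(\<lambda>e. (cmod (cinner f e))\<^sup>2) summable_on E" "(\<Sum>\<^sub>\<infinity>e\<in>E. (cmod (cinner f e))\<^sup>2) \<le> (norm f)\<^sup>2"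
proof -
  show s: "(\<lambda>e. (cmod (cinner f e))\<^sup>2) summable_on E"
    by (rule nonneg_bdd_above_summable_on)
       (auto intro!: bdd_aboveI2[where M = "(norm f)\<^sup>2"] bessel_finite[OF assms])
  show "(\<Sum>\<^sub>\<infinity>e\<in>E. (cmod (cinner f e))\<^sup>2) \<le> (norm f)\<^sup>2"
    by (rule infsum_le_finite_sums[OF s]) (auto intro: bessel_finite[OF assms])
qed

lemma summable_on_cauchyI:
  fixes f :: "'i \<Rightarrow> 'b :: banach"
  assumes "\<And>e. e > 0 \<Longrightarrow> \<exists>G. finite G \<and> G \<subseteq> A \<and>
    (\<forall>F. finite F \<longrightarrow> F \<subseteq> A \<longrightarrow> F \<inter> G = {} \<longrightarrow> norm (sum f F) < e)"
  shows "f summable_on A"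
proof -
  have "\<exists>P. eventually P (finite_subsets_at_top A) \<and>
      (\<forall>F F'. P F \<and> P F' \<longrightarrow> dist (sum f F) (sum f F') < e)" if e: "e > 0" for e
  proof -
    obtain G where G: "finite G" "G \<subseteq> A"
      "\<And>F. finite F \<Longrightarrow> F \<subseteq> A \<Longrightarrow> F \<inter> G = {} \<Longrightarrow> norm (sum f F) < e / 2"
      using assms[of "e / 2"] e by auto
    define P where "P F \<longleftrightarrow> finite F \<and> G \<subseteq> F \<and> F \<subseteq> A" for F
    have near: "dist (sum f F) (sum f G) < e / 2" if "P F" for F
    proof -
      have "sum f F - sum f G = sum f (F - G)"
        using that by (simp add: P_def sum_diff)
      then show ?thesis using G(3)[of "F - G"] that by (auto simp: P_def dist_norm)
    qed
    have "dist (sum f F) (sum f F') < e" if "P F" "P F'" for F F'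
      using dist_triangle2[of "sum f F" "sum f F'" "sum f G"] near[OF that(1)] near[OF that(2)]
      by linarith
    moreover have "eventually P (finite_subsets_at_top A)"
      unfolding eventually_finite_subsets_at_top P_def using G by auto
    ultimately show ?thesis by blast
  qed
  then have "cauchy_filter (filtermap (sum f) (finite_subsets_at_top A))"
    by (simp add: cauchy_filter_metric_filtermap)
  moreover have "complete (UNIV::'b set)"
    by (meson Cauchy_convergent UNIV_I complete_def convergent_def)
  ultimately obtain L where "(sum f \<longlongrightarrow> L) (finite_subsets_at_top A)"
    using complete_uniform[where S=UNIV] by (force simp add: filterlim_def)
  then show ?thesis
    using summable_on_def has_sum_def by blast
qed

lemma orthonormal_summable:
  fixes E :: "'h::complex_hilbert set"
  assumes E: "orthonormal E" and c: "(\<lambda>e. (cmod (c e))\<^sup>2) summable_on E"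
  shows "(\<lambda>e. c e *\<^sub>C e) summable_on E"
proof (rule summable_on_cauchyI)
  fix \<epsilon> :: real assume "\<epsilon> > 0"
  obtain G where G: "finite G" "G \<subseteq> E"
    "dist (\<Sum>e\<in>G. (cmod (c e))\<^sup>2) (\<Sum>\<^sub>\<infinity>e\<in>E. (cmod (c e))\<^sup>2) \<le> \<epsilon>\<^sup>2 / 2"
    using infsum_finite_approximation[OF c, of "\<epsilon>\<^sup>2 / 2"] \<open>\<epsilon> > 0\<close> by auto
  have "norm (\<Sum>e\<in>F. c e *\<^sub>C e) < \<epsilon>" if F: "finite F" "F \<subseteq> E" "F \<inter> G = {}" for F
  proof -
    have "(norm (\<Sum>e\<in>F. c e *\<^sub>C e))\<^sup>2 = (\<Sum>e\<in>F. (cmod (c e))\<^sup>2)"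
      by (rule norm_orthonormal_sum[OF E F(2,1)])
    also have "\<dots> = (\<Sum>e\<in>F \<union> G. (cmod (c e))\<^sup>2) - (\<Sum>e\<in>G. (cmod (c e))\<^sup>2)"
      using F G by (simp add: sum.union_disjoint)
    also have "\<dots> \<le> (\<Sum>\<^sub>\<infinity>e\<in>E. (cmod (c e))\<^sup>2) - (\<Sum>e\<in>G. (cmod (c e))\<^sup>2)"
      using finite_sum_le_infsum[OF c, of "F \<union> G"] F G by simp
    also have "\<dots> \<le> \<epsilon>\<^sup>2 / 2"
      using G(3) unfolding dist_real_def by linarith
    also have "\<dots> < \<epsilon>\<^sup>2" using \<open>\<epsilon> > 0\<close> by simp
    finally show ?thesis using \<open>\<epsilon> > 0\<close> power2_less_imp_less by fastforce
  qed
  with G show "\<exists>G. finite G \<and> G \<subseteq> E \<and>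
      (\<forall>F. finite F \<longrightarrow> F \<subseteq> E \<longrightarrow> F \<inter> G = {} \<longrightarrow> norm (\<Sum>e\<in>F. c e *\<^sub>C e) < \<epsilon>)"
    by blast
qed

lemma infsum_in_closed_subspace:
  fixes f :: "'i \<Rightarrow> 'h::complex_hilbert"
  assumes "closed V" "complex_vector.subspace V" "f summable_on I" "\<And>i. i \<in> I \<Longrightarrow> f i \<in> V"
  shows "infsum f I \<in> V"
proof (rule Lim_in_closed_set[OF assms(1) _ _ infsum_tendsto[OF assms(3)]])
  show "\<forall>\<^sub>F F in finite_subsets_at_top I. sum f F \<in> V"
    by (intro eventually_finite_subsets_at_top_weakI complex_vector.subspace_sum assms) (use assms in auto)
qed simp

lemma ex_maximal_orthonormal:
  assumes V: "complex_vector.subspace V"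
  shows "\<exists>E \<subseteq> V. orthonormal E \<and> (\<forall>x\<in>V. (\<forall>e\<in>E. cinner x e = 0) \<longrightarrow> x = 0)"
proof -
  let ?\<A> = "{E. E \<subseteq> V \<and> orthonormal E}"
  have "\<exists>M\<in>?\<A>. \<forall>X\<in>?\<A>. M \<subseteq> X \<longrightarrow> X = M"
  proof (rule Zorn_Lemma, rule ballI)
    fix C assume C: "C \<in> chains ?\<A>"
    then have sub: "\<And>E. E \<in> C \<Longrightarrow> E \<subseteq> V \<and> orthonormal E"
      by (auto simp: chains_def)
    have "cinner e e' = 0" if e: "e \<in> E" "E \<in> C" and e': "e' \<in> E'" "E' \<in> C" and ne: "e \<noteq> e'" for e e' E E'
    proof -
      have "E \<subseteq> E' \<or> E' \<subseteq> E" using chainsD[OF C] e(2) e'(2) by blast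
      then show ?thesis using sub[OF e(2)] sub[OF e'(2)] e e' ne by (auto simp: orthonormal_def)
    qed
    then show "\<Union>C \<in> ?\<A>" using sub by (fastforce simp: orthonormal_def)
  qed
  then obtain E where E: "E \<subseteq> V" "orthonormal E"
    and max: "\<And>X. X \<subseteq> V \<Longrightarrow> orthonormal X \<Longrightarrow> E \<subseteq> X \<Longrightarrow> X = E" by auto
  have "x = 0" if x: "x \<in> V" "\<forall>e\<in>E. cinner x e = 0" for x
  proof (rule ccontr)
    assume "x \<noteq> 0"
    define u where "u = complex_of_real (1 / norm x) *\<^sub>C x"
    have nu: "norm u = 1" using \<open>x \<noteq> 0\<close> by (simp add: u_def norm_divide)
    have "u \<in> V" using V x by (simp add: u_def complex_vector.subspace_scale)
    have ue: "cinner u e = 0" if "e \<in> E" for e using x that by (simp add: u_def cinner_linear)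
    have "orthonormal (insert u E)"
      using E(2) nu ue by (auto simp: orthonormal_def) (metis cinner_eq_zero_commute)
    then have "u \<in> E" using max[of "insert u E"] E(1) \<open>u \<in> V\<close> by auto
    then have "cinner u u = 0" using ue by blast
    then show False using nu by simp
  qed
  then show ?thesis using E by blast
qed

text \<open>Against each \<open>e \<in> E\<close> the series \<open>\<Sum>\<^sub>e \<langle>f, e\<rangle> e\<close> has the same inner product as \<open>f\<close>. For
  \<open>v \<in> V\<close> the difference of \<open>v\<close> and its own series therefore lies in \<open>V\<close> and is orthogonal to \<open>E\<close>,
  so that it vanishes by maximality: every \<open>v \<in> V\<close> is a combination of elements of \<open>E\<close>, and
  orthogonality to \<open>E\<close> extends to \<open>V\<close>.\<close>

lemma closed_subspace_expansion:
  fixes V :: "'h::complex_hilbert set"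
  assumes V: "closed V" "complex_vector.subspace V" and E: "E \<subseteq> V" "orthonormal E"
    and max: "\<And>x. x \<in> V \<Longrightarrow> (\<And>e. e \<in> E \<Longrightarrow> cinner x e = 0) \<Longrightarrow> x = 0"
  shows "(\<Sum>\<^sub>\<infinity>e\<in>E. cinner f e *\<^sub>C e) \<in> V"
    and "v \<in> V \<Longrightarrow> cinner (f - (\<Sum>\<^sub>\<infinity>e\<in>E. cinner f e *\<^sub>C e)) v = 0"
proof -
  define p where "p f = (\<Sum>\<^sub>\<infinity>e\<in>E. cinner f e *\<^sub>C e)" for f
  have s: "(\<lambda>e. cinner f e *\<^sub>C e) summable_on E" for f
    by (intro orthonormal_summable bessel_summable E)
  show pV: "(\<Sum>\<^sub>\<infinity>e\<in>E. cinner f e *\<^sub>C e) \<in> V" for f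
    by (rule infsum_in_closed_subspace[OF V s]) (use E V in \<open>auto intro: complex_vector.subspace_scale\<close>)
  have pe: "cinner (p f) e = cinner f e" if "e \<in> E" for f e
  proof -
    have "((\<lambda>e'. cinner (cinner f e' *\<^sub>C e') e) has_sum cinner (p f) e) E"
      unfolding p_def by (rule has_sum_bounded_linear[OF bounded_linear_cinner_left has_sum_infsum[OF s]])
    moreover have "((\<lambda>e'. cinner (cinner f e' *\<^sub>C e') e) has_sum cinner f e) E"
      by (rule has_sum_finite_neutralI[of "{e}"])
         (use that orthonormal_cinner[OF E(2)] in \<open>auto simp: cinner_scaleC_left\<close>)
    ultimately show ?thesis using has_sum_unique by blast
  qed
  show "cinner (f - (\<Sum>\<^sub>\<infinity>e\<in>E. cinner f e *\<^sub>C e)) v = 0" if v: "v \<in> V" for f v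
  proof -
    have "v - p v = 0"
      using max[of "v - p v"] pe pV[of v] v V
      by (auto simp: cinner_diff_left p_def complex_vector.subspace_diff)
    then have "((\<lambda>e. cinner v e *\<^sub>C e) has_sum v) E"
      using has_sum_infsum[OF s[of v]] by (simp add: p_def)
    from has_sum_bounded_linear[OF bounded_linear_cinner_right this]
    have "((\<lambda>e. cinner (f - p f) (cinner v e *\<^sub>C e)) has_sum cinner (f - p f) v) E" .
    moreover have "((\<lambda>e. cinner (f - p f) (cinner v e *\<^sub>C e)) has_sum 0) E"
      by (rule has_sum_0) (simp add: cinner_linear pe)
    ultimately show ?thesis using has_sum_unique unfolding p_def by blast
  qed
qed

lemma orthogonal_projection:
  fixes V :: "'h::complex_hilbert set"
  assumes "closed V" "complex_vector.subspace V"
  shows "\<exists>p\<in>V. \<forall>v\<in>V. cinner (f - p) v = 0"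
proof -
  obtain E where E: "E \<subseteq> V" "orthonormal E" "\<And>x. x \<in> V \<Longrightarrow> (\<And>e. e \<in> E \<Longrightarrow> cinner x e = 0) \<Longrightarrow> x = 0"
    using ex_maximal_orthonormal[OF assms(2)] by metis
  show ?thesis
    using closed_subspace_expansion[OF assms E] by blast
qed

lemma subspace_closure:
  assumes "complex_vector.subspace (V :: 'h::complex_inner set)"
  shows "complex_vector.subspace (closure V)"
proof (rule complex_vector.subspaceI)
  show "0 \<in> closure V"
    using assms closure_subset complex_vector.subspace_0 by blast
  fix x y assume "x \<in> closure V" "y \<in> closure V"
  then obtain a b where "\<And>n. a n \<in> V" "a \<longlonglongrightarrow> x" "\<And>n. b n \<in> V" "b \<longlonglongrightarrow> y"
    unfolding closure_sequential by auto
  then show "x + y \<in> closure V"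
    unfolding closure_sequential
    using assms by (auto intro!: exI[of _ "\<lambda>n. a n + b n"] tendsto_add complex_vector.subspace_add)
next
  fix c x assume "x \<in> closure V"
  then obtain a where "\<And>n. a n \<in> V" "a \<longlonglongrightarrow> x"
    unfolding closure_sequential by auto
  then show "c *\<^sub>C x \<in> closure V"
    unfolding closure_sequential
    using assms by (auto intro!: exI[of _ "\<lambda>n. c *\<^sub>C a n"] tendsto_scaleC_right complex_vector.subspace_scale)
qed

text \<open>Density of a span and triviality of its orthogonal complement are equivalent by the projection
  theorem; only the latter is convenient to verify.\<close>

lemma closure_span_eq_UNIV:
  fixes S :: "'h::complex_hilbert set"
  assumes "\<And>h. (\<And>s. s \<in> S \<Longrightarrow> cinner h s = 0) \<Longrightarrow> h = 0"
  shows "closure (complex_vector.span S) = UNIV"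
proof -
  let ?V = "closure (complex_vector.span S)"
  have "f \<in> ?V" for f
  proof -
    obtain p where p: "p \<in> ?V" "\<And>v. v \<in> ?V \<Longrightarrow> cinner (f - p) v = 0"
      using orthogonal_projection[of ?V f] by (auto simp: subspace_closure)
    have "f - p = 0"
      by (rule assms, rule p) (use closure_subset complex_vector.span_base in blast)
    then show ?thesis using p by simp
  qed
  then show ?thesis by auto
qed

lemma eq_zero_if_orthogonal_dense:
  fixes S :: "'h::complex_inner set"
  assumes "closure (complex_vector.span S) = UNIV" "\<And>s. s \<in> S \<Longrightarrow> cinner h s = 0"
  shows "h = 0"
proof -
  have "cinner h v = 0" if "v \<in> complex_vector.span S" for v
    using that by (induction rule: complex_vector.span_induct_alt) (auto simp: cinner_linear assms)
  moreover have "closed {v. cinner h v = 0}"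
    by (rule closed_Collect_eq[OF bounded_linear.continuous_on[OF bounded_linear_cinner_right continuous_on_id]
          continuous_on_const])
  ultimately have "closure (complex_vector.span S) \<subseteq> {v. cinner h v = 0}"
    by (intro closure_minimal) auto
  then have "h \<in> {v. cinner h v = 0}" using assms(1) by blast
  then show ?thesis by simp
qed

lemma is_onb_iff:
  "is_onb E \<longleftrightarrow> orthonormal E \<and> (\<forall>h. (\<forall>e\<in>E. cinner h e = 0) \<longrightarrow> h = (0 :: 'h :: complex_hilbert))"
proof
  assume "is_onb E"
  then show "orthonormal E \<and> (\<forall>h. (\<forall>e\<in>E. cinner h e = 0) \<longrightarrow> h = 0)"
    unfolding is_onb_def orthonormal_def by (metis eq_zero_if_orthogonal_dense)
next
  assume *: "orthonormal E \<and> (\<forall>h. (\<forall>e\<in>E. cinner h e = 0) \<longrightarrow> h = 0)"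
  then have "closure (complex_vector.span E) = UNIV" by (intro closure_span_eq_UNIV) simp
  with * show "is_onb E" unfolding is_onb_def orthonormal_def by simp
qed

lemma ex_onb: "\<exists>E :: 'h::complex_hilbert set. is_onb E"
  unfolding is_onb_iff using ex_maximal_orthonormal[of "UNIV :: 'h set"] by auto

lemma onb_orthonormal: "is_onb E \<Longrightarrow> orthonormal E"
  by (simp add: is_onb_def orthonormal_def)

lemma onb_expansion:
  fixes E :: "'h::complex_hilbert set"
  assumes "is_onb E"
  shows "((\<lambda>e. cinner f e *\<^sub>C e) has_sum f) E"
proof -
  have E: "orthonormal E" and max: "\<And>h. (\<And>e. e \<in> E \<Longrightarrow> cinner h e = 0) \<Longrightarrow> h = 0"
    using assms by (auto simp: is_onb_iff)
  have "cinner (f - (\<Sum>\<^sub>\<infinity>e\<in>E. cinner f e *\<^sub>C e)) v = 0" for v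
    by (rule closed_subspace_expansion(2)[of UNIV E]) (use E max in auto)
  then have "f - (\<Sum>\<^sub>\<infinity>e\<in>E. cinner f e *\<^sub>C e) = 0" by (metis cinner_self_eq_zero)
  moreover have "(\<lambda>e. cinner f e *\<^sub>C e) summable_on E"
    by (intro orthonormal_summable bessel_summable E)
  ultimately show ?thesis using has_sum_infsum by fastforce
qed

lemma parseval:
  fixes E :: "'h::complex_hilbert set"
  assumes "is_onb E"
  shows "((\<lambda>e. cinner f e * cinner e g) has_sum cinner f g) E"
  using has_sum_bounded_linear[OF bounded_linear_cinner_left onb_expansion[OF assms], of f g]
  by (simp only: cinner_scaleC_left)

lemma parseval_norm:
  fixes E :: "'h::complex_hilbert set"
  assumes "is_onb E"
  shows "((\<lambda>e. (cmod (cinner f e))\<^sup>2) has_sum (norm f)\<^sup>2) E"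
proof -
  have "((\<lambda>e. Re (cinner f e * cinner e f)) has_sum Re (cinner f f)) E"
    by (rule has_sum_Re[OF parseval[OF assms]])
  moreover have "Re (cinner f e * cinner e f) = (cmod (cinner f e))\<^sup>2" for e
    unfolding cinner_commute[of e f] by (simp add: cmod_power2 flip: power2_eq_square)
  ultimately show ?thesis by (simp only: cinner_self Re_complex_of_real)
qed

text \<open>The representing vector is a multiple of any vector \<open>u\<close> that is orthogonal to the kernel of the
  functional.\<close>

lemma riesz_representation:
  fixes \<phi> :: "'h::complex_hilbert \<Rightarrow> complex"
  assumes \<phi>: "bounded_linear \<phi>" and scale: "\<And>c f. \<phi> (c *\<^sub>C f) = c * \<phi> f"
  shows "\<exists>r. \<forall>f. \<phi> f = cinner f r"
proof (cases "\<forall>f. \<phi> f = 0")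
  case True
  then show ?thesis by (intro exI[of _ 0]) simp
next
  case False
  then obtain f0 where f0: "\<phi> f0 \<noteq> 0" by blast
  interpret \<phi>: bounded_linear \<phi> by fact
  let ?V = "{f. \<phi> f = 0}"
  have "closed ?V"
    by (rule closed_Collect_eq[OF bounded_linear.continuous_on[OF \<phi> continuous_on_id] continuous_on_const])
  moreover have "complex_vector.subspace ?V"
    by (auto simp: complex_vector.subspace_def \<phi>.add \<phi>.zero scale)
  ultimately obtain p where p: "\<phi> p = 0" "\<And>v. \<phi> v = 0 \<Longrightarrow> cinner (f0 - p) v = 0"
    using orthogonal_projection[of ?V f0] by auto
  define u where "u = f0 - p"
  have u: "\<phi> u \<noteq> 0" using f0 p by (simp add: u_def \<phi>.diff)
  then have "cinner u u \<noteq> 0" using \<phi>.zero by fastforce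
  have "\<phi> f = cinner f ((cnj (\<phi> u) / cnj (cinner u u)) *\<^sub>C u)" for f
  proof -
    have "\<phi> (\<phi> u *\<^sub>C f - \<phi> f *\<^sub>C u) = 0" by (simp add: \<phi>.diff scale)
    then have "cinner (\<phi> u *\<^sub>C f - \<phi> f *\<^sub>C u) u = 0"
      using p(2) cinner_eq_zero_commute unfolding u_def by blast
    then show ?thesis using \<open>cinner u u \<noteq> 0\<close> by (simp add: cinner_linear field_simps)
  qed
  then show ?thesis by blast
qed

lemma bounded_clinearI:
  assumes "\<And>f g. A (f + g) = A f + A (g :: 'h :: complex_inner)" "\<And>c f. A (c *\<^sub>C f) = c *\<^sub>C A f"
    "\<And>f. norm (A f) \<le> K * norm f"
  shows "bounded_clinear A"
  unfolding bounded_clinear_def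
  using assms by (auto intro!: bounded_linear_intro[where K = K] simp: scaleR_scaleC mult.commute)

lemma bounded_clinear_bounded_linear: "bounded_clinear A \<Longrightarrow> bounded_linear A"
  by (simp add: bounded_clinear_def)

lemma bounded_clinear_scaleC: "bounded_clinear A \<Longrightarrow> A (c *\<^sub>C f) = c *\<^sub>C A f"
  by (simp add: bounded_clinear_def)

lemmas bounded_clinear_add = linear_add[OF bounded_linear.linear[OF bounded_clinear_bounded_linear]]
lemmas bounded_clinear_diff = linear_diff[OF bounded_linear.linear[OF bounded_clinear_bounded_linear]]
lemmas bounded_clinear_zero = linear_0[OF bounded_linear.linear[OF bounded_clinear_bounded_linear]]

lemma bounded_clinear_comp: "bounded_clinear A \<Longrightarrow> bounded_clinear B \<Longrightarrow> bounded_clinear (\<lambda>f. A (B f))"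
  by (auto simp: bounded_clinear_def bounded_linear_compose)

lemma bounded_clinear_scaled: "bounded_clinear A \<Longrightarrow> bounded_clinear (\<lambda>f. c *\<^sub>C A f)"
  by (auto simp: bounded_clinear_def bounded_linear_compose[OF bounded_linear_scaleC] scaleC_scaleC mult.commute)

text \<open>For fixed \<open>g\<close> the functional \<open>f \<mapsto> \<langle>A f, g\<rangle>\<close> is represented by the value of the adjoint at \<open>g\<close>.\<close>

lemma ex_adjoint:
  fixes A :: "'h::complex_hilbert \<Rightarrow> 'h"
  assumes A: "bounded_clinear A"
  shows "\<exists>B. bounded_clinear B \<and> (\<forall>f g. cinner (A f) g = cinner f (B g))"
proof -
  have "\<exists>r. \<forall>f. cinner (A f) g = cinner f r" for g
    by (rule riesz_representation)
       (auto intro: bounded_linear_compose[OF bounded_linear_cinner_left bounded_clinear_bounded_linear[OF A]]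
         simp: bounded_clinear_scaleC[OF A] cinner_linear)
  then obtain B where B: "\<And>f g. cinner (A f) g = cinner f (B g)" by metis
  obtain K where K: "K \<ge> 0" "\<And>f. norm (A f) \<le> norm f * K"
    using bounded_linear.nonneg_bounded[OF bounded_clinear_bounded_linear[OF A]] by blast
  have "bounded_clinear B"
  proof (rule bounded_clinearI[where K = K])
    show "B (f + g) = B f + B g" for f g
      by (rule eq_by_cinner_left) (simp add: cinner_linear B[symmetric])
    show "B (c *\<^sub>C f) = c *\<^sub>C B f" for c f
      by (rule eq_by_cinner_left) (simp add: cinner_linear B[symmetric])
    show "norm (B g) \<le> K * norm g" for g
    proof -
      have "(norm (B g))\<^sup>2 = cmod (cinner (A (B g)) g)"
        by (simp add: B cinner_self norm_power)
      also have "\<dots> \<le> norm (A (B g)) * norm g" by (rule cmod_cinner_le)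
      also have "\<dots> \<le> norm (B g) * K * norm g" by (intro mult_right_mono K) simp
      finally have "norm (B g) * norm (B g) \<le> norm (B g) * (K * norm g)"
        by (simp add: power2_eq_square mult.assoc)
      then show ?thesis using K by (cases "norm (B g) = 0") (auto simp: mult_le_cancel_left)
    qed
  qed
  then show ?thesis using B by blast
qed

lemma cadjoint_eqI: "(\<And>f g. cinner (A f) g = cinner f (B g)) \<Longrightarrow> cadjoint A = B"
  unfolding cadjoint_def
proof (rule the_equality)
  fix C assume "\<forall>f g. cinner (A f) g = cinner f (C g)" "\<And>f g. cinner (A f) g = cinner f (B g)"
  then show "C = B" by (intro ext eq_by_cinner_left) metis
qed simp

lemma
  fixes A :: "'h::complex_hilbert \<Rightarrow> 'h"
  assumes "bounded_clinear A"
  shows bounded_clinear_cadjoint: "bounded_clinear (cadjoint A)"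
    and cinner_cadjoint: "cinner (A f) g = cinner f (cadjoint A g)"
proof -
  obtain B where B: "bounded_clinear B" "\<And>f g. cinner (A f) g = cinner f (B g)"
    using ex_adjoint[OF assms] by blast
  moreover from this have "cadjoint A = B" by (intro cadjoint_eqI)
  ultimately show "bounded_clinear (cadjoint A)" "cinner (A f) g = cinner f (cadjoint A g)" by simp_all
qed

section \<open>Square roots, absolute values and factorizations of operators\<close>

lemma nonneg_operator_bounded_clinear: "nonneg_operator A \<Longrightarrow> bounded_clinear A"
  by (simp add: nonneg_operator_def)

lemma nonneg_operator_selfadjoint: "nonneg_operator A \<Longrightarrow> cinner (A f) g = cinner f (A g)"
  by (simp add: nonneg_operator_def selfadjoint_def)

text \<open>The real inner product determines the complex one, because \<open>Im \<langle>f, g\<rangle> = Re \<langle>f, \<i> g\<rangle>\<close>.\<close>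

lemma cinner_eqI_real:
  fixes A :: "'h::complex_inner \<Rightarrow> 'h"
  assumes "\<And>c g. A (c *\<^sub>C g) = c *\<^sub>C A g" "\<And>f g. inner (A f) g = inner f (A g)"
  shows "cinner (A f) g = cinner f (A g)"
proof (rule complex_eqI)
  show "Re (cinner (A f) g) = Re (cinner f (A g))"
    using assms(2)[of f g] by (simp add: inner_eq_Re_cinner)
  show "Im (cinner (A f) g) = Im (cinner f (A g))"
    using assms(2)[of f "\<i> *\<^sub>C g"] by (simp add: inner_eq_Re_cinner assms(1) cinner_linear)
qed

text \<open>A square root of a contraction \<open>A \<ge> 0\<close> is \<open>1 - Y\<close> with \<open>Y\<close> a solution of
  \<open>Y = (Q + Y\<^sup>2) / 2\<close>, \<open>Q = 1 - A\<close>. The iterates of this fixed point equation starting at \<open>0\<close> commute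
  with one another, so that their increments are dominated by those of the scalar iteration
  \<open>y \<mapsto> (1 + y\<^sup>2) / 2\<close>, which increases and stays below \<open>1\<close>. Being limits of polynomials in \<open>A\<close>,
  the square roots so obtained commute with everything that commutes with \<open>A\<close>.\<close>

fun sqrt_iter :: "('h::real_normed_vector \<Rightarrow>\<^sub>L 'h) \<Rightarrow> nat \<Rightarrow> 'h \<Rightarrow>\<^sub>L 'h" where
  "sqrt_iter Q 0 = 0"
| "sqrt_iter Q (Suc n) = (1 / 2) *\<^sub>R (Q + (sqrt_iter Q n o\<^sub>L sqrt_iter Q n))"

fun sqrt_iter_bound :: "nat \<Rightarrow> real" where
  "sqrt_iter_bound 0 = 0"
| "sqrt_iter_bound (Suc n) = (1 + (sqrt_iter_bound n)\<^sup>2) / 2"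

lemma sqrt_iter_bound_range: "0 \<le> sqrt_iter_bound n \<and> sqrt_iter_bound n \<le> 1"
proof (induction n)
  case (Suc n)
  then have "(sqrt_iter_bound n)\<^sup>2 \<le> 1" by (simp add: power_le_one)
  then show ?case by simp
qed simp

lemma convergent_sqrt_iter_bound: "convergent sqrt_iter_bound"
proof (rule Bseq_monoseq_convergent)
  show "Bseq sqrt_iter_bound"
    by (rule BseqI'[of _ 1]) (use sqrt_iter_bound_range in simp)
  have "sqrt_iter_bound n \<le> sqrt_iter_bound (Suc n)" for n
    using zero_le_power2[of "sqrt_iter_bound n - 1"] by (simp add: power2_eq_square algebra_simps)
  then show "monoseq sqrt_iter_bound" by (rule incseq_imp_monoseq[OF incseq_SucI])
qed

lemmas blinfun_compose_bilinear = bounded_bilinear.add_left[OF bounded_bilinear_blinfun_compose]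
  bounded_bilinear.add_right[OF bounded_bilinear_blinfun_compose]
  bounded_bilinear.diff_left[OF bounded_bilinear_blinfun_compose]
  bounded_bilinear.diff_right[OF bounded_bilinear_blinfun_compose]
  bounded_bilinear.scaleR_left[OF bounded_bilinear_blinfun_compose]
  bounded_bilinear.scaleR_right[OF bounded_bilinear_blinfun_compose]

lemma sqrt_iter_commute:
  assumes "C o\<^sub>L Q = Q o\<^sub>L C"
  shows "C o\<^sub>L sqrt_iter Q n = sqrt_iter Q n o\<^sub>L C"
proof (induction n)
  case (Suc n)
  have "C o\<^sub>L (sqrt_iter Q n o\<^sub>L sqrt_iter Q n) = (sqrt_iter Q n o\<^sub>L sqrt_iter Q n) o\<^sub>L C"
  proof (rule blinfun_eqI)
    fix v
    have "(C o\<^sub>L sqrt_iter Q n) w = (sqrt_iter Q n o\<^sub>L C) w" for w by (simp only: Suc)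
    then show "(C o\<^sub>L (sqrt_iter Q n o\<^sub>L sqrt_iter Q n)) v = ((sqrt_iter Q n o\<^sub>L sqrt_iter Q n) o\<^sub>L C) v"
      by simp
  qed
  then show ?case by (simp add: blinfun_compose_bilinear assms)
qed simp

lemma sqrt_iter_norm:
  assumes "norm Q \<le> 1"
  shows "norm (sqrt_iter Q n) \<le> sqrt_iter_bound n"
proof (induction n)
  case (Suc n)
  have "norm (sqrt_iter Q n o\<^sub>L sqrt_iter Q n) \<le> norm (sqrt_iter Q n) * norm (sqrt_iter Q n)"
    by (rule norm_blinfun_compose)
  also have "\<dots> \<le> (sqrt_iter_bound n)\<^sup>2"
    unfolding power2_eq_square by (intro mult_mono Suc) (use sqrt_iter_bound_range in auto)
  finally have "norm (Q + (sqrt_iter Q n o\<^sub>L sqrt_iter Q n)) \<le> 1 + (sqrt_iter_bound n)\<^sup>2"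
    using norm_triangle_ineq[of Q "sqrt_iter Q n o\<^sub>L sqrt_iter Q n"] assms by linarith
  then show ?case by simp
qed simp

text \<open>\<open>Z\<^sup>2 - Y\<^sup>2 = (Z - Y) (Z + Y)\<close> for commuting \<open>Y\<close>, \<open>Z\<close> makes the induction parallel to the one for the
  scalar iteration.\<close>

lemma sqrt_iter_increment:
  assumes "norm Q \<le> 1"
  shows "norm (sqrt_iter Q (Suc n) - sqrt_iter Q n) \<le> sqrt_iter_bound (Suc n) - sqrt_iter_bound n"
proof (induction n)
  case 0
  then show ?case using assms by simp
next
  case (Suc n)
  let ?Y = "sqrt_iter Q n" and ?Z = "sqrt_iter Q (Suc n)"
  let ?y = "sqrt_iter_bound n" and ?z = "sqrt_iter_bound (Suc n)"
  have "?Z o\<^sub>L ?Y = ?Y o\<^sub>L ?Z"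
    by (rule sqrt_iter_commute) (rule sqrt_iter_commute[symmetric], simp)
  then have "(?Z - ?Y) o\<^sub>L (?Z + ?Y) = (?Z o\<^sub>L ?Z) - (?Y o\<^sub>L ?Y)"
    by (simp add: blinfun_compose_bilinear del: sqrt_iter.simps)
  then have "sqrt_iter Q (Suc (Suc n)) - ?Z = (1 / 2) *\<^sub>R ((?Z - ?Y) o\<^sub>L (?Z + ?Y))"
    using sqrt_iter.simps(2)[of Q "Suc n"] sqrt_iter.simps(2)[of Q n]
    by (metis add_diff_cancel_left scaleR_diff_right)
  then have "norm (sqrt_iter Q (Suc (Suc n)) - ?Z) \<le> (1 / 2) * (norm (?Z - ?Y) * norm (?Z + ?Y))"
    using norm_blinfun_compose[of "?Z - ?Y" "?Z + ?Y"] by (simp del: sqrt_iter.simps)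
  also have "\<dots> \<le> (1 / 2) * ((?z - ?y) * (?z + ?y))"
  proof (intro mult_left_mono mult_mono Suc)
    show "norm (?Z + ?Y) \<le> ?z + ?y"
      using norm_triangle_ineq[of ?Z ?Y] sqrt_iter_norm[OF assms, of n] sqrt_iter_norm[OF assms, of "Suc n"]
      by linarith
    show "0 \<le> ?z - ?y" by (rule order_trans[OF norm_ge_zero Suc])
  qed simp_all
  also have "\<dots> = sqrt_iter_bound (Suc (Suc n)) - ?z"
    by (simp only: sqrt_iter_bound.simps(2)[of "Suc n"] sqrt_iter_bound.simps(2)[of n])
       (simp add: power2_eq_square field_simps)
  finally show ?case .
qed

lemma convergent_sqrt_iter:
  fixes Q :: "'h::banach \<Rightarrow>\<^sub>L 'h"
  assumes "norm Q \<le> 1"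
  shows "convergent (sqrt_iter Q)"
proof -
  have inc: "norm (sqrt_iter Q (n + k) - sqrt_iter Q n) \<le> sqrt_iter_bound (n + k) - sqrt_iter_bound n" for n k
  proof (induction k)
    case (Suc k)
    have "norm (sqrt_iter Q (n + Suc k) - sqrt_iter Q n)
        \<le> norm (sqrt_iter Q (Suc (n + k)) - sqrt_iter Q (n + k)) + norm (sqrt_iter Q (n + k) - sqrt_iter Q n)"
      using norm_triangle_ineq[of "sqrt_iter Q (Suc (n + k)) - sqrt_iter Q (n + k)"
          "sqrt_iter Q (n + k) - sqrt_iter Q n"] by (simp del: sqrt_iter.simps)
    then show ?case using Suc sqrt_iter_increment[OF assms, of "n + k"] by (simp del: sqrt_iter.simps sqrt_iter_bound.simps)
  qed simp
  have "Cauchy (sqrt_iter Q)"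
  proof (rule metric_CauchyI)
    fix e :: real assume "e > 0"
    then obtain M where M: "\<And>m n. m \<ge> M \<Longrightarrow> n \<ge> M \<Longrightarrow> \<bar>sqrt_iter_bound m - sqrt_iter_bound n\<bar> < e / 2"
      using metric_CauchyD[OF convergent_Cauchy[OF convergent_sqrt_iter_bound], of "e / 2"]
      by (auto simp: dist_real_def)
    have "dist (sqrt_iter Q n) (sqrt_iter Q M) < e / 2" if "n \<ge> M" for n
    proof -
      have "norm (sqrt_iter Q n - sqrt_iter Q M) \<le> \<bar>sqrt_iter_bound n - sqrt_iter_bound M\<bar>"
        using inc[of M "n - M"] that by simp
      then show ?thesis unfolding dist_norm using M[OF that order.refl] by (rule order.strict_trans1)
    qed
    then show "\<exists>M. \<forall>m\<ge>M. \<forall>n\<ge>M. dist (sqrt_iter Q m) (sqrt_iter Q n) < e"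
      using dist_triangle_half_l by blast
  qed
  then show ?thesis by (rule Cauchy_convergent)
qed

lemma ex_sqrt_contraction:
  fixes A :: "'h::complex_hilbert \<Rightarrow> 'h"
  assumes A: "nonneg_operator A" and contr: "\<And>f. norm (A f) \<le> norm f"
  shows "\<exists>B. nonneg_operator B \<and> (\<forall>f. B (B f) = A f) \<and>
    (\<forall>C. bounded_linear C \<longrightarrow> (\<forall>f. C (A f) = A (C f)) \<longrightarrow> (\<forall>f. C (B f) = B (C f)))"
proof -
  have bl: "bounded_linear A" using A by (simp add: nonneg_operator_def bounded_clinear_def)
  define Q where "Q = id_blinfun - Blinfun A"
  have Q: "Q f = f - A f" for f
    by (simp add: Q_def blinfun.diff_left bounded_linear_Blinfun_apply[OF bl])
  have "norm (Q f) \<le> 1 * norm f" for f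
  proof -
    \<comment> \<open>A non-negative contraction satisfies \<open>A\<^sup>2 \<le> A\<close>.\<close>
    have sa: "inner (A u) v = inner u (A v)" for u v
      using A by (simp add: inner_eq_Re_cinner nonneg_operator_selfadjoint)
    have diff: "A (f - A f) = A f - A (A f)" by (rule linear_diff[OF bounded_linear.linear[OF bl]])
    have "0 \<le> inner (A (f - A f)) (f - A f)"
      using A by (simp add: inner_eq_Re_cinner nonneg_operator_def)
    also have "\<dots> = inner (A f) f - 2 * inner (A f) (A f) + inner (A (A f)) (A f)"
      by (simp add: diff inner_diff_left inner_diff_right sa inner_commute)
    also have "inner (A (A f)) (A f) \<le> norm (A f) * norm (A f)"
      using norm_cauchy_schwarz[of "A (A f)" "A f"] contr[of "A f"]
      by (meson mult_right_mono norm_ge_zero order_trans)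
    also have "norm (A f) * norm (A f) = inner (A f) (A f)"
      by (simp add: power2_norm_eq_inner[symmetric] power2_eq_square)
    finally have "inner (A f) (A f) \<le> inner (A f) f" by simp
    then have "(norm (Q f))\<^sup>2 \<le> (norm f)\<^sup>2 - inner (A f) f"
      by (simp add: Q power2_norm_eq_inner inner_diff_left inner_diff_right inner_commute)
    also have "\<dots> \<le> (norm f)\<^sup>2"
      using A by (simp add: inner_eq_Re_cinner nonneg_operator_def)
    finally show ?thesis by (simp add: power2_le_iff_abs_le)
  qed
  then have "norm Q \<le> 1" by (intro norm_blinfun_bound) auto
  then obtain Y where Y: "sqrt_iter Q \<longlonglongrightarrow> Y"
    using convergent_sqrt_iter by (auto simp: convergent_def)
  have apply_lim: "(\<lambda>n. sqrt_iter Q n f) \<longlonglongrightarrow> Y f" for f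
    by (intro blinfun.tendsto Y tendsto_const)
  have "(\<lambda>n. (1 / 2) *\<^sub>R (Q + (sqrt_iter Q n o\<^sub>L sqrt_iter Q n))) \<longlonglongrightarrow> (1 / 2) *\<^sub>R (Q + (Y o\<^sub>L Y))"
    by (intro tendsto_intros bounded_bilinear.tendsto[OF bounded_bilinear_blinfun_compose] Y)
  moreover have "(\<lambda>n. (1 / 2) *\<^sub>R (Q + (sqrt_iter Q n o\<^sub>L sqrt_iter Q n))) \<longlonglongrightarrow> Y"
    using LIMSEQ_Suc[OF Y] by simp
  ultimately have "Y = (1 / 2) *\<^sub>R (Q + (Y o\<^sub>L Y))" by (rule LIMSEQ_unique[rotated])
  then have "2 *\<^sub>R Y = 2 *\<^sub>R ((1 / 2) *\<^sub>R (Q + (Y o\<^sub>L Y)))" by (rule arg_cong)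
  then have "2 *\<^sub>R Y = Q + (Y o\<^sub>L Y)" by simp
  then have "(2 *\<^sub>R Y) f = (Q + (Y o\<^sub>L Y)) f" for f by (rule arg_cong)
  then have fixpoint: "2 *\<^sub>R Y f = (f - A f) + Y (Y f)" for f
    by (simp add: blinfun.add_left blinfun.scaleR_left Q)
  have "norm (sqrt_iter Q n) \<le> 1" for n
    using sqrt_iter_norm[OF \<open>norm Q \<le> 1\<close>, of n] sqrt_iter_bound_range[of n] by simp
  then have nY: "norm Y \<le> 1"
    by (intro LIMSEQ_le_const2[OF tendsto_norm[OF Y]]) auto
  define B where "B f = f - Y f" for f
  have BB: "B (B f) = A f" for f
    using fixpoint[of f] by (simp add: B_def blinfun.diff_right scaleR_2 algebra_simps)
  have comm: "C (B f) = B (C f)" if C: "bounded_linear C" "\<And>f. C (A f) = A (C f)" for C f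
  proof -
    have C': "Blinfun C f = C f" for f by (simp add: bounded_linear_Blinfun_apply C)
    have "C (f - A f) = C f - A (C f)" for f
      by (simp add: linear_diff[OF bounded_linear.linear[OF C(1)]] C)
    then have "Blinfun C o\<^sub>L Q = Q o\<^sub>L Blinfun C"
      by (intro blinfun_eqI) (simp add: C' Q)
    then have "Blinfun C o\<^sub>L sqrt_iter Q n = sqrt_iter Q n o\<^sub>L Blinfun C" for n
      by (rule sqrt_iter_commute)
    then have "(Blinfun C o\<^sub>L sqrt_iter Q n) f = (sqrt_iter Q n o\<^sub>L Blinfun C) f" for n by simp
    then have "C (sqrt_iter Q n f) = sqrt_iter Q n (C f)" for n by (simp add: C')
    then have "C (Y f) = Y (C f)"
      using bounded_linear.tendsto[OF C(1) apply_lim[of f]] apply_lim[of "C f"] LIMSEQ_unique by simp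
    then show ?thesis by (simp add: B_def linear_diff[OF bounded_linear.linear[OF C(1)]])
  qed
  have scale: "B (c *\<^sub>C f) = c *\<^sub>C B f" for c f
    using comm[OF bounded_linear_scaleC, of c f] A
    by (simp add: nonneg_operator_def bounded_clinear_def)
  have "bounded_clinear B"
    unfolding bounded_clinear_def B_def[abs_def]
    using scale by (auto simp: B_def intro!: bounded_linear_sub blinfun.bounded_linear_right bounded_linear_ident)
  have "inner (sqrt_iter Q n f) g = inner f (sqrt_iter Q n g)" for n f g
  proof (induction n arbitrary: f g)
    case (Suc n)
    have "inner (Q f) g = inner f (Q g)"
      using A by (simp add: Q cinner_linear inner_eq_Re_cinner nonneg_operator_selfadjoint)
    then show ?case
      by (simp add: blinfun.add_left blinfun.scaleR_left inner_add_left inner_add_right Suc)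
  qed simp
  then have "inner (Y f) g = inner f (Y g)" for f g
    using tendsto_inner[OF apply_lim[of f] tendsto_const[of g]] tendsto_inner[OF tendsto_const[of f] apply_lim[of g]]
      LIMSEQ_unique by simp
  then have "inner (B f) g = inner f (B g)" for f g
    by (simp add: B_def inner_diff_left inner_diff_right)
  then have sa: "selfadjoint B"
    unfolding selfadjoint_def using cinner_eqI_real[of B] scale by blast
  have "0 \<le> Re (cinner (B f) f)" for f
  proof -
    have "inner (Y f) f \<le> norm (Y f) * norm f" by (rule norm_cauchy_schwarz)
    also have "norm (Y f) \<le> norm f"
      using norm_blinfun[of Y f] nY by (meson mult_left_le_one_le norm_ge_zero order_trans)
    finally have "inner (Y f) f \<le> inner f f"
      by (simp add: power2_norm_eq_inner[symmetric] power2_eq_square mult_right_mono)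
    then show ?thesis by (simp add: B_def inner_eq_Re_cinner[symmetric] inner_diff_left)
  qed
  then have "nonneg_operator B"
    using \<open>bounded_clinear B\<close> sa by (simp add: nonneg_operator_def)
  then show ?thesis using BB comm by blast
qed

lemma nonneg_operator_scaleR:
  assumes "nonneg_operator A" "0 \<le> r"
  shows "nonneg_operator (\<lambda>f. r *\<^sub>R A f)"
  using assms unfolding scaleR_scaleC
  by (auto simp: nonneg_operator_def bounded_clinear_scaled selfadjoint_def cinner_linear)

lemma ex_sqrt_nonneg:
  fixes A :: "'h::complex_hilbert \<Rightarrow> 'h"
  assumes A: "nonneg_operator A"
  shows "\<exists>B. nonneg_operator B \<and> (\<forall>f. B (B f) = A f) \<and>
    (\<forall>C. bounded_linear C \<longrightarrow> (\<forall>f. C (A f) = A (C f)) \<longrightarrow> (\<forall>f. C (B f) = B (C f)))"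
proof -
  obtain K where K: "K > 0" "\<And>f. norm (A f) \<le> norm f * K"
    using A bounded_linear.pos_bounded unfolding nonneg_operator_def bounded_clinear_def by blast
  define A' where "A' f = (1 / K) *\<^sub>R A f" for f
  have "nonneg_operator A'" unfolding A'_def using A K by (intro nonneg_operator_scaleR) auto
  moreover have "norm (A' f) \<le> norm f" for f using K by (simp add: A'_def field_simps)
  ultimately obtain B where B: "nonneg_operator B" "\<And>f. B (B f) = A' f"
    and comm: "\<And>C f. bounded_linear C \<Longrightarrow> (\<And>f. C (A' f) = A' (C f)) \<Longrightarrow> C (B f) = B (C f)"
    using ex_sqrt_contraction[of A'] by blast
  have lin: "B (r *\<^sub>R f) = r *\<^sub>R B f" for r f
    using B by (simp add: scaleR_scaleC nonneg_operator_def bounded_clinear_def)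
  define S where "S f = sqrt K *\<^sub>R B f" for f
  have "nonneg_operator S" unfolding S_def using B K by (intro nonneg_operator_scaleR) auto
  moreover have "S (S f) = A f" for f using K by (simp add: S_def lin B A'_def)
  moreover have "C (S f) = S (C f)" if C: "bounded_linear C" "\<And>f. C (A f) = A (C f)" for C f
    using comm[OF C(1), of f] C by (simp add: S_def A'_def linear_scale[OF bounded_linear.linear[OF C(1)]])
  ultimately show ?thesis by blast
qed

text \<open>If two non-negative square roots \<open>B\<close>, \<open>C\<close> of the same operator commute, then \<open>D = B - C\<close>
  satisfies \<open>(B + C) D = 0\<close>, and positivity separates this into \<open>\<langle>B D g, D g\<rangle> = \<langle>C D g, D g\<rangle> = 0\<close>;
  hence the quadratic form of \<open>D\<^sup>3\<close> vanishes, which forces the self-adjoint operator \<open>D\<close> to vanish. An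
  arbitrary square root commutes with the one obtained as a limit of polynomials.\<close>

lemma sqrt_nonneg_unique:
  fixes B C :: "'h::complex_hilbert \<Rightarrow> 'h"
  assumes B: "nonneg_operator B" and C: "nonneg_operator C" and eq: "\<And>f. B (B f) = C (C f)"
  shows "B = C"
proof -
  have nn: "nonneg_operator (\<lambda>f. C (C f))"
    using C by (auto simp: nonneg_operator_def bounded_clinear_comp selfadjoint_def cinner_self)
  obtain S where S: "nonneg_operator S" "\<And>f. S (S f) = C (C f)"
    and comm: "\<And>T f. bounded_linear T \<Longrightarrow> (\<And>f. T (C (C f)) = C (C (T f))) \<Longrightarrow> T (S f) = S (T f)"
    using ex_sqrt_nonneg[OF nn] by blast
  have "T = S" if T: "nonneg_operator T" "\<And>f. T (T f) = C (C f)" for T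
  proof (rule ext)
    fix f
    have blin: "bounded_clinear T" "bounded_clinear S" using T S by (auto simp: nonneg_operator_def)
    note lin = bounded_clinear_diff[OF blin(1)] bounded_clinear_diff[OF blin(2)]
    have TS: "T (S g) = S (T g)" for g
      using T blin(1) by (intro comm) (auto simp: bounded_clinear_def, metis T(2))
    define D where "D g = T g - S g" for g
    have Dsa: "cinner (D g) h = cinner g (D h)" for g h
      using T S by (simp add: D_def cinner_linear nonneg_operator_selfadjoint)
    have Ddiff: "D (g - h) = D g - D h" for g h by (simp add: D_def lin)
    have sum0: "T (D g) + S (D g) = 0" for g
      by (simp add: D_def lin TS T(2) S(2))
    have "Re (cinner (T (D g)) (D g)) + Re (cinner (S (D g)) (D g)) = 0" for g
      using arg_cong[OF sum0[of g], of "\<lambda>v. Re (cinner v (D g))"] by (simp add: cinner_linear)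
    moreover have "0 \<le> Re (cinner (T (D g)) (D g))" "0 \<le> Re (cinner (S (D g)) (D g))" for g
      using T S by (simp_all add: nonneg_operator_def)
    ultimately have "Re (cinner (T (D g)) (D g)) = 0" "Re (cinner (S (D g)) (D g)) = 0" for g
      by (smt (verit))+
    then have "Re (cinner (D (D g)) (D g)) = 0" for g
      by (simp add: D_def[of "D g"] cinner_linear)
    \<comment> \<open>The quadratic form of \<open>D\<^sup>3\<close> vanishes; evaluating it at \<open>g - D g\<close> gives \<open>\<langle>D\<^sup>3 g, D g\<rangle> = \<parallel>D\<^sup>2 g\<parallel>\<^sup>2 = 0\<close>.\<close>
    then have q: "Re (cinner (D (D (D g))) g) = 0" for g by (simp add: Dsa)
    have "Re (cinner (D (D (D g))) (D g)) = 0" for g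
    proof -
      have "Re (cinner (D (D (D (g - D g)))) (g - D g)) = 0" by (rule q)
      moreover have "cinner (D (D (D (D g)))) g = cinner (D (D (D g))) (D g)"
        by (simp add: Dsa)
      ultimately show ?thesis
        using q[of g] q[of "D g"] by (simp add: Ddiff cinner_linear)
    qed
    then have "Re (cinner (D (D g)) (D (D g))) = 0" for g by (simp add: Dsa)
    then have "D (D g) = 0" for g by (simp add: cinner_self)
    then have "cinner (D f) (D f) = 0" by (simp add: Dsa)
    then show "T f = S f" by (simp add: D_def)
  qed
  from this[OF B eq] this[OF C] show ?thesis by simp
qed

lemma
  fixes A :: "'h::complex_hilbert \<Rightarrow> 'h"
  assumes A: "bounded_clinear A"
  shows nonneg_abs_op: "nonneg_operator (abs_op A)"
    and abs_op_abs_op: "abs_op A (abs_op A f) = cadjoint A (A f)"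
proof -
  have "cinner (cadjoint A f) g = cinner f (A g)" for f g
    by (metis A cinner_cadjoint cinner_commute)
  then have "nonneg_operator (\<lambda>f. cadjoint A (A f))"
    using A by (auto simp: nonneg_operator_def bounded_clinear_comp bounded_clinear_cadjoint
        selfadjoint_def cinner_cadjoint[symmetric] cinner_self)
  then obtain B where B: "nonneg_operator B" "\<And>f. B (B f) = cadjoint A (A f)"
    using ex_sqrt_nonneg by blast
  have "abs_op A = B"
    unfolding abs_op_def
  proof (rule the_equality)
    show "nonneg_operator B \<and> B \<circ> B = cadjoint A \<circ> A" using B by (auto simp: fun_eq_iff)
    fix C assume "nonneg_operator C \<and> C \<circ> C = cadjoint A \<circ> A"
    then show "C = B" using B by (intro sqrt_nonneg_unique) (auto simp: fun_eq_iff)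
  qed
  with B show "nonneg_operator (abs_op A)" "abs_op A (abs_op A f) = cadjoint A (A f)" by simp_all
qed

lemma norm_abs_op:
  fixes A :: "'h::complex_hilbert \<Rightarrow> 'h"
  assumes A: "bounded_clinear A"
  shows "norm (abs_op A f) = norm (A f)"
proof -
  have "complex_of_real ((norm (abs_op A f))\<^sup>2) = cinner f (abs_op A (abs_op A f))"
    unfolding cinner_self[symmetric] using nonneg_operator_selfadjoint[OF nonneg_abs_op[OF A]] by simp
  also have "\<dots> = complex_of_real ((norm (A f))\<^sup>2)"
    by (simp only: abs_op_abs_op[OF A] cinner_cadjoint[OF A, symmetric] cinner_self)
  finally show ?thesis by (simp only: of_real_eq_iff) simp
qed

lemma abs_op_nonneg:
  fixes A :: "'h::complex_hilbert \<Rightarrow> 'h"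
  assumes "nonneg_operator A"
  shows "abs_op A = A"
proof -
  have A: "bounded_clinear A" using assms by (rule nonneg_operator_bounded_clinear)
  have "cadjoint A = A" using assms by (intro cadjoint_eqI) (simp add: nonneg_operator_selfadjoint)
  then show ?thesis
    using nonneg_abs_op[OF A] assms abs_op_abs_op[OF A] by (intro sqrt_nonneg_unique) auto
qed

text \<open>The factor \<open>W\<close> is the extension by continuity of \<open>A f \<mapsto> B f\<close> to the closure of the range of
  \<open>A\<close>, composed with the orthogonal projection onto that closure.\<close>

lemma douglas_factorization:
  fixes A B :: "'h::complex_hilbert \<Rightarrow> 'h"
  assumes A: "bounded_clinear A" and B: "bounded_clinear B" and le: "\<And>f. norm (B f) \<le> norm (A f)"
  shows "\<exists>W. bounded_clinear W \<and> (\<forall>f. norm (W f) \<le> norm f) \<and> (\<forall>f. B f = W (A f))"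
proof -
  define V where "V = closure (range A)"
  have "complex_vector.subspace (range A)"
    unfolding complex_vector.subspace_def
    by (auto simp flip: bounded_clinear_add[OF A] bounded_clinear_scaleC[OF A] intro: rangeI)
       (metis A bounded_clinear_zero rangeI)
  then have V: "closed V" "complex_vector.subspace V" by (simp_all add: V_def subspace_closure)
  \<comment> \<open>The closure of the graph of \<open>A f \<mapsto> B f\<close>.\<close>
  define G where "G x y \<longleftrightarrow> (\<exists>s. (\<lambda>n. A (s n)) \<longlonglongrightarrow> x \<and> (\<lambda>n. B (s n)) \<longlonglongrightarrow> y)" for x y
  have Gadd: "G (x + x') (y + y')" if G: "G x y" "G x' y'" for x x' y y'
  proof -
    obtain s s' where "(\<lambda>n. A (s n)) \<longlonglongrightarrow> x" "(\<lambda>n. B (s n)) \<longlonglongrightarrow> y"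
      "(\<lambda>n. A (s' n)) \<longlonglongrightarrow> x'" "(\<lambda>n. B (s' n)) \<longlonglongrightarrow> y'" using G unfolding G_def by blast
    then show ?thesis unfolding G_def
      by (intro exI[of _ "\<lambda>n. s n + s' n"])
         (auto simp: bounded_clinear_add[OF A] bounded_clinear_add[OF B] intro: tendsto_add)
  qed
  have Gscale: "G (c *\<^sub>C x) (c *\<^sub>C y)" if G: "G x y" for c x y
  proof -
    obtain s where "(\<lambda>n. A (s n)) \<longlonglongrightarrow> x" "(\<lambda>n. B (s n)) \<longlonglongrightarrow> y" using G by (auto simp: G_def)
    then show ?thesis unfolding G_def
      by (intro exI[of _ "\<lambda>n. c *\<^sub>C s n"])
         (auto simp: bounded_clinear_scaleC[OF A] bounded_clinear_scaleC[OF B] intro: tendsto_scaleC_right)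
  qed
  have Gle: "norm y \<le> norm x" if G: "G x y" for x y
  proof -
    obtain s where "(\<lambda>n. A (s n)) \<longlonglongrightarrow> x" "(\<lambda>n. B (s n)) \<longlonglongrightarrow> y" using G by (auto simp: G_def)
    then show ?thesis using le by (intro LIMSEQ_le[OF tendsto_norm tendsto_norm]) auto
  qed
  have Gex: "\<exists>y. G x y" if x: "x \<in> V" for x
  proof -
    obtain a where a: "\<And>n. a n \<in> range A" "a \<longlonglongrightarrow> x" using x unfolding V_def closure_sequential by blast
    then have "\<forall>n. \<exists>f. a n = A f" by blast
    then obtain s where "\<forall>n. a n = A (s n)" by metis
    then have "a = (\<lambda>n. A (s n))" by blast
    with a(2) have s: "(\<lambda>n. A (s n)) \<longlonglongrightarrow> x" by simp
    have "Cauchy (\<lambda>n. B (s n))"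
    proof (rule metric_CauchyI)
      fix e :: real assume "e > 0"
      then obtain M where "\<forall>m\<ge>M. \<forall>n\<ge>M. dist (A (s m)) (A (s n)) < e"
        using LIMSEQ_imp_Cauchy[OF s] metric_CauchyD by blast
      moreover have "dist (B (s m)) (B (s n)) \<le> dist (A (s m)) (A (s n))" for m n
        using le[of "s m - s n"] by (simp add: dist_norm bounded_clinear_diff[OF A] bounded_clinear_diff[OF B])
      ultimately show "\<exists>M. \<forall>m\<ge>M. \<forall>n\<ge>M. dist (B (s m)) (B (s n)) < e" by (meson order.strict_trans1)
    qed
    then show ?thesis using s Cauchy_convergent unfolding G_def convergent_def by blast
  qed
  \<comment> \<open>The graph of \<open>W\<close>, with \<open>p\<close> the orthogonal projection of \<open>f\<close> to \<open>V\<close>.\<close>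
  define H where "H f y \<longleftrightarrow> (\<exists>p\<in>V. (\<forall>v\<in>V. cinner (f - p) v = 0) \<and> G p y)" for f y
  have Hadd: "H (f + f') (y + y')" if H: "H f y" "H f' y'" for f f' y y'
  proof -
    obtain p p' where "p \<in> V" "\<forall>v\<in>V. cinner (f - p) v = 0" "G p y"
      "p' \<in> V" "\<forall>v\<in>V. cinner (f' - p') v = 0" "G p' y'" using H by (auto simp: H_def)
    then show ?thesis unfolding H_def using V
      by (intro bexI[of _ "p + p'"]) (auto simp: cinner_linear Gadd complex_vector.subspace_add)
  qed
  have Hscale: "H (c *\<^sub>C f) (c *\<^sub>C y)" if H: "H f y" for c f y
  proof -
    obtain p where "p \<in> V" "\<forall>v\<in>V. cinner (f - p) v = 0" "G p y" using H by (auto simp: H_def)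
    then show ?thesis unfolding H_def using V
      by (intro bexI[of _ "c *\<^sub>C p"])
         (auto simp: Gscale complex_vector.subspace_scale cinner_linear)
  qed
  have Hle: "norm y \<le> norm f" if H: "H f y" for f y
  proof -
    obtain p where p: "p \<in> V" "\<forall>v\<in>V. cinner (f - p) v = 0" "G p y" using H by (auto simp: H_def)
    then have "complex_of_real ((norm p)\<^sup>2) = cinner f p" by (simp add: cinner_self[symmetric] cinner_linear del: of_real_power)
    then have "(norm p)\<^sup>2 = cmod (cinner f p)" by (metis abs_of_nonneg norm_of_real zero_le_power2)
    then have "norm p * norm p \<le> norm f * norm p" using cmod_cinner_le[of f p] by (simp add: power2_eq_square)
    then have "norm p \<le> norm f" by (cases "norm p = 0") (auto simp: mult_le_cancel_right)
    then show ?thesis using Gle[OF p(3)] by simp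
  qed
  have Hunique: "y = y'" if "H f y" "H f y'" for f y y'
    using Hle[OF Hadd[OF that(1) Hscale[OF that(2), of "-1"]]]
    by (simp add: complex_vector.scale_minus_left scaleC_one)
  have "\<exists>y. H f y" for f
    using orthogonal_projection[OF V, of f] Gex unfolding H_def by blast
  then obtain W where W: "\<And>f. H f (W f)" by metis
  have "bounded_clinear W"
    by (rule bounded_clinearI[where K = 1]) (use W Hadd Hscale Hle Hunique in \<open>auto, meson+\<close>)
  moreover have "B f = W (A f)" for f
  proof -
    have "G (A f) (B f)" unfolding G_def by (intro exI[of _ "\<lambda>_. f"]) simp
    moreover have "A f \<in> V" using closure_subset[of "range A"] by (auto simp: V_def)
    ultimately have "H (A f) (B f)" unfolding H_def by (intro bexI[of _ "A f"]) auto
    then show ?thesis using W Hunique by blast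
  qed
  ultimately show ?thesis using Hle[OF W] by blast
qed

section \<open>Nuclear representations and the trace\<close>

text \<open>Series \<open>A f = \<Sum>\<^sub>i \<langle>f, x\<^sub>i\<rangle> y\<^sub>i\<close> with \<open>\<Sum>\<^sub>i \<parallel>x\<^sub>i\<parallel> \<parallel>y\<^sub>i\<parallel> < \<infinity>\<close> describe exactly the trace class operators.
  The absolute value is awkward to handle under sums and partial traces, whereas these series can simply
  be concatenated and transformed term by term.\<close>

definition nuclear_rep :: "('h::complex_inner \<Rightarrow> 'h) \<Rightarrow> 'i set \<Rightarrow> ('i \<Rightarrow> 'h) \<Rightarrow> ('i \<Rightarrow> 'h) \<Rightarrow> bool" where
  "nuclear_rep A I x y \<longleftrightarrow> (\<lambda>i. norm (x i) * norm (y i)) summable_on I \<and>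
     (\<forall>f. ((\<lambda>i. cinner f (x i) *\<^sub>C y i) has_sum A f) I)"

lemma nuclear_rep_summable: "nuclear_rep A I x y \<Longrightarrow> (\<lambda>i. norm (x i) * norm (y i)) summable_on I"
  by (simp add: nuclear_rep_def)

lemma nuclear_rep_has_sum: "nuclear_rep A I x y \<Longrightarrow> ((\<lambda>i. cinner f (x i) *\<^sub>C y i) has_sum A f) I"
  by (simp add: nuclear_rep_def)

lemma norm_nuclear_term:
  "norm (cinner f x *\<^sub>C y) \<le> norm (f :: 'h :: complex_inner) * (norm x * norm (y :: 'h))"
  using mult_right_mono[OF cmod_cinner_le[of f x], of "norm y"] by (simp add: mult.assoc)

lemma nuclear_rep_infsum:
  fixes x y :: "'i \<Rightarrow> 'h::complex_hilbert"
  assumes s: "(\<lambda>i. norm (x i) * norm (y i)) summable_on I"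
  shows "nuclear_rep (\<lambda>f. \<Sum>\<^sub>\<infinity>i\<in>I. cinner f (x i) *\<^sub>C y i) I x y"
proof -
  have "(\<lambda>i. cinner f (x i) *\<^sub>C y i) summable_on I" for f
    by (rule Infinite_Sum.abs_summable_summable, rule Infinite_Sum.abs_summable_on_comparison_test'[OF summable_on_cmult_right[OF s]])
       (rule norm_nuclear_term)
  then show ?thesis using s by (simp add: nuclear_rep_def)
qed

lemma nuclear_rep_norm_le:
  assumes "nuclear_rep A I x y"
  shows "norm (A f) \<le> (\<Sum>\<^sub>\<infinity>i\<in>I. norm (x i) * norm (y i)) * norm f"
proof -
  have "((\<lambda>i. norm f * (norm (x i) * norm (y i))) has_sum norm f * (\<Sum>\<^sub>\<infinity>i\<in>I. norm (x i) * norm (y i))) I"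
    by (intro has_sum_cmult_right has_sum_infsum nuclear_rep_summable[OF assms])
  then have "norm (A f) \<le> norm f * (\<Sum>\<^sub>\<infinity>i\<in>I. norm (x i) * norm (y i))"
    by (rule norm_infsum_le[OF nuclear_rep_has_sum[OF assms]]) (rule norm_nuclear_term)
  then show ?thesis by (simp add: mult.commute)
qed

lemma nuclear_rep_bounded_clinear:
  assumes A: "nuclear_rep A I x y"
  shows "bounded_clinear A"
proof (rule bounded_clinearI[OF _ _ nuclear_rep_norm_le[OF A]])
  note hs = nuclear_rep_has_sum[OF A]
  show "A (f + g) = A f + A g" for f g
    using has_sum_unique[OF hs[of "f + g"]] has_sum_add[OF hs[of f] hs[of g]]
    by (simp add: cinner_linear scaleC_add_left)
  show "A (c *\<^sub>C f) = c *\<^sub>C A f" for c f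
    using has_sum_unique[OF hs[of "c *\<^sub>C f"]] has_sum_bounded_linear[OF bounded_linear_scaleC hs[of f], of c]
    by (simp add: cinner_linear scaleC_scaleC)
qed

lemma has_sum_Plus:
  fixes f :: "'i + 'j \<Rightarrow> 'a::topological_comm_monoid_add"
  assumes "((\<lambda>i. f (Inl i)) has_sum a) I" "((\<lambda>j. f (Inr j)) has_sum b) J"
  shows "(f has_sum (a + b)) (I <+> J)"
  unfolding Plus_def
proof (rule has_sum_Un_disjoint)
  show "(f has_sum a) (Inl ` I)" "(f has_sum b) (Inr ` J)"
    using assms by (simp_all add: has_sum_reindex o_def)
qed auto

lemma nuclear_rep_plus:
  fixes A B :: "'h::complex_hilbert \<Rightarrow> 'h"
  assumes A: "nuclear_rep A I x y" and B: "nuclear_rep B J x' y'"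
  shows "nuclear_rep (\<lambda>f. A f + B f) (I <+> J) (case_sum x x') (case_sum y y')"
proof -
  have "((\<lambda>k. norm (case_sum x x' k) * norm (case_sum y y' k)) has_sum
      (\<Sum>\<^sub>\<infinity>i\<in>I. norm (x i) * norm (y i)) + (\<Sum>\<^sub>\<infinity>j\<in>J. norm (x' j) * norm (y' j))) (I <+> J)"
    by (rule has_sum_Plus) (simp_all add: nuclear_rep_summable[OF A] nuclear_rep_summable[OF B])
  then show ?thesis
    unfolding nuclear_rep_def
    by (intro conjI allI has_sum_imp_summable has_sum_Plus)
       (simp_all add: nuclear_rep_has_sum[OF A] nuclear_rep_has_sum[OF B])
qed

lemma nuclear_rep_compose_left:
  assumes A: "nuclear_rep A I x y" and W: "bounded_clinear W"
  shows "nuclear_rep (\<lambda>f. W (A f)) I x (\<lambda>i. W (y i))"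
proof -
  obtain K where K: "\<And>f. norm (W f) \<le> norm f * K"
    using bounded_linear.bounded[OF bounded_clinear_bounded_linear[OF W]] by blast
  have le: "norm (x i) * norm (W (y i)) \<le> norm (x i) * norm (y i) * K" for i
    using mult_left_mono[OF K, of "norm (x i)" "y i"] by (simp add: mult.assoc)
  have "(\<lambda>i. norm (norm (x i) * norm (W (y i)))) summable_on I"
    by (rule Infinite_Sum.abs_summable_on_comparison_test'[OF summable_on_cmult_left[OF nuclear_rep_summable[OF A]]])
       (use le in simp)
  moreover have "((\<lambda>i. cinner f (x i) *\<^sub>C W (y i)) has_sum W (A f)) I" for f
    using has_sum_bounded_linear[OF bounded_clinear_bounded_linear[OF W] nuclear_rep_has_sum[OF A, of f]]
    by (simp add: bounded_clinear_scaleC[OF W])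
  ultimately show ?thesis by (simp add: nuclear_rep_def)
qed

lemma orthonormal_product_sum_le:
  fixes x y :: "'h::complex_inner"
  assumes "orthonormal E" "F \<subseteq> E" "finite F"
  shows "(\<Sum>e\<in>F. cmod (cinner e x * cinner y e)) \<le> norm x * norm y"
proof -
  have "(\<Sum>e\<in>F. cmod (cinner e x * cinner y e)) = (\<Sum>e\<in>F. \<bar>cmod (cinner x e)\<bar> * \<bar>cmod (cinner y e)\<bar>)"
    by (simp add: norm_mult cmod_cinner_commute[of _ x])
  also have "\<dots> \<le> L2_set (\<lambda>e. cmod (cinner x e)) F * L2_set (\<lambda>e. cmod (cinner y e)) F"
    by (rule L2_set_mult_ineq)
  also have "\<dots> \<le> norm x * norm y"
    unfolding L2_set_def
    by (intro mult_mono real_le_lsqrt bessel_finite[OF assms] real_sqrt_ge_zero sum_nonneg) auto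
  finally show ?thesis .
qed

text \<open>Expanding \<open>A e\<close> produces the double series of \<open>\<langle>e, x\<^sub>i\<rangle> \<langle>y\<^sub>i, e\<rangle>\<close>, which converges absolutely by
  Bessel's inequality; summed over \<open>e\<close> first, Parseval's identity turns it into \<open>\<Sum>\<^sub>i \<langle>y\<^sub>i, x\<^sub>i\<rangle>\<close>. In particular
  the trace is independent of the basis.\<close>

lemma nuclear_rep_trace_has_sum:
  fixes A :: "'h::complex_hilbert \<Rightarrow> 'h"
  assumes A: "nuclear_rep A I x y" and E: "is_onb E"
  shows "(\<lambda>i. cmod (cinner (y i) (x i))) summable_on I"
    and "((\<lambda>e. cinner (A e) e) has_sum (\<Sum>\<^sub>\<infinity>i\<in>I. cinner (y i) (x i))) E"
proof -
  define g where "g = (\<lambda>(i, e). cinner e (x i) * cinner (y i) e)"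
  have inner_summable: "(\<lambda>e. norm (g (i, e))) summable_on E" for i
    by (rule nonneg_bdd_above_summable_on)
       (auto simp: g_def intro!: bdd_aboveI2 orthonormal_product_sum_le[OF onb_orthonormal[OF E]])
  have inner_le: "(\<Sum>\<^sub>\<infinity>e\<in>E. norm (g (i, e))) \<le> norm (x i) * norm (y i)" for i
    by (rule infsum_le_finite_sums[OF inner_summable])
       (auto simp: g_def intro!: orthonormal_product_sum_le[OF onb_orthonormal[OF E]])
  have "(\<lambda>i. norm (\<Sum>\<^sub>\<infinity>e\<in>E. norm (g (i, e)))) summable_on I"
    by (rule Infinite_Sum.abs_summable_on_comparison_test'[OF nuclear_rep_summable[OF A]])
       (simp add: infsum_nonneg inner_le)
  then have "(\<lambda>p. norm (g p)) summable_on I \<times> E"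
    by (intro iffD2[OF Infinite_Sum.abs_summable_on_Sigma_iff] conjI ballI inner_summable)
  then have g: "(g has_sum infsum g (I \<times> E)) (I \<times> E)"
    by (rule has_sum_infsum[OF Infinite_Sum.abs_summable_summable])
  have "((\<lambda>i. cinner (y i) (x i)) has_sum infsum g (I \<times> E)) I"
  proof (rule has_sum_Sigma'[OF g])
    show "((\<lambda>e. g (i, e)) has_sum cinner (y i) (x i)) E" for i
      using parseval[OF E, of "y i" "x i"] by (simp add: g_def mult.commute)
  qed
  then have tr: "(\<Sum>\<^sub>\<infinity>i\<in>I. cinner (y i) (x i)) = infsum g (I \<times> E)" by (rule infsumI)
  show "((\<lambda>e. cinner (A e) e) has_sum (\<Sum>\<^sub>\<infinity>i\<in>I. cinner (y i) (x i))) E"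
    unfolding tr
  proof (rule has_sum_Sigma')
    show "((\<lambda>(e, i). g (i, e)) has_sum infsum g (I \<times> E)) (E \<times> I)"
      by (rule iffD1[OF has_sum_swap g])
    show "((\<lambda>i. (\<lambda>(e, i). g (i, e)) (e, i)) has_sum cinner (A e) e) I" for e
      using has_sum_bounded_linear[OF bounded_linear_cinner_left nuclear_rep_has_sum[OF A, of e], of e]
      by (simp add: g_def cinner_scaleC_left)
  qed
  show "(\<lambda>i. cmod (cinner (y i) (x i))) summable_on I"
    by (rule Infinite_Sum.abs_summable_on_comparison_test'[OF nuclear_rep_summable[OF A]])
       (metis cmod_cinner_le mult.commute)
qed

lemma onb_SOME: "is_onb (SOME E :: 'h::complex_hilbert set. is_onb E)"
  using ex_onb by (rule someI_ex)

lemma nuclear_rep_trace: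
  fixes A :: "'h::complex_hilbert \<Rightarrow> 'h"
  assumes "nuclear_rep A I x y"
  shows "trace A = (\<Sum>\<^sub>\<infinity>i\<in>I. cinner (y i) (x i))"
  unfolding trace_def by (rule infsumI[OF nuclear_rep_trace_has_sum(2)[OF assms onb_SOME]])

text \<open>The factorization \<open>|A| = W A\<close> with a contraction \<open>W\<close> replaces \<open>y\<^sub>i\<close> by \<open>W y\<^sub>i\<close> and so transfers the
  representation to \<open>|A|\<close> without increasing the norms.\<close>

lemma nuclear_rep_trace_class:
  fixes A :: "'h::complex_hilbert \<Rightarrow> 'h"
  assumes A: "nuclear_rep A I x y"
  shows "A \<in> trace_class" "trace_norm A \<le> (\<Sum>\<^sub>\<infinity>i\<in>I. norm (x i) * norm (y i))"
proof -
  have bA: "bounded_clinear A" by (rule nuclear_rep_bounded_clinear[OF A])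
  then obtain W where W: "bounded_clinear W" "\<And>f. norm (W f) \<le> norm f" "\<And>f. abs_op A f = W (A f)"
    using douglas_factorization[OF bA nonneg_operator_bounded_clinear[OF nonneg_abs_op[OF bA]]]
    by (auto simp: norm_abs_op[OF bA])
  have rep: "nuclear_rep (abs_op A) I x (\<lambda>i. W (y i))"
    using nuclear_rep_compose_left[OF A W(1)] by (simp only: ext[of _ _, OF W(3), symmetric])
  show "A \<in> trace_class"
    using nuclear_rep_trace_has_sum(2)[OF rep onb_SOME] bA onb_SOME
    unfolding trace_class_def by (auto dest: has_sum_imp_summable)
  have le: "norm (cinner (W (y i)) (x i)) \<le> norm (x i) * norm (y i)" for i
    using order_trans[OF cmod_cinner_le mult_right_mono[OF W(2)], of "x i" "y i"]
    by (simp add: mult.commute)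
  have "trace_norm A \<le> cmod (trace (abs_op A))"
    unfolding trace_norm_def by (rule complex_Re_le_cmod)
  also have "\<dots> \<le> (\<Sum>\<^sub>\<infinity>i\<in>I. norm (x i) * norm (y i))"
    unfolding nuclear_rep_trace[OF rep]
    by (rule norm_infsum_le[OF has_sum_infsum has_sum_infsum])
       (use Infinite_Sum.abs_summable_summable[OF nuclear_rep_trace_has_sum(1)[OF rep onb_SOME]] nuclear_rep_summable[OF A] le in auto)
  finally show "trace_norm A \<le> (\<Sum>\<^sub>\<infinity>i\<in>I. norm (x i) * norm (y i))" .
qed

text \<open>With \<open>A = W |A|\<close> and \<open>S\<close> the square root of \<open>|A|\<close>, the expansion of \<open>S f\<close> in an orthonormal
  basis gives \<open>A f = \<Sum>\<^sub>e \<langle>f, S e\<rangle> W S e\<close>, and \<open>\<Sum>\<^sub>e \<parallel>S e\<parallel>\<^sup>2\<close> is the trace of \<open>|A|\<close>.\<close>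

lemma trace_class_nuclear_rep:
  fixes A :: "'h::complex_hilbert \<Rightarrow> 'h"
  assumes A: "A \<in> trace_class"
  shows "\<exists>(E :: 'h set) x y. nuclear_rep A E x y \<and> (\<Sum>\<^sub>\<infinity>e\<in>E. norm (x e) * norm (y e)) \<le> trace_norm A"
proof -
  have bA: "bounded_clinear A" using A by (simp add: trace_class_def)
  note nA = nonneg_abs_op[OF bA]
  obtain E where E: "is_onb E" "(\<lambda>e. cinner (abs_op A e) e) summable_on E"
    using A by (auto simp: trace_class_def)
  obtain S where S: "nonneg_operator S" "\<And>f. S (S f) = abs_op A f"
    using ex_sqrt_nonneg[OF nA] by blast
  have bS: "bounded_clinear S" by (rule nonneg_operator_bounded_clinear[OF S(1)])
  obtain W where W: "bounded_clinear W" "\<And>f. norm (W f) \<le> norm f" "\<And>f. A f = W (abs_op A f)"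
    using douglas_factorization[OF nonneg_operator_bounded_clinear[OF nA] bA]
    by (auto simp: norm_abs_op[OF bA])
  have sq: "cinner (abs_op A e) e = complex_of_real (norm (S e) * norm (S e))" for e
    using nonneg_operator_selfadjoint[OF S(1), of "S e" e] by (simp add: S(2) cinner_self power2_eq_square)
  have s: "(\<lambda>e. norm (S e) * norm (S e)) summable_on E"
    using summable_on_Re[OF E(2)] by (simp add: sq)
  have "((\<lambda>e. cinner f (S e) *\<^sub>C S e) has_sum abs_op A f) E" for f
    using has_sum_bounded_linear[OF bounded_clinear_bounded_linear[OF bS] onb_expansion[OF E(1), of "S f"]]
    by (simp add: bounded_clinear_scaleC[OF bS] S(2) nonneg_operator_selfadjoint[OF S(1)])
  then have rep: "nuclear_rep (abs_op A) E S S" using s by (simp add: nuclear_rep_def)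
  have "trace_norm A = Re (\<Sum>\<^sub>\<infinity>e\<in>E. complex_of_real (norm (S e) * norm (S e)))"
    unfolding trace_norm_def nuclear_rep_trace[OF rep] by (simp add: cinner_self power2_eq_square)
  also have "\<dots> = (\<Sum>\<^sub>\<infinity>e\<in>E. norm (S e) * norm (S e))"
    using infsumI[OF has_sum_of_real[OF has_sum_infsum[OF s]]] by (metis Re_complex_of_real)
  finally have tn: "trace_norm A = (\<Sum>\<^sub>\<infinity>e\<in>E. norm (S e) * norm (S e))" .
  have rep': "nuclear_rep A E S (\<lambda>e. W (S e))"
    using nuclear_rep_compose_left[OF rep W(1)] by (simp only: ext[of _ _, OF W(3), symmetric])
  have "(\<Sum>\<^sub>\<infinity>e\<in>E. norm (S e) * norm (W (S e))) \<le> trace_norm A"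
    unfolding tn using W(2)
    by (intro infsum_mono nuclear_rep_summable[OF rep'] s mult_left_mono) auto
  with rep' show ?thesis by blast
qed

lemma trace_class_bounded_clinear: "A \<in> trace_class \<Longrightarrow> bounded_clinear A"
  by (simp add: trace_class_def)

lemma trace_class_norm_le:
  fixes A :: "'h::complex_hilbert \<Rightarrow> 'h"
  assumes "A \<in> trace_class"
  shows "norm (A f) \<le> trace_norm A * norm f"
proof -
  obtain E x y where "nuclear_rep A (E :: 'h set) x y"
    and "(\<Sum>\<^sub>\<infinity>e\<in>E. norm (x e) * norm (y e)) \<le> trace_norm A"
    using trace_class_nuclear_rep[OF assms] by blast
  then show ?thesis using order_trans[OF nuclear_rep_norm_le mult_right_mono] norm_ge_zero by blast
qed

lemma trace_class_plus:
  fixes A B :: "'h::complex_hilbert \<Rightarrow> 'h"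
  assumes "A \<in> trace_class" "B \<in> trace_class"
  shows "(\<lambda>f. A f + B f) \<in> trace_class"
proof -
  obtain E x y and E' x' y' where
    "nuclear_rep A (E :: 'h set) x y" "nuclear_rep B (E' :: 'h set) x' y'"
    using assms[THEN trace_class_nuclear_rep] by blast
  from nuclear_rep_trace_class(1)[OF nuclear_rep_plus[OF this]] show ?thesis .
qed

lemma
  fixes A :: "'h::complex_hilbert \<Rightarrow> 'h"
  assumes A: "A \<in> trace_class"
  shows trace_class_scale: "(\<lambda>f. c *\<^sub>C A f) \<in> trace_class"
    and trace_norm_scale_le: "trace_norm (\<lambda>f. c *\<^sub>C A f) \<le> cmod c * trace_norm A"
proof -
  obtain E x y where rep: "nuclear_rep A (E :: 'h set) x y"
    and le: "(\<Sum>\<^sub>\<infinity>e\<in>E. norm (x e) * norm (y e)) \<le> trace_norm A"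
    using trace_class_nuclear_rep[OF A] by blast
  have "bounded_clinear (scaleC c :: 'h \<Rightarrow> 'h)"
    by (auto simp: bounded_clinear_def bounded_linear_scaleC scaleC_scaleC mult.commute)
  from nuclear_rep_compose_left[OF rep this]
  have rep': "nuclear_rep (\<lambda>f. c *\<^sub>C A f) E x (\<lambda>e. c *\<^sub>C y e)" .
  show "(\<lambda>f. c *\<^sub>C A f) \<in> trace_class" by (rule nuclear_rep_trace_class(1)[OF rep'])
  have "trace_norm (\<lambda>f. c *\<^sub>C A f) \<le> (\<Sum>\<^sub>\<infinity>e\<in>E. cmod c * (norm (x e) * norm (y e)))"
    using nuclear_rep_trace_class(2)[OF rep'] by (simp add: mult.left_commute)
  also have "\<dots> = cmod c * (\<Sum>\<^sub>\<infinity>e\<in>E. norm (x e) * norm (y e))"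
    by (rule infsum_cmult_right) (rule nuclear_rep_summable[OF rep])
  finally show "trace_norm (\<lambda>f. c *\<^sub>C A f) \<le> cmod c * trace_norm A"
    using mult_left_mono[OF le, of "cmod c"] by simp
qed

lemma trace_class_diff:
  fixes A B :: "'h::complex_hilbert \<Rightarrow> 'h"
  assumes "A \<in> trace_class" "B \<in> trace_class"
  shows "(\<lambda>f. A f - B f) \<in> trace_class"
  using trace_class_plus[OF assms(1) trace_class_scale[OF assms(2), of "-1"]]
  by simp

lemma trace_has_sum:
  fixes A :: "'h::complex_hilbert \<Rightarrow> 'h"
  assumes "A \<in> trace_class" "is_onb E"
  shows "((\<lambda>e. cinner (A e) e) has_sum trace A) E"
proof -
  obtain E x y where "nuclear_rep A (E :: 'h set) x y"
    using trace_class_nuclear_rep[OF assms(1)] by blast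
  then show ?thesis using nuclear_rep_trace_has_sum(2)[OF _ assms(2)] nuclear_rep_trace by metis
qed

lemma nonneg_trace_classI:
  fixes A :: "'h::complex_hilbert \<Rightarrow> 'h"
  assumes A: "nonneg_operator A" and E: "is_onb E" and s: "(\<lambda>e. Re (cinner (A e) e)) summable_on E"
  shows "A \<in> trace_class"
proof -
  have "Im (cinner (A e) e) = 0" for e
    using arg_cong[OF cinner_commute[of "A e" e], of Im] nonneg_operator_selfadjoint[OF A, of e e] by simp
  then have "cinner (A e) e = complex_of_real (Re (cinner (A e) e))" for e
    by (simp add: complex_eq_iff)
  then have "(\<lambda>e. cinner (abs_op A e) e) = (\<lambda>e. complex_of_real (Re (cinner (A e) e)))"
    unfolding abs_op_nonneg[OF A] by (rule ext)
  then have "(\<lambda>e. cinner (abs_op A e) e) summable_on E"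
    using summable_on_of_real[OF s] by simp
  then show ?thesis
    using E nonneg_operator_bounded_clinear[OF A] by (auto simp: trace_class_def)
qed

definition rank_one :: "'h::complex_inner \<Rightarrow> 'h \<Rightarrow> 'h \<Rightarrow> 'h" where
  "rank_one x y f = cinner f x *\<^sub>C y"

lemma
  fixes x y :: "'h::complex_hilbert"
  shows rank_one_trace_class: "rank_one x y \<in> trace_class"
    and trace_norm_rank_one_le: "trace_norm (rank_one x y) \<le> norm x * norm y"
proof -
  have "nuclear_rep (rank_one x y) {()} (\<lambda>_. x) (\<lambda>_. y)"
    by (simp add: nuclear_rep_def rank_one_def has_sum_finite_iff)
  from nuclear_rep_trace_class[OF this]
  show "rank_one x y \<in> trace_class" "trace_norm (rank_one x y) \<le> norm x * norm y" by simp_all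
qed

text \<open>The difference to a partial sum is represented by the remaining terms of the series.\<close>

lemma finite_rank_approximation:
  fixes A :: "'h::complex_hilbert \<Rightarrow> 'h"
  assumes A: "A \<in> trace_class" and "0 < \<epsilon>"
  shows "\<exists>(I :: 'h set) x y. finite I \<and> trace_norm (\<lambda>f. A f - (\<Sum>i\<in>I. rank_one (x i) (y i) f)) \<le> \<epsilon>"
proof -
  obtain E x y where rep: "nuclear_rep A (E :: 'h set) x y"
    using trace_class_nuclear_rep[OF A] by blast
  note s = nuclear_rep_summable[OF rep]
  obtain I where I: "finite I" "I \<subseteq> E"
    "dist (\<Sum>e\<in>I. norm (x e) * norm (y e)) (\<Sum>\<^sub>\<infinity>e\<in>E. norm (x e) * norm (y e)) \<le> \<epsilon>"
    using infsum_finite_approximation[OF s \<open>0 < \<epsilon>\<close>] by blast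
  have rest: "((\<lambda>e. norm (x e) * norm (y e)) has_sum
      ((\<Sum>\<^sub>\<infinity>e\<in>E. norm (x e) * norm (y e)) - (\<Sum>e\<in>I. norm (x e) * norm (y e)))) (E - I)"
    by (rule has_sum_Diff[OF has_sum_infsum[OF s] has_sum_finite[OF I(1)] I(2)])
  have "((\<lambda>e. cinner f (x e) *\<^sub>C y e) has_sum (A f - (\<Sum>e\<in>I. rank_one (x e) (y e) f))) (E - I)" for f
    unfolding rank_one_def
    by (rule has_sum_Diff[OF nuclear_rep_has_sum[OF rep] has_sum_finite[OF I(1)] I(2)])
  then have "nuclear_rep (\<lambda>f. A f - (\<Sum>i\<in>I. rank_one (x i) (y i) f)) (E - I) x y"
    using has_sum_imp_summable[OF rest] by (simp add: nuclear_rep_def)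
  then have "trace_norm (\<lambda>f. A f - (\<Sum>i\<in>I. rank_one (x i) (y i) f)) \<le> \<epsilon>"
    using nuclear_rep_trace_class(2) infsumI[OF rest] I(3) unfolding dist_real_def by fastforce
  then show ?thesis using I(1) by blast
qed

section \<open>Partial traces on abstract Hilbert tensor products\<close>

text \<open>Only these properties of the tensor product of two Hilbert spaces matter for the partial
  trace. Keeping the product map abstract yields both partial traces at once, the second one by
  exchanging the two factors.\<close>

locale hilbert_tensor =
  fixes ten :: "'a::complex_hilbert \<Rightarrow> 'b::complex_hilbert \<Rightarrow> 'c::complex_hilbert"
  assumes ten_add_left: "ten (f + f') g = ten f g + ten f' g"
    and ten_add_right: "ten f (g + g') = ten f g + ten f g'"
    and ten_scaleC_left: "ten (c *\<^sub>C f) g = c *\<^sub>C ten f g"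
    and ten_scaleC_right: "ten f (c *\<^sub>C g) = c *\<^sub>C ten f g"
    and cinner_ten: "cinner (ten f g) (ten f' g') = cinner f f' * cinner g g'"
    and ten_dense: "(\<And>f g. cinner h (ten f g) = 0) \<Longrightarrow> h = 0"
begin

lemma norm_ten: "norm (ten f g) = norm f * norm g"
proof -
  have "complex_of_real ((norm (ten f g))\<^sup>2) = complex_of_real ((norm f * norm g)\<^sup>2)"
    unfolding cinner_self[symmetric] cinner_ten by (simp add: cinner_self power_mult_distrib)
  then show ?thesis by (simp only: of_real_eq_iff) (simp add: power2_eq_iff_nonneg)
qed

lemma bounded_linear_ten_left: "bounded_linear (\<lambda>f. ten f g)"
  by (rule bounded_linear_intro[where K = "norm g"])
     (simp_all add: ten_add_left scaleR_scaleC ten_scaleC_left norm_ten)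

lemma bounded_linear_ten_right: "bounded_linear (ten f)"
  by (rule bounded_linear_intro[where K = "norm f"])
     (simp_all add: ten_add_right scaleR_scaleC ten_scaleC_right norm_ten)

lemma closed_subspace_containing_ten:
  assumes "closed V" "complex_vector.subspace V" "\<And>f g. ten f g \<in> V"
  shows "h \<in> V"
proof -
  have "closure (complex_vector.span (range (\<lambda>(f, g). ten f g))) = UNIV"
    by (rule closure_span_eq_UNIV) (auto intro: ten_dense)
  moreover have "closure (complex_vector.span (range (\<lambda>(f, g). ten f g))) \<subseteq> V"
    using assms by (intro closure_minimal complex_vector.span_minimal) auto
  ultimately show ?thesis by auto
qed

text \<open>The adjoint of \<open>f \<mapsto> ten f g\<close>.\<close>

definition slice :: "'b \<Rightarrow> 'c \<Rightarrow> 'a" where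
  "slice g h = (SOME u. \<forall>f. cinner (ten f g) h = cinner f u)"

lemma cinner_slice: "cinner f (slice g h) = cinner (ten f g) h"
proof -
  have "\<exists>u. \<forall>f. cinner (ten f g) h = cinner f u"
    by (rule riesz_representation)
       (auto intro: bounded_linear_compose[OF bounded_linear_cinner_left bounded_linear_ten_left]
         simp: ten_scaleC_left cinner_linear)
  from someI_ex[OF this] show ?thesis unfolding slice_def by (rule allE) (erule sym)
qed

lemma slice_ten: "slice e (ten f g) = cinner g e *\<^sub>C f"
  by (rule eq_by_cinner_left)
     (simp add: cinner_slice cinner_ten cinner_linear, metis cinner_commute mult.commute)

lemma slice_scaleC: "slice e (c *\<^sub>C h) = c *\<^sub>C slice e h"
  by (rule eq_by_cinner_left) (simp add: cinner_slice cinner_linear)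

lemma bounded_linear_slice: "bounded_linear (slice e)"
proof (rule bounded_linear_intro[where K = "norm e"])
  show "slice e (h + k) = slice e h + slice e k" for h k
    by (rule eq_by_cinner_left) (simp add: cinner_slice cinner_linear)
  show "slice e (r *\<^sub>R h) = r *\<^sub>R slice e h" for r h
    by (simp add: scaleR_scaleC slice_scaleC)
  show "norm (slice e h) \<le> norm h * norm e" for h
  proof -
    have "(norm (slice e h))\<^sup>2 = cmod (cinner (ten (slice e h) e) h)"
      by (simp add: cinner_slice[symmetric] cinner_self norm_power)
    also have "\<dots> \<le> norm (slice e h) * norm e * norm h"
      using cmod_cinner_le[of "ten (slice e h) e" h] by (simp add: norm_ten)
    finally have "norm (slice e h) * norm (slice e h) \<le> norm (slice e h) * (norm h * norm e)"
      by (simp add: power2_eq_square mult_ac)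
    then show ?thesis by (cases "norm (slice e h) = 0") (auto simp: mult_le_cancel_left)
  qed
qed

text \<open>Bessel's inequality for the mutually orthogonal subspaces of vectors \<open>ten f e\<close> with \<open>e \<in> E\<close>: the vector
  \<open>v = \<Sum>\<^sub>e ten (slice e h) e\<close> satisfies \<open>\<langle>v, h\<rangle> = \<parallel>v\<parallel>\<^sup>2\<close>.\<close>

lemma slice_bessel:
  assumes E: "orthonormal E" "F \<subseteq> E" "finite F"
  shows "(\<Sum>e\<in>F. (norm (slice e h))\<^sup>2) \<le> (norm h)\<^sup>2"
proof -
  let ?v = "\<Sum>e\<in>F. ten (slice e h) e" and ?s = "\<Sum>e\<in>F. (norm (slice e h))\<^sup>2"
  have vh: "cinner ?v h = complex_of_real ?s"
    by (simp add: cinner_linear cinner_slice[symmetric] cinner_self)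
  have "cinner ?v ?v = (\<Sum>e\<in>F. \<Sum>e'\<in>F. cinner (slice e h) (slice e' h) * cinner e e')"
    by (simp add: cinner_linear cinner_ten) (rule sum.swap)
  also have "\<dots> = (\<Sum>e\<in>F. \<Sum>e'\<in>F. if e = e' then cinner (slice e h) (slice e' h) else 0)"
    using E by (intro sum.cong refl) (auto simp: orthonormal_cinner subset_iff)
  also have "\<dots> = complex_of_real ?s"
    using E(3) by (simp add: cinner_self)
  finally have "(norm ?v)\<^sup>2 = ?s" unfolding cinner_self by (simp only: of_real_eq_iff)
  moreover have "?s \<le> norm ?v * norm h"
    using cmod_cinner_le[of ?v h] unfolding vh by (simp add: sum_nonneg del: of_real_sum of_real_power)
  ultimately have "norm ?v * norm ?v \<le> norm ?v * norm h" by (simp add: power2_eq_square)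
  then have "norm ?v \<le> norm h" by (cases "norm ?v = 0") (auto simp: mult_le_cancel_left)
  then show ?thesis using \<open>(norm ?v)\<^sup>2 = ?s\<close> power_mono[of "norm ?v" "norm h" 2] by simp
qed

lemma slice_product_sum_le:
  assumes E: "orthonormal E" "F \<subseteq> E" "finite F"
  shows "(\<Sum>e\<in>F. norm (slice e x) * norm (slice e y)) \<le> norm x * norm y"
proof -
  have "(\<Sum>e\<in>F. norm (slice e x) * norm (slice e y))
      \<le> L2_set (\<lambda>e. norm (slice e x)) F * L2_set (\<lambda>e. norm (slice e y)) F"
    using L2_set_mult_ineq[of "\<lambda>e. norm (slice e x)" "\<lambda>e. norm (slice e y)" F] by simp
  also have "\<dots> \<le> norm x * norm y"
    unfolding L2_set_def
    by (intro mult_mono real_le_lsqrt slice_bessel[OF E] real_sqrt_ge_zero sum_nonneg) auto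
  finally show ?thesis .
qed

text \<open>With \<open>J\<^sub>e f = ten f e\<close> this is \<open>\<Sum>\<^sub>e J\<^sub>e\<^sup>* A J\<^sub>e\<close>, the operator given by \<open>\<langle>ptr A f, g\<rangle> = \<Sum>\<^sub>e \<langle>A (ten f e), ten g e\<rangle>\<close>.\<close>

definition ptr :: "('c \<Rightarrow> 'c) \<Rightarrow> 'a \<Rightarrow> 'a" where
  "ptr A f = (\<Sum>\<^sub>\<infinity>e\<in>(SOME E. is_onb E). slice e (A (ten f e)))"

text \<open>Slicing each term of a representation of \<open>A\<close> along a basis of the second factor represents the
  partial trace; by Bessel's inequality for slices the sum of the norms does not increase, which makes
  the partial trace a contraction for the trace norm.\<close>

lemma nuclear_rep_ptr:
  fixes I :: "'i set"
  assumes A: "nuclear_rep A I x y"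
  defines "E \<equiv> SOME E. is_onb E"
  shows "nuclear_rep (ptr A) (I \<times> E) (\<lambda>(i, e). slice e (x i)) (\<lambda>(i, e). slice e (y i))"
    and "(\<Sum>\<^sub>\<infinity>(i, e)\<in>I \<times> E. norm (slice e (x i)) * norm (slice e (y i))) \<le> (\<Sum>\<^sub>\<infinity>i\<in>I. norm (x i) * norm (y i))"
    and "(\<lambda>e. slice e (A (ten f e))) summable_on E"
proof -
  have onb: "is_onb E" unfolding E_def by (rule onb_SOME)
  define n where "n = (\<lambda>(i, e). norm (slice e (x i)) * norm (slice e (y i)))"
  have n0: "norm (n p) = n p" for p by (simp add: n_def split: prod.split)
  have inner_summable: "(\<lambda>e. n (i, e)) summable_on E" for i
    by (rule nonneg_bdd_above_summable_on)
       (auto simp: n_def intro!: bdd_aboveI2 slice_product_sum_le[OF onb_orthonormal[OF onb]])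
  have inner_le: "(\<Sum>\<^sub>\<infinity>e\<in>E. n (i, e)) \<le> norm (x i) * norm (y i)" for i
    by (rule infsum_le_finite_sums[OF inner_summable])
       (auto simp: n_def intro!: slice_product_sum_le[OF onb_orthonormal[OF onb]])
  have nonneg: "0 \<le> (\<Sum>\<^sub>\<infinity>e\<in>E. n (i, e))" for i by (rule infsum_nonneg) (simp add: n_def)
  have outer: "(\<lambda>i. norm (\<Sum>\<^sub>\<infinity>e\<in>E. n (i, e))) summable_on I"
    by (rule Infinite_Sum.abs_summable_on_comparison_test'[OF nuclear_rep_summable[OF A]])
       (simp add: nonneg inner_le)
  have "(\<lambda>p. norm (n p)) summable_on I \<times> E"
    by (intro iffD2[OF Infinite_Sum.abs_summable_on_Sigma_iff] conjI ballI)
       (simp_all only: n0 inner_summable outer)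
  then have s: "n summable_on I \<times> E" by (simp only: n0)
  have "infsum n (I \<times> E) = (\<Sum>\<^sub>\<infinity>i\<in>I. \<Sum>\<^sub>\<infinity>e\<in>E. n (i, e))"
    by (rule infsum_Sigma_banach[OF s, symmetric])
  also have "\<dots> \<le> (\<Sum>\<^sub>\<infinity>i\<in>I. norm (x i) * norm (y i))"
    using outer nonneg by (intro infsum_mono inner_le nuclear_rep_summable[OF A]) simp
  finally show "(\<Sum>\<^sub>\<infinity>(i, e)\<in>I \<times> E. norm (slice e (x i)) * norm (slice e (y i))) \<le> (\<Sum>\<^sub>\<infinity>i\<in>I. norm (x i) * norm (y i))"
    by (simp add: n_def)
  let ?x = "\<lambda>(i, e). slice e (x i)" and ?y = "\<lambda>(i, e). slice e (y i)"
  define R where "R f = (\<Sum>\<^sub>\<infinity>p\<in>I \<times> E. cinner f (?x p) *\<^sub>C ?y p)" for f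
  have R: "nuclear_rep R (I \<times> E) ?x ?y"
    unfolding R_def using s by (intro nuclear_rep_infsum) (simp add: n_def case_prod_beta')
  have hs: "((\<lambda>e. slice e (A (ten f e))) has_sum R f) E" for f
  proof (rule has_sum_SigmaD)
    show "((\<lambda>(e, i). (\<lambda>p. cinner f (?x p) *\<^sub>C ?y p) (i, e)) has_sum R f) (E \<times> I)"
      by (rule iffD1[OF has_sum_swap nuclear_rep_has_sum[OF R]])
    fix e
    have "((\<lambda>i. slice e (cinner (ten f e) (x i) *\<^sub>C y i)) has_sum slice e (A (ten f e))) I"
      by (rule has_sum_bounded_linear[OF bounded_linear_slice nuclear_rep_has_sum[OF A]])
    then show "((\<lambda>i. (\<lambda>(e, i). (\<lambda>p. cinner f (?x p) *\<^sub>C ?y p) (i, e)) (e, i)) has_sum slice e (A (ten f e))) I"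
      by (simp add: slice_scaleC cinner_slice)
  qed
  have "ptr A = R"
    unfolding ptr_def[abs_def] E_def[symmetric] by (rule ext, rule infsumI[OF hs])
  then show "nuclear_rep (ptr A) (I \<times> E) ?x ?y" using R by simp
  show "(\<lambda>e. slice e (A (ten f e))) summable_on E"
    by (rule has_sum_imp_summable[OF hs])
qed

lemma
  assumes A: "A \<in> trace_class"
  shows ptr_trace_class: "ptr A \<in> trace_class"
    and trace_norm_ptr_le: "trace_norm (ptr A) \<le> trace_norm A"
    and ptr_summable: "(\<lambda>e. slice e (A (ten f e))) summable_on (SOME E. is_onb E)"
proof -
  obtain I x y where rep: "nuclear_rep A (I :: 'c set) x y"
    and le: "(\<Sum>\<^sub>\<infinity>e\<in>I. norm (x e) * norm (y e)) \<le> trace_norm A"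
    using trace_class_nuclear_rep[OF A] by blast
  note ptr = nuclear_rep_ptr[OF rep]
  show "ptr A \<in> trace_class" by (rule nuclear_rep_trace_class(1)[OF ptr(1)])
  show "(\<lambda>e. slice e (A (ten f e))) summable_on (SOME E. is_onb E)" by (rule ptr(3))
  show "trace_norm (ptr A) \<le> trace_norm A"
    using nuclear_rep_trace_class(2)[OF ptr(1)] ptr(2) le by (simp add: case_prod_beta')
qed

lemma ptr_plus:
  assumes "A \<in> trace_class" "B \<in> trace_class"
  shows "ptr (\<lambda>f. A f + B f) = (\<lambda>f. ptr A f + ptr B f)"
  unfolding ptr_def[abs_def]
  by (rule ext) (simp add: linear_add[OF bounded_linear.linear[OF bounded_linear_slice]]
      infsum_add ptr_summable assms)

lemma ptr_scaleC:
  assumes "A \<in> trace_class"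
  shows "ptr (\<lambda>f. c *\<^sub>C A f) = (\<lambda>f. c *\<^sub>C ptr A f)"
  unfolding ptr_def[abs_def] slice_scaleC
  by (rule ext, rule infsumI)
     (rule has_sum_bounded_linear[OF bounded_linear_scaleC has_sum_infsum[OF ptr_summable[OF assms]]])

lemma ptr_diff:
  assumes "A \<in> trace_class" "B \<in> trace_class"
  shows "ptr (\<lambda>f. A f - B f) = (\<lambda>f. ptr A f - ptr B f)"
  using ptr_plus[OF assms(1) trace_class_scale[OF assms(2), of "-1"]] ptr_scaleC[OF assms(2), of "-1"]
  by simp

lemma ptr_product:
  assumes B: "B \<in> trace_class" and C: "\<And>f g. C (ten f g) = ten (A f) (B g)"
  shows "ptr C = (\<lambda>f. trace B *\<^sub>C A f)"
  unfolding ptr_def[abs_def] C slice_ten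
  by (rule ext, rule infsumI)
     (rule has_sum_bounded_linear[OF bounded_linear_scaleC_left trace_has_sum[OF B onb_SOME]])

definition ten_op :: "('a \<Rightarrow> 'a) \<Rightarrow> ('b \<Rightarrow> 'b) \<Rightarrow> 'c \<Rightarrow> 'c" where
  "ten_op A B = (THE C. bounded_clinear C \<and> (\<forall>f g. C (ten f g) = ten (A f) (B g)))"

text \<open>If \<open>C\<close> and \<open>D\<close> agree on product vectors, then \<open>C\<^sup>* k - D\<^sup>* k\<close> is orthogonal to all of these.\<close>

lemma bounded_clinear_eq_on_ten:
  assumes C: "bounded_clinear C" and D: "bounded_clinear D" and eq: "\<And>f g. C (ten f g) = D (ten f g)"
  shows "C = D"
proof -
  have "cadjoint C k - cadjoint D k = 0" for k
  proof (rule ten_dense)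
    fix f g
    have "cinner (ten f g) (cadjoint C k - cadjoint D k) = 0"
      by (simp add: cinner_linear cinner_cadjoint[OF C, symmetric] cinner_cadjoint[OF D, symmetric] eq)
    then show "cinner (cadjoint C k - cadjoint D k) (ten f g) = 0"
      using cinner_eq_zero_commute by blast
  qed
  then have "cinner (C h) k = cinner (D h) k" for h k
    by (simp add: cinner_cadjoint[OF C] cinner_cadjoint[OF D])
  then show ?thesis by (intro ext eq_by_cinner_right)
qed

lemma ten_op_eqI:
  assumes "bounded_clinear C" "\<And>f g. C (ten f g) = ten (A f) (B g)"
  shows "ten_op A B = C"
  unfolding ten_op_def
  by (rule the_equality) (use assms bounded_clinear_eq_on_ten in auto)

text \<open>The products of the terms of representations of \<open>A\<close> and \<open>B\<close> represent their tensor product.\<close>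

lemma ex_ten_op:
  assumes "A \<in> trace_class" "B \<in> trace_class"
  shows "\<exists>C\<in>trace_class. \<forall>f g. C (ten f g) = ten (A f) (B g)"
proof -
  obtain I x y where A: "nuclear_rep A (I :: 'a set) x y"
    using trace_class_nuclear_rep[OF assms(1)] by blast
  obtain J x' y' where B: "nuclear_rep B (J :: 'b set) x' y'"
    using trace_class_nuclear_rep[OF assms(2)] by blast
  let ?x = "\<lambda>(i, j). ten (x i) (x' j)" and ?y = "\<lambda>(i, j). ten (y i) (y' j)"
  let ?a = "\<lambda>i. norm (x i) * norm (y i)" and ?b = "\<lambda>j. norm (x' j) * norm (y' j)"
  have "(\<lambda>p. norm ((\<lambda>(i, j). ?a i * ?b j) p)) summable_on I \<times> J"
    unfolding Infinite_Sum.abs_summable_on_Sigma_iff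
    using nuclear_rep_summable[OF A] nuclear_rep_summable[OF B]
    by (auto intro: summable_on_cmult_right summable_on_cmult_left
        simp: abs_mult infsum_cmult_right' infsum_nonneg)
  then have "(\<lambda>p. norm (?x p) * norm (?y p)) summable_on I \<times> J"
    by (simp add: norm_ten case_prod_beta' mult_ac)
  from nuclear_rep_infsum[OF this] obtain C where C: "nuclear_rep C (I \<times> J) ?x ?y" by blast
  have "C (ten f g) = ten (A f) (B g)" for f g
  proof -
    have "((\<lambda>i. cinner f (x i) *\<^sub>C ten (y i) (B g)) has_sum C (ten f g)) I"
    proof (rule has_sum_SigmaD[OF nuclear_rep_has_sum[OF C, of "ten f g"]])
      fix i
      have "((\<lambda>j. ten (cinner f (x i) *\<^sub>C y i) (cinner g (x' j) *\<^sub>C y' j)) has_sum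
          ten (cinner f (x i) *\<^sub>C y i) (B g)) J"
        by (rule has_sum_bounded_linear[OF bounded_linear_ten_right nuclear_rep_has_sum[OF B]])
      then show "((\<lambda>j. cinner (ten f g) (?x (i, j)) *\<^sub>C ?y (i, j)) has_sum cinner f (x i) *\<^sub>C ten (y i) (B g)) J"
        by (simp add: ten_scaleC_left ten_scaleC_right scaleC_scaleC cinner_ten mult.commute)
    qed
    moreover have "((\<lambda>i. ten (cinner f (x i) *\<^sub>C y i) (B g)) has_sum ten (A f) (B g)) I"
      by (rule has_sum_bounded_linear[OF bounded_linear_ten_left nuclear_rep_has_sum[OF A]])
    ultimately show ?thesis by (simp add: ten_scaleC_left has_sum_unique)
  qed
  then show ?thesis using nuclear_rep_trace_class(1)[OF C] by blast
qed

lemma ten_op: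
  assumes "A \<in> trace_class" "B \<in> trace_class"
  shows "ten_op A B \<in> trace_class" "ten_op A B (ten f g) = ten (A f) (B g)"
  using ex_ten_op[OF assms] ten_op_eqI trace_class_bounded_clinear by metis+

lemma ten_op_rank_one:
  "ten_op (rank_one x y) (rank_one x' y') = rank_one (ten x x') (ten y y')"
  by (rule ten_op_eqI)
     (simp_all add: trace_class_bounded_clinear rank_one_trace_class rank_one_def cinner_ten
        ten_scaleC_left ten_scaleC_right scaleC_scaleC)

text \<open>Products of rank one operators are the rank one operators between product vectors; linear
  combinations of these are dense in the trace class operators. The set of operators on which two
  candidates for the partial trace agree is closed and linear, so it is everything.\<close>

lemma partial_trace_unique:
  fixes T T' :: "('c \<Rightarrow> 'c) \<Rightarrow> 'k::complex_hilbert \<Rightarrow> 'k"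
  assumes T: "continuous_linear_on_trace_class T" and T': "continuous_linear_on_trace_class T'"
    and eq: "\<And>A B. A \<in> trace_class \<Longrightarrow> B \<in> trace_class \<Longrightarrow> T (ten_op A B) = T' (ten_op A B)"
  shows "T = T'"
proof -
  define Z where "Z = {A \<in> trace_class. T A = T' A}"
  have Z_tc: "A \<in> trace_class" if "A \<in> Z" for A using that by (simp add: Z_def)
  have Z_plus: "(\<lambda>f. A f + B f) \<in> Z" if "A \<in> Z" "B \<in> Z" for A B
    using that T T' by (simp add: Z_def trace_class_plus continuous_linear_on_trace_class_def)
  have Z_scale: "(\<lambda>f. c *\<^sub>C A f) \<in> Z" if "A \<in> Z" for c A
    using that T T' by (simp add: Z_def trace_class_scale continuous_linear_on_trace_class_def)
  have Z_closed: "A \<in> Z"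
    if A: "A \<in> trace_class" and lim: "\<And>\<delta>. \<delta> > 0 \<Longrightarrow> \<exists>B\<in>Z. trace_norm (\<lambda>f. B f - A f) < \<delta>" for A
  proof -
    have tc: "U A \<in> trace_class" if "continuous_linear_on_trace_class U" "A \<in> trace_class"
      for U :: "('c \<Rightarrow> 'c) \<Rightarrow> 'k \<Rightarrow> 'k" and A
      using that by (auto simp: continuous_linear_on_trace_class_def)
    have small: "norm (T A f - T' A f) \<le> \<epsilon> * (2 * norm f)" if "\<epsilon> > 0" for \<epsilon> f
    proof -
      have cont: "\<exists>\<delta>>0. \<forall>B\<in>trace_class. trace_norm (\<lambda>f. B f - A f) < \<delta> \<longrightarrow> trace_norm (\<lambda>f. U B f - U A f) < \<epsilon>"
        if "continuous_linear_on_trace_class U" for U :: "('c \<Rightarrow> 'c) \<Rightarrow> 'k \<Rightarrow> 'k"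
        using that A \<open>\<epsilon> > 0\<close> unfolding continuous_linear_on_trace_class_def by simp
      obtain \<delta> \<delta>' where \<delta>: "\<delta> > 0" "\<delta>' > 0"
        "\<And>B. B \<in> trace_class \<Longrightarrow> trace_norm (\<lambda>f. B f - A f) < \<delta> \<Longrightarrow> trace_norm (\<lambda>f. T B f - T A f) < \<epsilon>"
        "\<And>B. B \<in> trace_class \<Longrightarrow> trace_norm (\<lambda>f. B f - A f) < \<delta>' \<Longrightarrow> trace_norm (\<lambda>f. T' B f - T' A f) < \<epsilon>"
        using cont[OF T] cont[OF T'] by blast
      obtain B where B: "B \<in> Z" "trace_norm (\<lambda>f. B f - A f) < min \<delta> \<delta>'"
        using lim[of "min \<delta> \<delta>'"] \<delta> by auto
      have near: "norm (U B f - U A f) \<le> \<epsilon> * norm f"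
        if U: "continuous_linear_on_trace_class U" and le: "trace_norm (\<lambda>f. U B f - U A f) < \<epsilon>" for U :: "('c \<Rightarrow> 'c) \<Rightarrow> 'k \<Rightarrow> 'k"
        using trace_class_norm_le[OF trace_class_diff[OF tc[OF U Z_tc[OF B(1)]] tc[OF U A]], of f]
          mult_right_mono[OF less_imp_le[OF le], of "norm f"] by simp
      have "norm (T B f - T A f) \<le> \<epsilon> * norm f" "norm (T' B f - T' A f) \<le> \<epsilon> * norm f"
        using \<delta> B Z_tc by (auto intro!: near T T')
      moreover have "T B f = T' B f" using B by (simp add: Z_def)
      ultimately show ?thesis
        using norm_triangle_ineq4[of "T' B f - T' A f" "T B f - T A f"] by simp
    qed
    have "norm (T A f - T' A f) \<le> 0" for f
    proof (rule field_le_epsilon)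
      fix e :: real assume "e > 0"
      then have "norm (T A f - T' A f) \<le> e / (2 * norm f + 1) * (2 * norm f)"
        by (intro small) (simp add: add_nonneg_pos)
      also have "\<dots> \<le> e" using \<open>e > 0\<close> by (simp add: divide_le_eq add_nonneg_pos)
      finally show "norm (T A f - T' A f) \<le> 0 + e" by simp
    qed
    then show ?thesis using A by (auto simp: Z_def)
  qed
  have span: "x \<in> {x. P x}" if P: "\<And>f g. P (ten f g)" "\<And>x x'. P x \<Longrightarrow> P x' \<Longrightarrow> P (x + x')"
    "\<And>c x. P x \<Longrightarrow> P (c *\<^sub>C x)" and cl: "\<And>x. (\<And>\<delta>. \<delta> > 0 \<Longrightarrow> \<exists>u. P u \<and> norm (u - x) < \<delta>) \<Longrightarrow> P x" for P x
  proof (rule closed_subspace_containing_ten)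
    show "complex_vector.subspace {x. P x}"
      using P(2,3) P(3)[OF P(1), of 0] by (simp add: complex_vector.subspace_def)
    show "closed {x. P x}"
      unfolding closure_eq[symmetric]
    proof (intro equalityI closure_subset subsetI)
      fix x assume "x \<in> closure {x. P x}"
      then have "\<exists>u. P u \<and> norm (u - x) < \<delta>" if "\<delta> > 0" for \<delta>
        using that unfolding closure_approachable by (auto simp: dist_norm)
      then show "x \<in> {x. P x}" using cl by blast
    qed
  qed (use P in simp)
  have rank_one_left: "rank_one x (ten f' g') \<in> Z" for x f' g'
  proof -
    let ?y = "ten f' g'"
    have "x \<in> {x. rank_one x ?y \<in> Z}"
    proof (rule span)
      show "rank_one (ten f g) ?y \<in> Z" for f g
        using eq[OF rank_one_trace_class rank_one_trace_class]
        by (simp add: Z_def rank_one_trace_class ten_op_rank_one)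
      show "rank_one (u + v) ?y \<in> Z" if "rank_one u ?y \<in> Z" "rank_one v ?y \<in> Z" for u v
        using Z_plus[OF that] by (simp add: rank_one_def[abs_def] cinner_linear scaleC_add_left)
      show "rank_one (c *\<^sub>C u) ?y \<in> Z" if "rank_one u ?y \<in> Z" for c u
        using Z_scale[OF that, of "cnj c"] by (simp add: rank_one_def[abs_def] cinner_linear scaleC_scaleC)
      fix x assume lim: "\<And>\<delta>. \<delta> > 0 \<Longrightarrow> \<exists>u. rank_one u ?y \<in> Z \<and> norm (u - x) < \<delta>"
      show "rank_one x ?y \<in> Z"
      proof (rule Z_closed[OF rank_one_trace_class])
        fix \<delta> :: real assume "\<delta> > 0"
        \<comment> \<open>The summand \<open>1\<close> keeps the denominator positive when the fixed vector is \<open>0\<close>.\<close>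
        then obtain u where u: "rank_one u ?y \<in> Z" "norm (u - x) < \<delta> / (norm ?y + 1)"
          using lim[of "\<delta> / (norm ?y + 1)"] by (auto simp: add_nonneg_pos)
        have "trace_norm (\<lambda>f. rank_one u ?y f - rank_one x ?y f) = trace_norm (rank_one (u - x) ?y)"
          by (simp add: rank_one_def[abs_def] cinner_linear complex_vector.scale_left_diff_distrib)
        also have "\<dots> \<le> norm (u - x) * norm ?y" by (rule trace_norm_rank_one_le)
        also have "\<dots> \<le> norm (u - x) * (norm ?y + 1)" by (intro mult_left_mono) auto
        also have "\<dots> < \<delta>" using u(2) by (simp add: pos_less_divide_eq add_nonneg_pos)
        finally show "\<exists>B\<in>Z. trace_norm (\<lambda>f. B f - rank_one x ?y f) < \<delta>" using u(1) by blast
      qed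
    qed
    then show ?thesis by simp
  qed
  have rank_one: "rank_one x y \<in> Z" for x y
  proof -
    have "y \<in> {y. rank_one x y \<in> Z}"
    proof (rule span)
      show "rank_one x (ten f g) \<in> Z" for f g by (rule rank_one_left)
      show "rank_one x (u + v) \<in> Z" if "rank_one x u \<in> Z" "rank_one x v \<in> Z" for u v
        using Z_plus[OF that] by (simp add: rank_one_def[abs_def] scaleC_add_right)
      show "rank_one x (c *\<^sub>C u) \<in> Z" if "rank_one x u \<in> Z" for c u
        using Z_scale[OF that, of c] by (simp add: rank_one_def[abs_def] scaleC_scaleC mult.commute)
      fix y assume lim: "\<And>\<delta>. \<delta> > 0 \<Longrightarrow> \<exists>u. rank_one x u \<in> Z \<and> norm (u - y) < \<delta>"
      show "rank_one x y \<in> Z"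
      proof (rule Z_closed[OF rank_one_trace_class])
        fix \<delta> :: real assume "\<delta> > 0"
        then obtain u where u: "rank_one x u \<in> Z" "norm (u - y) < \<delta> / (norm x + 1)"
          using lim[of "\<delta> / (norm x + 1)"] by (auto simp: add_nonneg_pos)
        have "trace_norm (\<lambda>f. rank_one x u f - rank_one x y f) = trace_norm (rank_one x (u - y))"
          by (simp add: rank_one_def[abs_def] complex_vector.scale_right_diff_distrib)
        also have "\<dots> \<le> norm x * norm (u - y)" by (rule trace_norm_rank_one_le)
        also have "\<dots> \<le> (norm x + 1) * norm (u - y)" by (intro mult_right_mono) auto
        also have "\<dots> < \<delta>" using u(2) by (simp add: pos_less_divide_eq add_nonneg_pos mult.commute)
        finally show "\<exists>B\<in>Z. trace_norm (\<lambda>f. B f - rank_one x y f) < \<delta>" using u(1) by blast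
      qed
    qed
    then show ?thesis by simp
  qed
  have "A \<in> Z" if A: "A \<in> trace_class" for A
  proof (rule Z_closed[OF A])
    fix \<delta> :: real assume "\<delta> > 0"
    obtain I :: "'c set" and x y where I: "finite I"
      "trace_norm (\<lambda>f. A f - (\<Sum>i\<in>I. rank_one (x i) (y i) f)) \<le> \<delta> / 2"
      using finite_rank_approximation[OF A, of "\<delta> / 2"] \<open>\<delta> > 0\<close> by auto
    let ?B = "\<lambda>f. \<Sum>i\<in>I. rank_one (x i) (y i) f"
    have zero: "(\<lambda>_. 0) \<in> Z" using Z_scale[OF rank_one, of 0] by simp
    have B: "?B \<in> Z"
      using I(1) by (induction I rule: finite_induct) (auto simp: zero Z_plus rank_one)
    have "trace_norm (\<lambda>f. (- 1) *\<^sub>C (A f - ?B f)) \<le> cmod (- 1) * trace_norm (\<lambda>f. A f - ?B f)"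
      by (rule trace_norm_scale_le[OF trace_class_diff[OF A Z_tc[OF B]]])
    then have "trace_norm (\<lambda>f. ?B f - A f) < \<delta>"
      using I(2) \<open>\<delta> > 0\<close> by simp
    then show "\<exists>B\<in>Z. trace_norm (\<lambda>f. B f - A f) < \<delta>" by (rule bexI[OF _ B])
  qed
  then have "T A = T' A" if "A \<in> trace_class" for A using that by (auto simp: Z_def)
  moreover have "T A = T' A" if "A \<notin> trace_class" for A
    using that T T' PiE_arb[of T trace_class "\<lambda>_. trace_class" A]
      PiE_arb[of T' trace_class "\<lambda>_. trace_class" A]
    by (simp add: continuous_linear_on_trace_class_def)
  ultimately show ?thesis by blast
qed

lemma continuous_linear_ptr: "continuous_linear_on_trace_class (restrict ptr trace_class)"
  unfolding continuous_linear_on_trace_class_def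
proof (intro conjI ballI allI impI)
  show "restrict ptr trace_class \<in> trace_class \<rightarrow>\<^sub>E trace_class"
    by (simp add: ptr_trace_class)
  fix A :: "'c \<Rightarrow> 'c" assume A: "A \<in> trace_class"
  show "restrict ptr trace_class (\<lambda>f. c *\<^sub>C A f) = (\<lambda>f. c *\<^sub>C restrict ptr trace_class A f)" for c
    using A by (simp add: trace_class_scale ptr_scaleC)
  fix B :: "'c \<Rightarrow> 'c" assume B: "B \<in> trace_class"
  show "restrict ptr trace_class (\<lambda>f. A f + B f) = (\<lambda>f. restrict ptr trace_class A f + restrict ptr trace_class B f)"
    using A B by (simp add: trace_class_plus ptr_plus)
next
  fix A :: "'c \<Rightarrow> 'c" and \<epsilon> :: real assume A: "A \<in> trace_class" and "\<epsilon> > 0"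
  have "trace_norm (\<lambda>f. restrict ptr trace_class B f - restrict ptr trace_class A f) \<le> trace_norm (\<lambda>f. B f - A f)"
    if "B \<in> trace_class" for B
    using trace_norm_ptr_le[OF trace_class_diff[OF that A]] that A by (simp add: ptr_diff)
  note le = this
  show "\<exists>\<delta>>0. \<forall>B\<in>trace_class. trace_norm (\<lambda>f. B f - A f) < \<delta> \<longrightarrow>
      trace_norm (\<lambda>f. restrict ptr trace_class B f - restrict ptr trace_class A f) < \<epsilon>"
    using \<open>\<epsilon> > 0\<close> by (intro exI[of _ \<epsilon>] conjI ballI impI order.strict_trans1[OF le]) auto
qed

lemma the_partial_trace:
  "(THE T. continuous_linear_on_trace_class T \<and>
      (\<forall>A\<in>trace_class. \<forall>B\<in>trace_class. T (ten_op A B) = (\<lambda>f. trace B *\<^sub>C A f)))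
    = restrict ptr trace_class"
proof (rule the_equality)
  have prod: "restrict ptr trace_class (ten_op A B) = (\<lambda>f. trace B *\<^sub>C A f)"
    if "A \<in> trace_class" "B \<in> trace_class" for A B
    using ten_op[OF that] ptr_product[OF that(2)] by simp
  then show "continuous_linear_on_trace_class (restrict ptr trace_class) \<and>
      (\<forall>A\<in>trace_class. \<forall>B\<in>trace_class. restrict ptr trace_class (ten_op A B) = (\<lambda>f. trace B *\<^sub>C A f))"
    using continuous_linear_ptr by simp
  fix T assume "continuous_linear_on_trace_class T \<and>
      (\<forall>A\<in>trace_class. \<forall>B\<in>trace_class. T (ten_op A B) = (\<lambda>f. trace B *\<^sub>C A f))"
  then show "T = restrict ptr trace_class"
    using prod by (intro partial_trace_unique continuous_linear_ptr) auto
qed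

end

section \<open>Completeness and total sets in \<open>L\<^sup>2\<close>\<close>

lemma L2_rel_refl [simp]: "L2_rel u u \<longleftrightarrow> square_integrable u"
  by (simp add: L2_rel_def)

lemma square_integrable_rep [simp]: "square_integrable (rep_L2 f)"
  using Quotient3_rep_reflp[OF Quotient3_L2, of f] by simp

lemma abs_rep_L2 [simp]: "abs_L2 (rep_L2 f) = f"
  by (rule Quotient3_abs_rep[OF Quotient3_L2])

lemma abs_L2_eqI: "square_integrable u \<Longrightarrow> square_integrable v \<Longrightarrow> AE t in lborel. u t = v t \<Longrightarrow> abs_L2 u = abs_L2 v"
  by (rule Quotient3_rel_abs[OF Quotient3_L2]) (simp add: L2_rel_def)

lemma cinner_abs_L2:
  "square_integrable u \<Longrightarrow> square_integrable v \<Longrightarrow>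
    cinner (abs_L2 u) (abs_L2 v) = (\<integral>t. u t * cnj (v t) \<partial>lborel)"
  by (simp add: cinner_L2.abs_eq)

lemma norm_abs_L2: "square_integrable u \<Longrightarrow> (norm (abs_L2 u))\<^sup>2 = (\<integral>t. (cmod (u t))\<^sup>2 \<partial>lborel)"
proof -
  assume u: "square_integrable u"
  have "complex_of_real ((norm (abs_L2 u))\<^sup>2) = (\<integral>t. complex_of_real ((cmod (u t))\<^sup>2) \<partial>lborel)"
    unfolding cinner_self[symmetric] cinner_abs_L2[OF u u] complex_norm_square ..
  then show ?thesis by (simp only: integral_complex_of_real of_real_eq_iff)
qed

lemma nn_norm_abs_L2:
  assumes "square_integrable u"
  shows "(\<integral>\<^sup>+t. ennreal ((cmod (u t))\<^sup>2) \<partial>lborel) = ennreal ((norm (abs_L2 u))\<^sup>2)"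
  unfolding norm_abs_L2[OF assms]
  by (rule nn_integral_eq_integral) (use assms in \<open>auto simp: square_integrable_def\<close>)

lemma square_integrableI_nn:
  assumes [measurable]: "u \<in> borel_measurable borel"
    and "(\<integral>\<^sup>+t. ennreal ((cmod (u t))\<^sup>2) \<partial>lborel) < \<infinity>"
  shows "square_integrable u"
  unfolding square_integrable_def
  using assms(2) by (auto intro!: integrableI_bounded)

lemma abs_L2_plus:
  "square_integrable u \<Longrightarrow> square_integrable v \<Longrightarrow> abs_L2 u + abs_L2 v = abs_L2 (\<lambda>t. u t + v t)"
  by (simp add: plus_L2.abs_eq)

lemma abs_L2_scaleC: "square_integrable u \<Longrightarrow> c *\<^sub>C abs_L2 u = abs_L2 (\<lambda>t. c * u t)"
  by (simp add: scaleC_L2.abs_eq)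

lemma square_integrable_diff:
  "square_integrable u \<Longrightarrow> square_integrable v \<Longrightarrow> square_integrable (\<lambda>t. u t - v t)"
  using square_integrable_add[of u "\<lambda>t. -1 * v t"] square_integrable_scale[of v "-1"] by simp

lemma abs_L2_diff:
  assumes "square_integrable u" "square_integrable v"
  shows "abs_L2 u - abs_L2 v = abs_L2 (\<lambda>t. u t - v t)"
  unfolding minus_L2_def uminus_L2_def abs_L2_scaleC[OF assms(2)]
  using abs_L2_plus[OF assms(1) square_integrable_scale[OF assms(2), of "-1"]] by simp

lemma abs_L2_sum:
  assumes "\<And>i. i \<in> I \<Longrightarrow> square_integrable (u i)"
  shows "square_integrable (\<lambda>t. \<Sum>i\<in>I. u i t) \<and> (\<Sum>i\<in>I. abs_L2 (u i)) = abs_L2 (\<lambda>t. \<Sum>i\<in>I. u i t)"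
  using assms
  by (induction I rule: infinite_finite_induct)
     (auto simp: square_integrable_zero zero_L2_def square_integrable_add abs_L2_plus)

text \<open>The Riesz--Fischer theorem: along a rapidly converging subsequence the increments are
  summable almost everywhere by monotone convergence, and Fatou's lemma identifies the pointwise limit as
  the limit in norm.\<close>

lemma L2_Cauchy_convergent:
  fixes X :: "nat \<Rightarrow> 'a::euclidean_space L2"
  assumes X: "Cauchy X"
  shows "convergent X"
proof -
  have "\<exists>M. \<forall>m\<ge>M. \<forall>n\<ge>M. dist (X m) (X n) < (1 / 2) ^ k" for k
    using metric_CauchyD[OF X, of "(1 / 2) ^ k"] by simp
  then obtain M where M: "\<And>k m n. m \<ge> M k \<Longrightarrow> n \<ge> M k \<Longrightarrow> dist (X m) (X n) < (1 / 2) ^ k" by metis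
  \<comment> \<open>Adding all thresholds up to \<open>k\<close> makes the sequence of indices strictly increasing.\<close>
  define r where "r k = k + (\<Sum>i\<le>k. M i)" for k
  have rM: "M k \<le> r k" "M k \<le> r (Suc k)" for k
    using member_le_sum[of k "{..k}" M] by (auto simp: r_def)
  have r: "strict_mono r" by (rule strict_monoI_Suc) (simp add: r_def)
  define u where "u n = rep_L2 (X (r n))" for n
  have sq: "square_integrable (u n)" for n by (simp add: u_def)
  have Xu: "X (r n) = abs_L2 (u n)" for n by (simp add: u_def)
  note [measurable] = square_integrable_measurable[OF sq]
  define d where "d n t = cmod (u (Suc n) t - u n t)" for n t
  have sqd: "square_integrable (\<lambda>t. complex_of_real (d n t))" for n
    using square_integrable_diff[OF sq sq, of "Suc n" n] by (simp add: d_def square_integrable_def)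
  have nd: "norm (abs_L2 (\<lambda>t. complex_of_real (d n t))) \<le> (1 / 2) ^ n" for n
  proof -
    have "(norm (abs_L2 (\<lambda>t. complex_of_real (d n t))))\<^sup>2 = (norm (X (r (Suc n)) - X (r n)))\<^sup>2"
      unfolding Xu abs_L2_diff[OF sq sq] norm_abs_L2[OF sqd] norm_abs_L2[OF square_integrable_diff[OF sq sq]]
      by (simp add: d_def)
    then have "norm (abs_L2 (\<lambda>t. complex_of_real (d n t))) = norm (X (r (Suc n)) - X (r n))"
      by (simp add: power2_eq_iff_nonneg)
    then show ?thesis using M[of n "r (Suc n)" "r n"] rM[of n] by (simp add: dist_norm)
  qed
  define g where "g N t = ennreal ((\<Sum>k<N. d k t)\<^sup>2)" for N t
  have g_le: "(\<integral>\<^sup>+t. g N t \<partial>lborel) \<le> 4" for N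
  proof -
    have *: "square_integrable (\<lambda>t. \<Sum>k<N. complex_of_real (d k t))"
      "(\<Sum>k<N. abs_L2 (\<lambda>t. complex_of_real (d k t))) = abs_L2 (\<lambda>t. \<Sum>k<N. complex_of_real (d k t))"
      using abs_L2_sum[of "{..<N}" "\<lambda>k t. complex_of_real (d k t)"] sqd by auto
    have "norm (abs_L2 (\<lambda>t. \<Sum>k<N. complex_of_real (d k t))) \<le> (\<Sum>k<N. (1 / 2) ^ k)"
      unfolding *(2)[symmetric] by (intro order_trans[OF norm_sum] sum_mono nd)
    also have "\<dots> \<le> (\<Sum>k. (1 / 2 :: real) ^ k)"
      by (intro sum_le_suminf summable_geometric) auto
    also have "\<dots> = 2" by (simp add: suminf_geometric)
    finally have "(norm (abs_L2 (\<lambda>t. \<Sum>k<N. complex_of_real (d k t))))\<^sup>2 \<le> 2\<^sup>2"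
      by (intro power_mono) auto
    moreover have "(\<integral>\<^sup>+t. g N t \<partial>lborel) = ennreal ((norm (abs_L2 (\<lambda>t. \<Sum>k<N. complex_of_real (d k t))))\<^sup>2)"
      unfolding nn_norm_abs_L2[OF *(1), symmetric] g_def
      by (simp flip: of_real_sum)
    ultimately show ?thesis using ennreal_leI by fastforce
  qed
  have g_meas [measurable]: "g N \<in> borel_measurable lborel" for N
    unfolding g_def d_def by measurable
  have "incseq g"
    unfolding g_def
    by (intro incseq_SucI le_funI ennreal_leI power_mono) (auto simp: d_def intro: sum_nonneg)
  then have "(\<integral>\<^sup>+t. (SUP N. g N t) \<partial>lborel) = (SUP N. \<integral>\<^sup>+t. g N t \<partial>lborel)"
    by (rule nn_integral_monotone_convergence_SUP) simp
  also have "\<dots> \<le> 4" using g_le by (intro SUP_least)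
  finally have "(\<integral>\<^sup>+t. (SUP N. g N t) \<partial>lborel) \<noteq> \<infinity>" by (auto simp: top_unique)
  then have fin: "AE t in lborel. (SUP N. g N t) \<noteq> \<infinity>"
    by (intro nn_integral_noteq_infinite) auto
  have conv: "AE t in lborel. convergent (\<lambda>n. u n t)"
    using fin
  proof eventually_elim
    case (elim t)
    then obtain c where c: "c \<ge> 0" "(SUP N. g N t) = ennreal c" by (cases "SUP N. g N t") auto
    have "(\<Sum>k<N. d k t)\<^sup>2 \<le> c" for N
    proof -
      have "g N t \<le> ennreal c" unfolding c(2)[symmetric] by (rule SUP_upper) simp
      then show ?thesis using c(1) by (simp add: g_def)
    qed
    then have "(\<Sum>k<N. d k t) \<le> sqrt c" for N by (rule real_le_rsqrt)
    then have "summable (\<lambda>k. d k t)"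
      by (intro summableI_nonneg_bounded[of _ "sqrt c"]) (simp_all add: d_def)
    then have "summable (\<lambda>k. u (Suc k) t - u k t)"
      unfolding d_def by (rule summable_norm_cancel)
    then have "convergent (\<lambda>n. \<Sum>k<n. u (Suc k) t - u k t)"
      by (simp add: summable_iff_convergent)
    then have "convergent (\<lambda>n. (u n t - u 0 t) + u 0 t)"
      by (subst (asm) sum_lessThan_telescope) (intro convergent_add convergent_const)
    then show ?case by simp
  qed
  define v where "v t = lim (\<lambda>n. u n t)" for t
  have [measurable]: "v \<in> borel_measurable borel"
    unfolding v_def by measurable
  have lim: "AE t in lborel. (\<lambda>n. u n t) \<longlonglongrightarrow> v t"
    using conv by eventually_elim (simp add: v_def convergent_LIMSEQ_iff)
  have fatou: "\<exists>N. \<forall>n\<ge>N. (\<integral>\<^sup>+t. ennreal ((cmod (v t - u n t))\<^sup>2) \<partial>lborel) \<le> ennreal (\<epsilon>\<^sup>2)" if "\<epsilon> > 0" for \<epsilon> :: real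
  proof -
    obtain N where N: "\<And>m n. m \<ge> N \<Longrightarrow> n \<ge> N \<Longrightarrow> dist (X (r m)) (X (r n)) < \<epsilon>"
      using metric_CauchyD[OF Cauchy_subseq_Cauchy[OF X r] \<open>\<epsilon> > 0\<close>] by (auto simp: o_def)
    have "(\<integral>\<^sup>+t. ennreal ((cmod (v t - u n t))\<^sup>2) \<partial>lborel) \<le> ennreal (\<epsilon>\<^sup>2)" if n: "n \<ge> N" for n
    proof -
      have "(\<integral>\<^sup>+t. ennreal ((cmod (v t - u n t))\<^sup>2) \<partial>lborel)
          = (\<integral>\<^sup>+t. liminf (\<lambda>m. ennreal ((cmod (u m t - u n t))\<^sup>2)) \<partial>lborel)"
      proof (rule nn_integral_cong_AE)
        show "AE t in lborel. ennreal ((cmod (v t - u n t))\<^sup>2) = liminf (\<lambda>m. ennreal ((cmod (u m t - u n t))\<^sup>2))"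
          using lim
        proof eventually_elim
          case (elim t)
          then have "(\<lambda>m. ennreal ((cmod (u m t - u n t))\<^sup>2)) \<longlonglongrightarrow> ennreal ((cmod (v t - u n t))\<^sup>2)"
            by (intro tendsto_ennrealI tendsto_intros)
          then show ?case by (rule lim_imp_Liminf[OF sequentially_bot, symmetric])
        qed
      qed
      also have "\<dots> \<le> liminf (\<lambda>m. \<integral>\<^sup>+t. ennreal ((cmod (u m t - u n t))\<^sup>2) \<partial>lborel)"
        by (rule nn_integral_liminf) measurable
      also have "\<dots> \<le> limsup (\<lambda>m. \<integral>\<^sup>+t. ennreal ((cmod (u m t - u n t))\<^sup>2) \<partial>lborel)"
        by (rule Liminf_le_Limsup) simp
      also have "\<dots> \<le> ennreal (\<epsilon>\<^sup>2)"
      proof (rule Limsup_bounded)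
        show "\<forall>\<^sub>F m in sequentially. (\<integral>\<^sup>+t. ennreal ((cmod (u m t - u n t))\<^sup>2) \<partial>lborel) \<le> ennreal (\<epsilon>\<^sup>2)"
          using eventually_ge_at_top[of N]
        proof eventually_elim
          case (elim m)
          have "(\<integral>\<^sup>+t. ennreal ((cmod (u m t - u n t))\<^sup>2) \<partial>lborel) = ennreal ((norm (X (r m) - X (r n)))\<^sup>2)"
            unfolding Xu abs_L2_diff[OF sq sq] by (rule nn_norm_abs_L2[OF square_integrable_diff[OF sq sq]])
          also have "\<dots> \<le> ennreal (\<epsilon>\<^sup>2)"
            using N[OF elim n] by (intro ennreal_leI power_mono) (auto simp: dist_norm)
          finally show ?case .
        qed
      qed
      finally show ?thesis .
    qed
    then show ?thesis by blast
  qed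
  have sqvu: "square_integrable (\<lambda>t. v t - u n t)"
    if "(\<integral>\<^sup>+t. ennreal ((cmod (v t - u n t))\<^sup>2) \<partial>lborel) \<le> ennreal (\<epsilon>\<^sup>2)" for n \<epsilon>
    by (rule square_integrableI_nn) (use that in \<open>auto intro: le_less_trans\<close>)
  obtain N where "(\<integral>\<^sup>+t. ennreal ((cmod (v t - u N t))\<^sup>2) \<partial>lborel) \<le> ennreal (1\<^sup>2)"
    using fatou[of 1] by auto
  from square_integrable_add[OF sqvu[OF this] sq[of N]] have sqv: "square_integrable v" by simp
  have "(X \<circ> r) \<longlonglongrightarrow> abs_L2 v"
  proof (rule metric_LIMSEQ_I)
    fix \<epsilon> :: real assume "\<epsilon> > 0"
    then obtain N where N: "\<And>n. n \<ge> N \<Longrightarrow> (\<integral>\<^sup>+t. ennreal ((cmod (v t - u n t))\<^sup>2) \<partial>lborel) \<le> ennreal ((\<epsilon> / 2)\<^sup>2)"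
      using fatou[of "\<epsilon> / 2"] by auto
    have "dist ((X \<circ> r) n) (abs_L2 v) < \<epsilon>" if n: "n \<ge> N" for n
    proof -
      have "ennreal ((norm (abs_L2 v - X (r n)))\<^sup>2) \<le> ennreal ((\<epsilon> / 2)\<^sup>2)"
        using N[OF n] unfolding Xu abs_L2_diff[OF sqv sq] nn_norm_abs_L2[OF square_integrable_diff[OF sqv sq]] .
      then have "(norm (abs_L2 v - X (r n)))\<^sup>2 \<le> (\<epsilon> / 2)\<^sup>2" by simp
      then have "norm (abs_L2 v - X (r n)) \<le> \<epsilon> / 2" using \<open>\<epsilon> > 0\<close> by (auto dest: power2_le_imp_le)
      then show ?thesis using \<open>\<epsilon> > 0\<close> by (simp add: dist_norm norm_minus_commute)
    qed
    then show "\<exists>N. \<forall>n\<ge>N. dist ((X \<circ> r) n) (abs_L2 v) < \<epsilon>" by blast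
  qed
  then have "X \<longlonglongrightarrow> abs_L2 v" by (rule Cauchy_converges_subseq[OF X r])
  then show ?thesis by (auto simp: convergent_def)
qed

instance L2 :: (euclidean_space) complex_hilbert
  by intro_classes (rule L2_Cauchy_convergent)

text \<open>Restricting to the sets \<open>B n\<close> makes \<open>h\<close> integrable, and its integrals over all Borel sets then
  vanish by Dynkin's lemma.\<close>

lemma AE_zero_if_integrals_zero:
  fixes h :: "'a::euclidean_space \<Rightarrow> complex"
  assumes G: "Int_stable G" "UNIV \<in> G" "sets borel = sigma_sets UNIV G"
    and B: "\<And>n::nat. B n \<in> sets borel" "(\<Union>n. B n) = UNIV"
    and int: "\<And>n. set_integrable lborel (B n) h"
    and zero: "\<And>n A. A \<in> G \<Longrightarrow> (\<integral>t. indicator (A \<inter> B n) t *\<^sub>R h t \<partial>lborel) = 0"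
  shows "AE t in lborel. h t = 0"
proof -
  have "AE t in lborel. indicator (B n) t *\<^sub>R h t = 0" for n
  proof -
    let ?k = "\<lambda>t. indicator (B n) t *\<^sub>R h t"
    have k: "integrable lborel ?k" using int[of n] by (simp add: set_integrable_def)
    have kA: "set_integrable lborel A ?k" if "A \<in> sets borel" for A
      unfolding set_integrable_def by (rule integrable_mult_indicator) (use that k in auto)
    have set_eq: "set_lebesgue_integral lborel A ?k = (\<integral>t. indicator (A \<inter> B n) t *\<^sub>R h t \<partial>lborel)" for A
      unfolding set_lebesgue_integral_def by (intro Bochner_Integration.integral_cong) (auto simp: indicator_def)
    have "set_lebesgue_integral lborel A ?k = 0" if "A \<in> sigma_sets UNIV G" for A
    proof (rule sigma_sets_induct_disjoint[OF G(1) _ that])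
      show "set_lebesgue_integral lborel A ?k = 0" if "A \<in> G" for A
        unfolding set_eq by (rule zero[OF that])
      show "set_lebesgue_integral lborel (UNIV - A) ?k = 0"
        if A: "A \<in> sigma_sets UNIV G" "set_lebesgue_integral lborel A ?k = 0" for A
      proof -
        have [measurable]: "A \<in> sets borel" using A G(3) by simp
        have "set_lebesgue_integral lborel (A \<union> (UNIV - A)) ?k
            = set_lebesgue_integral lborel A ?k + set_lebesgue_integral lborel (UNIV - A) ?k"
          by (rule set_integral_Un) (auto intro: kA)
        then show ?thesis using A(2) zero[OF G(2), of n] set_eq[of UNIV] by simp
      qed
      show "set_lebesgue_integral lborel (\<Union>i. A i) ?k = 0"
        if A: "disjoint_family A" "range A \<subseteq> sigma_sets UNIV G"
          "\<And>i. set_lebesgue_integral lborel (A i) ?k = 0" for A :: "nat \<Rightarrow> 'a set"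
      proof -
        have Ai: "A i \<in> sets borel" for i using A(2) G(3) by auto
        have "set_lebesgue_integral lborel (\<Union>i. A i) ?k = (\<Sum>i. set_lebesgue_integral lborel (A i) ?k)"
          by (rule lebesgue_integral_countable_add)
             (use Ai A(1) in \<open>auto simp: disjoint_family_on_def intro!: kA sets.countable_UN\<close>)
        then show ?thesis by (simp add: A(3))
      qed
    qed (auto simp: set_lebesgue_integral_def)
    then have "AE t in lborel. ?k t = (0 :: complex)"
      using G(3) by (intro sigma_finite_measure.density_zero[OF lborel.sigma_finite_measure_axioms k]) auto
    then show ?thesis .
  qed
  then have "AE t in lborel. \<forall>n. indicator (B n) t *\<^sub>R h t = 0" by (intro iffD2[OF AE_all_countable] allI)
  then show ?thesis
  proof eventually_elim
    case (elim t)
    obtain n where "t \<in> B n" using B(2) by blast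
    then show ?case using elim[rule_format, of n] by simp
  qed
qed

lemma square_integrable_indicator:
  "A \<in> sets borel \<Longrightarrow> bounded A \<Longrightarrow> square_integrable (\<lambda>t::'a::euclidean_space. complex_of_real (indicator A t))"
proof -
  assume A: "A \<in> sets borel" "bounded A"
  have "(cmod (complex_of_real (indicator A t)))\<^sup>2 = indicator A t" for t
    by (simp add: indicator_def)
  then show ?thesis
    using A integrable_real_indicator[of A lborel] emeasure_bounded_finite[of A]
    by (simp add: square_integrable_def)
qed

abbreviation indicator_L2 :: "'a::euclidean_space set \<Rightarrow> 'a L2" where
  "indicator_L2 A \<equiv> abs_L2 (\<lambda>t. complex_of_real (indicator A t))"

lemma L2_eq_zero_if_orthogonal_indicators:
  fixes h :: "'a::euclidean_space L2"
  assumes G: "Int_stable G" "UNIV \<in> G" "sets borel = sigma_sets UNIV G"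
    and B: "\<And>n::nat. B n \<in> sets borel" "\<And>n. bounded (B n)" "(\<Union>n. B n) = UNIV"
    and orth: "\<And>n A. A \<in> G \<Longrightarrow> cinner h (indicator_L2 (A \<inter> B n)) = 0"
  shows "h = 0"
proof -
  let ?u = "rep_L2 h"
  have sq: "square_integrable (\<lambda>t. complex_of_real (indicator (A \<inter> B n) t))" if "A \<in> sets borel" for A n
    using that B by (intro square_integrable_indicator) auto
  have eq: "?u t * cnj (complex_of_real (indicator A t)) = indicator A t *\<^sub>R ?u t" for A t
    by (simp add: scaleR_conv_of_real mult.commute)
  have "AE t in lborel. ?u t = 0"
  proof (rule AE_zero_if_integrals_zero[OF G B(1,3)])
    show "set_integrable lborel (B n) ?u" for n
      using integrable_square_integrable_mult[OF square_integrable_rep sq[of UNIV n], of h]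
      by (simp only: set_integrable_def eq Int_UNIV_left) simp
    fix n A assume "A \<in> G"
    then have "A \<in> sets borel" using G(3) by auto
    have "cinner (abs_L2 ?u) (indicator_L2 (A \<inter> B n)) = 0" using orth[OF \<open>A \<in> G\<close>] by simp
    then show "(\<integral>t. indicator (A \<inter> B n) t *\<^sub>R ?u t \<partial>lborel) = 0"
      by (simp only: cinner_abs_L2[OF square_integrable_rep sq[OF \<open>A \<in> sets borel\<close>]] eq)
  qed
  then have "abs_L2 ?u = abs_L2 (\<lambda>_. 0)"
    by (intro abs_L2_eqI) (auto simp: square_integrable_zero)
  then show ?thesis by (simp add: zero_L2_def)
qed

text \<open>Each element of the basis has a non-zero inner product with one of countably many indicator
  functions, and by Bessel's inequality each of these sees only countably many basis elements.\<close>

lemma countable_onb: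
  fixes E :: "'a::euclidean_space L2 set"
  assumes E: "is_onb E"
  shows "countable E"
proof -
  obtain \<B> :: "'a set set" where \<B>: "countable \<B>" "topological_basis \<B>"
    using ex_countable_basis by blast
  define G where "G = Inter ` {\<A>. finite \<A> \<and> \<A> \<subseteq> \<B>}"
  have "Int_stable G"
    unfolding Int_stable_def
  proof (intro ballI)
    fix S T assume "S \<in> G" "T \<in> G"
    then obtain \<A> \<A>' where "S = \<Inter>\<A>" "T = \<Inter>\<A>'" "finite \<A>" "\<A> \<subseteq> \<B>" "finite \<A>'" "\<A>' \<subseteq> \<B>"
      by (auto simp: G_def)
    then show "S \<inter> T \<in> G" unfolding G_def by (intro image_eqI[of _ _ "\<A> \<union> \<A>'"]) auto
  qed
  have "UNIV \<in> G" unfolding G_def by (intro image_eqI[of _ _ "{}"]) auto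
  have "countable G" unfolding G_def by (intro countable_image countable_Collect_finite_subset \<B>)
  have "G \<subseteq> sets borel"
    using \<B>(2) by (auto simp: G_def topological_basis_def intro!: borel_open open_Inter)
  have "\<B> \<subseteq> G"
  proof
    fix S assume "S \<in> \<B>"
    then show "S \<in> G" unfolding G_def by (intro image_eqI[of _ _ "{S}"]) auto
  qed
  have "sets borel = sigma_sets UNIV \<B>"
    by (subst borel_eq_countable_basis[OF \<B>]) simp
  also have "\<dots> \<subseteq> sigma_sets UNIV G" using \<open>\<B> \<subseteq> G\<close> by (rule sigma_sets_subseteq)
  finally have "sets borel \<subseteq> sigma_sets UNIV G" .
  moreover have "sigma_sets UNIV G \<subseteq> sets borel"
    using sets.sigma_sets_subset[OF \<open>G \<subseteq> sets borel\<close>] by simp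
  ultimately have sG: "sets borel = sigma_sets UNIV G" by blast
  let ?B = "\<lambda>n. cball (0::'a) (real n)"
  define D where "D = (\<lambda>(S, n). indicator_L2 (S \<inter> ?B n)) ` (G \<times> UNIV)"
  have "countable D" unfolding D_def using \<open>countable G\<close> by auto
  have UB: "(\<Union>n. ?B n) = UNIV" by (auto intro: real_arch_simple)
  have "E \<subseteq> (\<Union>d\<in>D. {e \<in> E. (cmod (cinner d e))\<^sup>2 \<noteq> 0})"
  proof
    fix e assume "e \<in> E"
    then have "e \<noteq> 0" using E by (auto simp: is_onb_def)
    have "\<exists>d\<in>D. cinner e d \<noteq> 0"
    proof (rule ccontr)
      assume "\<not> ?thesis"
      then have "e = 0"
        by (intro L2_eq_zero_if_orthogonal_indicators[OF \<open>Int_stable G\<close> \<open>UNIV \<in> G\<close> sG, of ?B])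
           (auto simp: D_def UB)
      with \<open>e \<noteq> 0\<close> show False ..
    qed
    then show "e \<in> (\<Union>d\<in>D. {e \<in> E. (cmod (cinner d e))\<^sup>2 \<noteq> 0})"
      using \<open>e \<in> E\<close> cinner_eq_zero_commute by auto
  qed
  moreover have "countable (\<Union>d\<in>D. {e \<in> E. (cmod (cinner d e))\<^sup>2 \<noteq> 0})"
    using bessel_summable(1)[OF onb_orthonormal[OF E]]
    by (intro countable_UN \<open>countable D\<close> summable_countable_real)
  ultimately show ?thesis by (rule countable_subset)
qed

lemma square_integrable_tensor:
  "square_integrable u \<Longrightarrow> square_integrable v \<Longrightarrow> square_integrable (\<lambda>(s, t). u s * v t)"
  using tensor.rsp[THEN rel_funD, THEN rel_funD, of u u v v] by (simp add: L2_rel_def)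

lemma tensor_abs_L2:
  "square_integrable u \<Longrightarrow> square_integrable v \<Longrightarrow> abs_L2 u \<otimes> abs_L2 v = abs_L2 (\<lambda>(s, t). u s * v t)"
  by (simp add: tensor.abs_eq)

lemma cinner_tensor: "cinner (f \<otimes> g) (f' \<otimes> g') = cinner f f' * cinner g g'"
proof -
  let ?u = "rep_L2 f" and ?v = "rep_L2 g" and ?u' = "rep_L2 f'" and ?v' = "rep_L2 g'"
  let ?h = "\<lambda>p. (case p of (s, t) \<Rightarrow> ?u s * ?v t) * cnj (case p of (s, t) \<Rightarrow> ?u' s * ?v' t)"
  have "cinner (abs_L2 ?u \<otimes> abs_L2 ?v) (abs_L2 ?u' \<otimes> abs_L2 ?v') = integral\<^sup>L lborel ?h"
    by (simp only: tensor_abs_L2 square_integrable_rep cinner_abs_L2 square_integrable_tensor)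
  also have "\<dots> = (\<integral>p. ?h p \<partial>(lborel \<Otimes>\<^sub>M lborel))" by (simp only: lborel_prod)
  also have "\<dots> = (\<integral>s. \<integral>t. ?h (s, t) \<partial>lborel \<partial>lborel)"
    by (rule lborel_pair.integral_fst'[symmetric], unfold lborel_prod)
       (intro integrable_square_integrable_mult square_integrable_tensor square_integrable_rep)
  also have "\<dots> = (\<integral>s. \<integral>t. (?u s * cnj (?u' s)) * (?v t * cnj (?v' t)) \<partial>lborel \<partial>lborel)"
    by (simp add: mult_ac)
  also have "\<dots> = cinner (abs_L2 ?u) (abs_L2 ?u') * cinner (abs_L2 ?v) (abs_L2 ?v')"
    by (simp only: cinner_abs_L2 square_integrable_rep integral_mult_right_zero integral_mult_left_zero)
  finally show ?thesis by simp
qed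

text \<open>The Borel sets of a product space are generated by the rectangles, whose indicator functions are
  tensor products.\<close>

lemma tensor_dense:
  fixes h :: "('a::euclidean_space \<times> 'b::euclidean_space) L2"
  assumes "\<And>f g. cinner h (f \<otimes> g) = 0"
  shows "h = 0"
proof (rule L2_eq_zero_if_orthogonal_indicators)
  let ?G = "{A \<times> C | A C. A \<in> sets (borel :: 'a measure) \<and> C \<in> sets (borel :: 'b measure)}"
  show "Int_stable ?G" by (rule Int_stable_pair_measure_generator)
  show "UNIV \<in> ?G" by (intro CollectI exI[of _ UNIV]) auto
  show "sets borel = sigma_sets UNIV ?G"
    unfolding borel_prod[symmetric] sets_pair_measure by simp
  let ?B = "\<lambda>n. cball (0::'a) (real n) \<times> cball (0::'b) (real n)"
  show "?B n \<in> sets borel" "bounded (?B n)" for n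
    by (auto intro!: borel_closed closed_Times bounded_Times)
  show "(\<Union>n. ?B n) = UNIV"
  proof -
    have "\<exists>n. norm (fst p) \<le> real n \<and> norm (snd p) \<le> real n" for p :: "'a \<times> 'b"
      using real_arch_simple[of "max (norm (fst p)) (norm (snd p))"] by auto
    then show ?thesis by (force simp: mem_Times_iff)
  qed
  fix n and S assume "S \<in> ?G"
  then obtain A C where S: "S = A \<times> C" "A \<in> sets borel" "C \<in> sets borel" by auto
  have sq: "square_integrable (\<lambda>t. complex_of_real (indicator (A \<inter> cball 0 (real n)) t))"
    "square_integrable (\<lambda>t. complex_of_real (indicator (C \<inter> cball 0 (real n)) t))"
    using S(2,3) by (auto intro!: square_integrable_indicator)
  have "indicator_L2 (S \<inter> ?B n) = indicator_L2 (A \<inter> cball 0 (real n)) \<otimes> indicator_L2 (C \<inter> cball 0 (real n))"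
    unfolding tensor_abs_L2[OF sq]
    by (rule arg_cong[where f = abs_L2]) (auto simp: S(1) indicator_def fun_eq_iff)
  then show "cinner h (indicator_L2 (S \<inter> ?B n)) = 0" by (simp add: assms)
qed

lemma
  fixes f f' :: "'a::euclidean_space L2" and g g' :: "'b::euclidean_space L2"
  shows tensor_add_left: "(f + f') \<otimes> g = f \<otimes> g + f' \<otimes> g"
    and tensor_add_right: "f \<otimes> (g + g') = f \<otimes> g + f \<otimes> g'"
    and tensor_scaleC_left: "(c *\<^sub>C f) \<otimes> g = c *\<^sub>C (f \<otimes> g)"
    and tensor_scaleC_right: "f \<otimes> (c *\<^sub>C g) = c *\<^sub>C (f \<otimes> g)"
proof -
  note sq = square_integrable_rep square_integrable_add square_integrable_scale square_integrable_tensor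
  let ?u = "rep_L2 f" and ?u' = "rep_L2 f'" and ?v = "rep_L2 g" and ?v' = "rep_L2 g'"
  have "(abs_L2 ?u + abs_L2 ?u') \<otimes> abs_L2 ?v = abs_L2 ?u \<otimes> abs_L2 ?v + abs_L2 ?u' \<otimes> abs_L2 ?v"
    by (simp only: abs_L2_plus tensor_abs_L2 sq) (simp add: case_prod_beta' algebra_simps)
  then show "(f + f') \<otimes> g = f \<otimes> g + f' \<otimes> g" by simp
  have "abs_L2 ?u \<otimes> (abs_L2 ?v + abs_L2 ?v') = abs_L2 ?u \<otimes> abs_L2 ?v + abs_L2 ?u \<otimes> abs_L2 ?v'"
    by (simp only: abs_L2_plus tensor_abs_L2 sq) (simp add: case_prod_beta' algebra_simps)
  then show "f \<otimes> (g + g') = f \<otimes> g + f \<otimes> g'" by simp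
  have "(c *\<^sub>C abs_L2 ?u) \<otimes> abs_L2 ?v = c *\<^sub>C (abs_L2 ?u \<otimes> abs_L2 ?v)"
    by (simp only: abs_L2_scaleC tensor_abs_L2 sq) (simp add: case_prod_beta' algebra_simps)
  then show "(c *\<^sub>C f) \<otimes> g = c *\<^sub>C (f \<otimes> g)" by simp
  have "abs_L2 ?u \<otimes> (c *\<^sub>C abs_L2 ?v) = c *\<^sub>C (abs_L2 ?u \<otimes> abs_L2 ?v)"
    by (simp only: abs_L2_scaleC tensor_abs_L2 sq) (simp add: case_prod_beta' algebra_simps)
  then show "f \<otimes> (c *\<^sub>C g) = c *\<^sub>C (f \<otimes> g)" by simp
qed

interpretation L2_tensor: hilbert_tensor
  "tensor :: 'a::euclidean_space L2 \<Rightarrow> 'b::euclidean_space L2 \<Rightarrow> ('a \<times> 'b) L2"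
  by unfold_locales
     (simp_all add: tensor_add_left tensor_add_right tensor_scaleC_left tensor_scaleC_right
       cinner_tensor tensor_dense)

interpretation L2_tensor_flip: hilbert_tensor
  "\<lambda>(g :: 'b::euclidean_space L2) (f :: 'a::euclidean_space L2). f \<otimes> g"
  by unfold_locales
     (simp_all add: tensor_add_left tensor_add_right tensor_scaleC_left tensor_scaleC_right
       cinner_tensor tensor_dense)

lemma partial_trace_1_product:
  fixes A :: "'a::euclidean_space L2 \<Rightarrow> 'a L2" and B :: "'b::euclidean_space L2 \<Rightarrow> 'b L2"
  assumes A: "A \<in> trace_class" and B: "B \<in> trace_class" and C: "C \<in> trace_class"
    and prod: "\<And>f g. C (f \<otimes> g) = A f \<otimes> B g"
  shows "partial_trace_1 C = (\<lambda>f. trace B *\<^sub>C A f)"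
proof -
  have "(partial_trace_1 :: (('a \<times> 'b) L2 \<Rightarrow> _) \<Rightarrow> _) = restrict L2_tensor.ptr trace_class"
    unfolding partial_trace_1_def tensor_op_def
    using L2_tensor.the_partial_trace[unfolded L2_tensor.ten_op_def] by simp
  then have "partial_trace_1 C = restrict L2_tensor.ptr trace_class C" by (rule fun_cong)
  also have "\<dots> = L2_tensor.ptr C" using C by (rule restrict_apply')
  finally show ?thesis by (simp only: L2_tensor.ptr_product[OF B prod])
qed

lemma partial_trace_2_product:
  fixes A :: "'a::euclidean_space L2 \<Rightarrow> 'a L2" and B :: "'b::euclidean_space L2 \<Rightarrow> 'b L2"
  assumes A: "A \<in> trace_class" and B: "B \<in> trace_class" and C: "C \<in> trace_class"
    and prod: "\<And>f g. C (f \<otimes> g) = A f \<otimes> B g"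
  shows "partial_trace_2 C = (\<lambda>g. trace A *\<^sub>C B g)"
proof -
  have op: "tensor_op A B = L2_tensor_flip.ten_op B A" for A :: "'a L2 \<Rightarrow> 'a L2" and B :: "'b L2 \<Rightarrow> 'b L2"
    unfolding tensor_op_def L2_tensor_flip.ten_op_def by (subst all_comm) simp
  have swap: "(\<forall>A\<in>trace_class. \<forall>B\<in>trace_class. T (L2_tensor_flip.ten_op B A) = (\<lambda>g. trace A *\<^sub>C B g)) \<longleftrightarrow>
      (\<forall>A\<in>trace_class. \<forall>B\<in>trace_class. T (L2_tensor_flip.ten_op A B) = (\<lambda>g. trace B *\<^sub>C A g))"
    for T :: "(('a \<times> 'b) L2 \<Rightarrow> _) \<Rightarrow> _" by blast
  have "(partial_trace_2 :: (('a \<times> 'b) L2 \<Rightarrow> _) \<Rightarrow> _) = restrict L2_tensor_flip.ptr trace_class"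
    unfolding partial_trace_2_def op swap by (rule L2_tensor_flip.the_partial_trace)
  then have "partial_trace_2 C = restrict L2_tensor_flip.ptr trace_class C" by (rule fun_cong)
  also have "\<dots> = L2_tensor_flip.ptr C" using C by (rule restrict_apply')
  finally show ?thesis by (simp only: L2_tensor_flip.ptr_product[OF A prod])
qed

section \<open>Multipliers with integrable symbols\<close>

lemma weakly_measurable_swap:
  assumes "weakly_measurable \<mu> F"
  shows "(\<lambda>x. cinner f (F x)) \<in> borel_measurable \<mu>" "(\<lambda>x. cinner (F x) f) \<in> borel_measurable \<mu>"
proof -
  show *: "(\<lambda>x. cinner f (F x)) \<in> borel_measurable \<mu>" using assms by (simp add: weakly_measurable_def)
  show "(\<lambda>x. cinner (F x) f) \<in> borel_measurable \<mu>"
    using measurable_compose[OF * borel_measurable_cnj] by (simp add: cinner_commute[of _ f, symmetric])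
qed

lemma
  fixes F :: "'x \<Rightarrow> 'h::complex_hilbert"
  assumes w: "integrable \<mu> w" and F: "weakly_measurable \<mu> F" and K: "\<And>x. norm (F x) \<le> K"
  shows integrable_multiplier: "integrable \<mu> (\<lambda>x. w x * cinner f (F x) * cinner (F x) g)"
    and multiplier_form_le: "cmod (\<integral>x. w x * cinner f (F x) * cinner (F x) g \<partial>\<mu>)
      \<le> (\<integral>x. cmod (w x) \<partial>\<mu>) * K\<^sup>2 * norm f * norm g"
proof -
  note [measurable] = weakly_measurable_swap[OF F] borel_measurable_integrable[OF w]
  have "0 \<le> K" using order_trans[OF norm_ge_zero K] .
  have le: "cmod (w x * cinner f (F x) * cinner (F x) g) \<le> cmod (w x) * (K\<^sup>2 * norm f * norm g)" for x
  proof -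
    have "cmod (cinner f (F x)) * cmod (cinner (F x) g) \<le> (norm f * K) * (K * norm g)"
      by (intro mult_mono order_trans[OF cmod_cinner_le] mult_left_mono mult_right_mono K)
         (simp_all add: \<open>0 \<le> K\<close>)
    then have "cmod (w x) * (cmod (cinner f (F x)) * cmod (cinner (F x) g)) \<le> cmod (w x) * ((norm f * K) * (K * norm g))"
      by (rule mult_left_mono) simp
    then show ?thesis by (simp add: norm_mult power2_eq_square mult_ac)
  qed
  have int: "integrable \<mu> (\<lambda>x. cmod (w x) * (K\<^sup>2 * norm f * norm g))"
    using w by (intro integrable_mult_left integrable_norm) auto
  show I: "integrable \<mu> (\<lambda>x. w x * cinner f (F x) * cinner (F x) g)"
    by (rule Bochner_Integration.integrable_bound[OF int])
       (measurable, use le in \<open>auto intro!: AE_I2 order_trans[OF _ abs_ge_self]\<close>)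
  have "cmod (\<integral>x. w x * cinner f (F x) * cinner (F x) g \<partial>\<mu>) \<le> (\<integral>x. cmod (w x) * (K\<^sup>2 * norm f * norm g) \<partial>\<mu>)"
    by (intro order_trans[OF integral_norm_bound] integral_mono integrable_norm I int le)
  then show "cmod (\<integral>x. w x * cinner f (F x) * cinner (F x) g \<partial>\<mu>)
      \<le> (\<integral>x. cmod (w x) \<partial>\<mu>) * K\<^sup>2 * norm f * norm g"
    by (simp add: mult.assoc)
qed

text \<open>The sesquilinear form defining the multiplier is bounded, so the Riesz representation theorem
  yields the operator.\<close>

lemma
  fixes F :: "'x \<Rightarrow> 'h::complex_hilbert"
  assumes w: "integrable \<mu> w" and F: "weakly_measurable \<mu> F" and K: "\<And>x. norm (F x) \<le> K"
  shows bounded_clinear_multiplier: "bounded_clinear (multiplier \<mu> w F F)"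
    and cinner_multiplier:
      "cinner (multiplier \<mu> w F F f) g = (\<integral>x. w x * cinner f (F x) * cinner (F x) g \<partial>\<mu>)"
proof -
  note I = integrable_multiplier[OF w F K] and I_le = multiplier_form_le[OF w F K]
  define J where "J f g = (\<integral>x. w x * cinner f (F x) * cinner (F x) g \<partial>\<mu>)" for f g
  define C where "C = (\<integral>x. cmod (w x) \<partial>\<mu>) * K\<^sup>2"
  have J_le: "cmod (J f g) \<le> C * norm f * norm g" for f g unfolding J_def C_def by (rule I_le)
  have J_add: "J f (g + g') = J f g + J f g'" "J (f + f') g = J f g + J f' g" for f f' g g'
    unfolding J_def by (simp_all add: cinner_linear distrib_left distrib_right I)
  have J_scale: "J f (c *\<^sub>C g) = cnj c * J f g" "J (c *\<^sub>C f) g = c * J f g" for c f g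
    unfolding J_def by (simp_all add: cinner_linear mult_ac flip: integral_mult_right_zero)
  have "\<exists>r. \<forall>g. cnj (J f g) = cinner g r" for f
  proof (rule riesz_representation)
    show "bounded_linear (\<lambda>g. cnj (J f g))"
      by (rule bounded_linear_intro[where K = "C * norm f"])
         (use J_le[of f] in \<open>simp_all add: J_add J_scale scaleR_scaleC scaleR_conv_of_real mult.commute\<close>)
  qed (simp add: J_scale)
  then obtain M where "\<And>f g. cnj (J f g) = cinner g (M f)" by metis
  then have M: "cinner (M f) g = J f g" for f g
    by (metis cinner_commute complex_cnj_cnj)
  have "bounded_clinear M"
  proof (rule bounded_clinearI[where K = C])
    show "M (f + g) = M f + M g" for f g
      by (rule eq_by_cinner_right) (simp add: cinner_linear M J_add)
    show "M (c *\<^sub>C f) = c *\<^sub>C M f" for c f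
      by (rule eq_by_cinner_right) (simp add: cinner_linear M J_scale)
    show "norm (M f) \<le> C * norm f" for f
    proof -
      have "(norm (M f))\<^sup>2 = cmod (cinner (M f) (M f))" by (simp add: cinner_self norm_power)
      also have "\<dots> \<le> C * norm f * norm (M f)" unfolding M by (rule J_le)
      finally have "norm (M f) * norm (M f) \<le> C * norm f * norm (M f)" by (simp add: power2_eq_square)
      moreover have "0 \<le> C" unfolding C_def by simp
      ultimately show ?thesis by (cases "norm (M f) = 0") (auto simp: mult_le_cancel_right)
    qed
  qed
  moreover have "multiplier \<mu> w F F = M"
    unfolding multiplier_def
  proof (rule the_equality)
    show "is_multiplier \<mu> w F F M"
      using I F borel_measurable_integrable[OF w] by (simp add: is_multiplier_def M J_def)
    fix M' assume "is_multiplier \<mu> w F F M'"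
    then have "cinner (M' f) g = cinner (M f) g" for f g by (simp add: is_multiplier_def M J_def)
    then show "M' = M" by (intro ext eq_by_cinner_right)
  qed
  ultimately show "bounded_clinear (multiplier \<mu> w F F)"
    "cinner (multiplier \<mu> w F F f) g = (\<integral>x. w x * cinner f (F x) * cinner (F x) g \<partial>\<mu>)"
    using M by (simp_all add: J_def)
qed

lemma finite_to_nat_on_less:
  assumes "countable E"
  shows "finite {e \<in> E. to_nat_on E e < n}"
  by (rule finite_imageD[of "to_nat_on E"])
     (auto intro: finite_subset[of _ "{..<n}"] inj_on_subset[OF inj_on_to_nat_on[OF assms]])

lemma has_sum_imp_sequence_limit:
  assumes "countable E" "(f has_sum s) E"
  shows "(\<lambda>n. sum f {e \<in> E. to_nat_on E e < n}) \<longlonglongrightarrow> s"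
proof -
  note fin = finite_to_nat_on_less[OF assms(1)]
  have "filterlim (\<lambda>n. {e \<in> E. to_nat_on E e < n}) (finite_subsets_at_top E) sequentially"
    unfolding filterlim_finite_subsets_at_top
  proof (intro allI impI)
    fix X assume X: "finite X \<and> X \<subseteq> E"
    have "\<forall>\<^sub>F n in sequentially. Max (insert 0 (to_nat_on E ` X)) < n" by (rule eventually_gt_at_top)
    then show "\<forall>\<^sub>F n in sequentially. finite {e \<in> E. to_nat_on E e < n} \<and>
        X \<subseteq> {e \<in> E. to_nat_on E e < n} \<and> {e \<in> E. to_nat_on E e < n} \<subseteq> E"
      by eventually_elim (use X fin in auto)
  qed
  then show ?thesis using assms(2) unfolding has_sum_def by (rule filterlim_compose[rotated])
qed

text \<open>In an orthonormal basis \<open>\<langle>M e, e\<rangle> = \<integral> w |\<langle>e, F\<rangle>|\<^sup>2\<close>; as the basis is countable, dominated convergence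
  and Parseval's identity turn the sum of these into \<open>\<integral> w \<parallel>F\<parallel>\<^sup>2\<close>.\<close>

lemma density_operator_multiplier:
  fixes F :: "'x \<Rightarrow> 'h::complex_hilbert" and w :: "'x \<Rightarrow> real"
  assumes countable: "\<And>E :: 'h set. is_onb E \<Longrightarrow> countable E"
    and w: "integrable \<mu> w" "AE x in \<mu>. 0 \<le> w x" and F: "weakly_measurable \<mu> F" "\<And>x. norm (F x) = c"
    and total: "(\<integral>x. w x \<partial>\<mu>) * c\<^sup>2 = 1"
  shows "density_operator (multiplier \<mu> (\<lambda>x. complex_of_real (w x)) F F)" (is "density_operator ?M")
proof -
  have wc: "integrable \<mu> (\<lambda>x. complex_of_real (w x))" using w by simp
  have Fle: "norm (F x) \<le> c" for x using F by simp
  note M = cinner_multiplier[OF wc F(1) Fle]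
  note [measurable] = weakly_measurable_swap[OF F(1)] borel_measurable_integrable[OF w(1)]
  have diag: "of_real (w x) * cinner f (F x) * cinner (F x) f = complex_of_real (w x * (cmod (cinner f (F x)))\<^sup>2)" for f x
    using complex_norm_square[of "cinner f (F x)"] by (simp add: cinner_commute[of "F x" f])
  have diag_int: "integrable \<mu> (\<lambda>x. w x * (cmod (cinner f (F x)))\<^sup>2)" for f
    using integrable_Re[OF integrable_multiplier[OF wc F(1) Fle, of f f]]
    unfolding diag Re_complex_of_real .
  have Mdiag: "cinner (?M f) f = complex_of_real (\<integral>x. w x * (cmod (cinner f (F x)))\<^sup>2 \<partial>\<mu>)" for f
    unfolding M diag by (rule integral_complex_of_real)
  have "selfadjoint ?M"
    unfolding selfadjoint_def
  proof (intro allI)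
    fix f g
    have "cinner f (?M g) = cnj (cinner (?M g) f)" by (rule cinner_commute)
    also have "\<dots> = (\<integral>x. cnj (of_real (w x) * cinner g (F x) * cinner (F x) f) \<partial>\<mu>)"
      unfolding M by (rule Bochner_Integration.integral_cnj[symmetric])
    also have "\<dots> = cinner (?M f) g"
      unfolding M
      by (intro Bochner_Integration.integral_cong refl)
         (simp add: cinner_commute[of g] cinner_commute[of _ f] mult_ac)
    finally show "cinner (?M f) g = cinner f (?M g)" ..
  qed
  moreover have "0 \<le> Re (cinner (?M f) f)" for f
    unfolding Mdiag using w(2) by (auto intro!: integral_nonneg_AE elim: eventually_mono)
  ultimately have nonneg: "nonneg_operator ?M"
    using bounded_clinear_multiplier[OF wc F(1) Fle] by (simp add: nonneg_operator_def)
  obtain E :: "'h set" where E: "is_onb E" using ex_onb by blast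
  have sum_eq: "(\<Sum>e\<in>S. \<integral>x. w x * (cmod (cinner e (F x)))\<^sup>2 \<partial>\<mu>)
      = (\<integral>x. w x * (\<Sum>e\<in>S. (cmod (cinner e (F x)))\<^sup>2) \<partial>\<mu>)" for S
    by (simp add: sum_distrib_left diag_int)
  have sum_le: "w x * (\<Sum>e\<in>S. (cmod (cinner e (F x)))\<^sup>2) \<le> w x * c\<^sup>2"
    if "finite S" "S \<subseteq> E" "0 \<le> w x" for S x
    using bessel_finite[OF onb_orthonormal[OF E] that(2,1), of "F x"] that(3) F(2)
    by (intro mult_left_mono) (simp_all add: cmod_cinner_commute)
  have "(\<lambda>e. Re (cinner (?M e) e)) summable_on E"
  proof (rule nonneg_bdd_above_summable_on)
    show "0 \<le> Re (cinner (?M e) e)" for e using nonneg by (simp add: nonneg_operator_def)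
    show "bdd_above (sum (\<lambda>e. Re (cinner (?M e) e)) ` {S. S \<subseteq> E \<and> finite S})"
    proof (rule bdd_aboveI2)
      fix S assume S: "S \<in> {S. S \<subseteq> E \<and> finite S}"
      have "(\<Sum>e\<in>S. Re (cinner (?M e) e)) = (\<integral>x. w x * (\<Sum>e\<in>S. (cmod (cinner e (F x)))\<^sup>2) \<partial>\<mu>)"
        unfolding Mdiag Re_complex_of_real by (rule sum_eq)
      also have "\<dots> \<le> (\<integral>x. w x * c\<^sup>2 \<partial>\<mu>)"
        using w S by (intro integral_mono_AE) (auto simp: sum_distrib_left diag_int elim!: eventually_mono
            intro!: sum_le[unfolded sum_distrib_left])
      finally show "(\<Sum>e\<in>S. Re (cinner (?M e) e)) \<le> (\<integral>x. w x * c\<^sup>2 \<partial>\<mu>)" .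
    qed
  qed
  then have tc: "?M \<in> trace_class" by (rule nonneg_trace_classI[OF nonneg E])
  let ?S = "\<lambda>n. {e \<in> E. to_nat_on E e < n}"
  note S = finite_to_nat_on_less[OF countable[OF E]]
  have "(\<lambda>n. \<integral>x. w x * (\<Sum>e\<in>?S n. (cmod (cinner e (F x)))\<^sup>2) \<partial>\<mu>) \<longlonglongrightarrow> (\<integral>x. w x * c\<^sup>2 \<partial>\<mu>)"
  proof (rule integral_dominated_convergence[where w = "\<lambda>x. w x * c\<^sup>2"])
    show "AE x in \<mu>. (\<lambda>n. w x * (\<Sum>e\<in>?S n. (cmod (cinner e (F x)))\<^sup>2)) \<longlonglongrightarrow> w x * c\<^sup>2"
    proof (intro AE_I2 tendsto_mult_left)
      fix x
      show "(\<lambda>n. \<Sum>e\<in>?S n. (cmod (cinner e (F x)))\<^sup>2) \<longlonglongrightarrow> c\<^sup>2"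
        using has_sum_imp_sequence_limit[OF countable[OF E] parseval_norm[OF E, of "F x"]]
        by (simp add: F(2) cmod_cinner_commute[of "F x"])
    qed
    show "AE x in \<mu>. norm (w x * (\<Sum>e\<in>?S n. (cmod (cinner e (F x)))\<^sup>2)) \<le> w x * c\<^sup>2" for n
      using w(2) by eventually_elim (use S sum_le in \<open>simp add: sum_nonneg\<close>)
    show "integrable \<mu> (\<lambda>x. w x * c\<^sup>2)" using w by simp
  qed measurable
  then have "(\<lambda>n. \<Sum>e\<in>?S n. cinner (?M e) e) \<longlonglongrightarrow> complex_of_real (\<integral>x. w x * c\<^sup>2 \<partial>\<mu>)"
    unfolding Mdiag sum_eq[symmetric] of_real_sum[symmetric] by (rule tendsto_of_real)
  moreover have "(\<lambda>n. \<Sum>e\<in>?S n. cinner (?M e) e) \<longlonglongrightarrow> trace ?M"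
    by (rule has_sum_imp_sequence_limit[OF countable[OF E] trace_has_sum[OF tc E]])
  ultimately have "trace ?M = complex_of_real (\<integral>x. w x * c\<^sup>2 \<partial>\<mu>)" by (rule LIMSEQ_unique[rotated])
  then have "trace ?M = 1" using total by simp
  then show ?thesis using nonneg tc by (simp add: density_operator_def)
qed


section \<open>Time-frequency shifts\<close>

lemma borel_measurable_comp_continuous:
  "f \<in> borel_measurable borel \<Longrightarrow> continuous_on UNIV c \<Longrightarrow> (\<lambda>x. f (c x)) \<in> borel_measurable borel"
  by (rule measurable_compose[OF borel_measurable_continuous_onI])

lemma square_integrable_translate: "square_integrable u \<Longrightarrow> square_integrable (\<lambda>t. u (t - x))"
  using translation.rsp[THEN rel_funD, THEN rel_funD, of x x u u] by (simp add: L2_rel_def)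

abbreviation phase :: "'a::euclidean_space \<Rightarrow> 'a \<Rightarrow> complex" where
  "phase \<omega> t \<equiv> exp (2 * complex_of_real pi * \<i> * complex_of_real (inner \<omega> t))"

lemma square_integrable_modulate: "square_integrable u \<Longrightarrow> square_integrable (\<lambda>t. phase \<omega> t * u t)"
  using modulation.rsp[THEN rel_funD, THEN rel_funD, of \<omega> \<omega> u u] by (simp add: L2_rel_def)

lemma tf_shift_abs_L2:
  "square_integrable u \<Longrightarrow> tf_shift x \<omega> (abs_L2 u) = abs_L2 (\<lambda>t. phase \<omega> t * u (t - x))"
  by (simp add: tf_shift_def translation.abs_eq modulation.abs_eq square_integrable_translate)

lemma norm_tf_shift: "norm (tf_shift x \<omega> \<phi>) = norm (\<phi> :: 'a::euclidean_space L2)"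
proof -
  let ?u = "rep_L2 \<phi>"
  note [measurable] = square_integrable_measurable[OF square_integrable_rep[of \<phi>]]
  have "(norm (tf_shift x \<omega> (abs_L2 ?u)))\<^sup>2 = (\<integral>t. (cmod (?u (- x + t)))\<^sup>2 \<partial>lborel)"
    unfolding tf_shift_abs_L2[OF square_integrable_rep]
      norm_abs_L2[OF square_integrable_modulate[OF square_integrable_translate[OF square_integrable_rep]]]
    by (simp add: norm_mult)
  also have "\<dots> = (\<integral>t. (cmod (?u t))\<^sup>2 \<partial>distr lborel borel ((+) (- x)))"
    by (rule integral_distr[symmetric]) auto
  also have "\<dots> = (norm (abs_L2 ?u))\<^sup>2"
    by (simp only: lborel_distr_plus norm_abs_L2 square_integrable_rep)
  finally show ?thesis by (simp add: power2_eq_iff_nonneg)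
qed

lemma weakly_measurable_tf_shift:
  "weakly_measurable lebesgue (\<lambda>(x, \<omega>). tf_shift x \<omega> (\<phi> :: 'a::euclidean_space L2))"
  unfolding weakly_measurable_def
proof
  fix f :: "'a L2"
  let ?u = "rep_L2 \<phi>" and ?v = "rep_L2 f"
  note [measurable] = square_integrable_measurable[OF square_integrable_rep[of \<phi>]]
    square_integrable_measurable[OF square_integrable_rep[of f]]
  have eq: "cinner f (tf_shift x \<omega> \<phi>) = (\<integral>t. ?v t * cnj (phase \<omega> t * ?u (t - x)) \<partial>lborel)" for x \<omega>
    using tf_shift_abs_L2[OF square_integrable_rep, of x \<omega> \<phi>]
      cinner_abs_L2[OF square_integrable_rep[of f]
        square_integrable_modulate[OF square_integrable_translate[OF square_integrable_rep[of \<phi>]]], of \<omega> x]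
    by simp
  have phase_meas: "(\<lambda>p. phase (snd (fst p)) (snd p)) \<in> borel_measurable (borel :: (('a \<times> 'a) \<times> 'a) measure)"
    by (intro borel_measurable_continuous_onI continuous_intros)
  have u_meas: "(\<lambda>p :: ('a \<times> 'a) \<times> 'a. ?u (snd p - fst (fst p))) \<in> borel_measurable borel"
    and v_meas: "(\<lambda>p :: ('a \<times> 'a) \<times> 'a. ?v (snd p)) \<in> borel_measurable borel"
    by (rule borel_measurable_comp_continuous; measurable; intro continuous_intros)+
  have "(\<lambda>p. ?v (snd p) * cnj (phase (snd (fst p)) (snd p) * ?u (snd p - fst (fst p)))) \<in> borel_measurable borel"
    using phase_meas u_meas v_meas by simp
  then have "(\<lambda>z. \<integral>t. ?v t * cnj (phase (snd z) t * ?u (t - fst z)) \<partial>lborel) \<in> borel_measurable (lborel :: ('a \<times> 'a) measure)"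
    by (intro lborel.borel_measurable_lebesgue_integral) (simp add: lborel_prod case_prod_beta')
  then have "(\<lambda>z. cinner f (case z of (x, \<omega>) \<Rightarrow> tf_shift x \<omega> \<phi>)) \<in> borel_measurable lborel"
    by (simp add: case_prod_beta' eq)
  then show "(\<lambda>z. cinner f (case z of (x, \<omega>) \<Rightarrow> tf_shift x \<omega> \<phi>)) \<in> borel_measurable lebesgue"
    by (rule measurable_completion)
qed

lemma tf_shift_tensor:
  "tf_shift (x1, x2) (\<omega>1, \<omega>2) (\<phi>1 \<otimes> \<phi>2) = tf_shift x1 \<omega>1 \<phi>1 \<otimes> tf_shift x2 \<omega>2 \<phi>2"
proof -
  note sq = square_integrable_rep square_integrable_translate square_integrable_modulate square_integrable_tensor
  let ?u = "rep_L2 \<phi>1" and ?v = "rep_L2 \<phi>2"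
  have "tf_shift (x1, x2) (\<omega>1, \<omega>2) (abs_L2 ?u \<otimes> abs_L2 ?v)
      = tf_shift x1 \<omega>1 (abs_L2 ?u) \<otimes> tf_shift x2 \<omega>2 (abs_L2 ?v)"
    by (simp only: tf_shift_abs_L2 tensor_abs_L2 sq)
       (auto intro!: arg_cong[where f = abs_L2] simp: fun_eq_iff algebra_simps exp_add)
  then show ?thesis by simp
qed


section \<open>Fubini's theorem in phase space coordinates\<close>

text \<open>The symbol \<open>m\<close> is a product in the grouping \<open>((x\<^sub>1, \<omega>\<^sub>1), (x\<^sub>2, \<omega>\<^sub>2))\<close> of the variables rather than
  in the grouping \<open>((x\<^sub>1, x\<^sub>2), (\<omega>\<^sub>1, \<omega>\<^sub>2))\<close> of phase space, so that the permutation exchanging the two has to be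
  shown to preserve Lebesgue measure.\<close>

definition regroup :: "('a \<times> 'c) \<times> ('b \<times> 'e) \<Rightarrow> ('a \<times> 'b) \<times> ('c \<times> 'e)" where
  "regroup z = ((fst (fst z), fst (snd z)), (snd (fst z), snd (snd z)))"

lemma nn_integral_lborel_pair:
  fixes f :: "'a::euclidean_space \<times> 'b::euclidean_space \<Rightarrow> ennreal"
  assumes "f \<in> borel_measurable borel"
  shows "(\<integral>\<^sup>+p. f p \<partial>lborel) = (\<integral>\<^sup>+x. \<integral>\<^sup>+y. f (x, y) \<partial>lborel \<partial>lborel)"
  using lborel.nn_integral_fst[of f lborel] assms by (simp add: lborel_prod)

text \<open>Written as iterated integrals, the two sides differ by the order of the two inner variables in the
  middle.\<close>

lemma nn_integral_regroup:
  fixes f :: "('a::euclidean_space \<times> 'b::euclidean_space) \<times> ('c::euclidean_space \<times> 'e::euclidean_space) \<Rightarrow> ennreal"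
  assumes f: "f \<in> borel_measurable borel"
  shows "(\<integral>\<^sup>+z. f (regroup z) \<partial>lborel) = (\<integral>\<^sup>+p. f p \<partial>lborel)"
proof -
  note fc = borel_measurable_comp_continuous[OF f]
  have "(\<integral>\<^sup>+z. f (regroup z) \<partial>lborel) = (\<integral>\<^sup>+z. \<integral>\<^sup>+z'. f (regroup (z, z')) \<partial>lborel \<partial>lborel)"
    by (rule nn_integral_lborel_pair) (unfold regroup_def, intro fc continuous_intros)
  also have "\<dots> = (\<integral>\<^sup>+z. \<integral>\<^sup>+x'. \<integral>\<^sup>+\<omega>'. f (regroup (z, (x', \<omega>'))) \<partial>lborel \<partial>lborel \<partial>lborel)"
    by (intro nn_integral_cong nn_integral_lborel_pair) (unfold regroup_def, intro fc continuous_intros)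
  also have "\<dots> = (\<integral>\<^sup>+x. \<integral>\<^sup>+\<omega>. \<integral>\<^sup>+x'. \<integral>\<^sup>+\<omega>'. f (regroup ((x, \<omega>), (x', \<omega>'))) \<partial>lborel \<partial>lborel \<partial>lborel \<partial>lborel)"
  proof (rule nn_integral_lborel_pair)
    have "(\<lambda>p. f (regroup p)) \<in> borel_measurable (lborel \<Otimes>\<^sub>M lborel)"
      unfolding lborel_prod by (simp, unfold regroup_def, intro fc continuous_intros)
    then have "(\<lambda>z. \<integral>\<^sup>+z'. f (regroup (z, z')) \<partial>lborel) \<in> borel_measurable lborel"
      by (intro lborel.borel_measurable_nn_integral) simp
    moreover have "(\<integral>\<^sup>+z'. f (regroup (z, z')) \<partial>lborel) = (\<integral>\<^sup>+x'. \<integral>\<^sup>+\<omega>'. f (regroup (z, (x', \<omega>'))) \<partial>lborel \<partial>lborel)" for z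
      by (rule nn_integral_lborel_pair) (unfold regroup_def, intro fc continuous_intros)
    ultimately show "(\<lambda>z. \<integral>\<^sup>+x'. \<integral>\<^sup>+\<omega>'. f (regroup (z, (x', \<omega>'))) \<partial>lborel \<partial>lborel) \<in> borel_measurable borel" by simp
  qed
  also have "\<dots> = (\<integral>\<^sup>+x. \<integral>\<^sup>+x'. \<integral>\<^sup>+\<omega>. \<integral>\<^sup>+\<omega>'. f ((x, x'), (\<omega>, \<omega>')) \<partial>lborel \<partial>lborel \<partial>lborel \<partial>lborel)"
  proof (rule nn_integral_cong)
    fix x :: 'a
    have "(\<lambda>p. f ((x, fst (fst p)), (snd (fst p), snd p))) \<in> borel_measurable ((lborel \<Otimes>\<^sub>M lborel) \<Otimes>\<^sub>M lborel)"
      unfolding lborel_prod by (simp, intro fc continuous_intros)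
    then have "(\<lambda>(x', \<omega>). \<integral>\<^sup>+\<omega>'. f ((x, x'), (\<omega>, \<omega>')) \<partial>lborel) \<in> borel_measurable (lborel \<Otimes>\<^sub>M lborel)"
      unfolding case_prod_beta'
      by (intro lborel.borel_measurable_nn_integral) (simp add: case_prod_beta')
    from lborel_pair.Fubini'[OF this]
    show "(\<integral>\<^sup>+\<omega>. \<integral>\<^sup>+x'. \<integral>\<^sup>+\<omega>'. f (regroup ((x, \<omega>), (x', \<omega>'))) \<partial>lborel \<partial>lborel \<partial>lborel)
        = (\<integral>\<^sup>+x'. \<integral>\<^sup>+\<omega>. \<integral>\<^sup>+\<omega>'. f ((x, x'), (\<omega>, \<omega>')) \<partial>lborel \<partial>lborel \<partial>lborel)"
      by (simp add: regroup_def)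
  qed
  also have "\<dots> = (\<integral>\<^sup>+x. \<integral>\<^sup>+x'. \<integral>\<^sup>+w. f ((x, x'), w) \<partial>lborel \<partial>lborel \<partial>lborel)"
    by (intro nn_integral_cong nn_integral_lborel_pair[symmetric] fc continuous_intros)
  also have "\<dots> = (\<integral>\<^sup>+y. \<integral>\<^sup>+w. f (y, w) \<partial>lborel \<partial>lborel)"
  proof (rule nn_integral_lborel_pair[symmetric])
    have "f \<in> borel_measurable (lborel \<Otimes>\<^sub>M lborel)" using f by (simp add: lborel_prod)
    then have "(\<lambda>y. \<integral>\<^sup>+w. f (y, w) \<partial>lborel) \<in> borel_measurable lborel"
      by (intro lborel.borel_measurable_nn_integral) simp
    then show "(\<lambda>y. \<integral>\<^sup>+w. f (y, w) \<partial>lborel) \<in> borel_measurable borel" by simp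
  qed
  also have "\<dots> = (\<integral>\<^sup>+p. f p \<partial>lborel)" by (rule nn_integral_lborel_pair[OF f, symmetric])
  finally show ?thesis .
qed

lemma measurable_regroup [measurable]:
  "(regroup :: ('a::euclidean_space \<times> 'c::euclidean_space) \<times> ('b::euclidean_space \<times> 'e::euclidean_space) \<Rightarrow> _)
    \<in> borel_measurable borel"
  unfolding regroup_def[abs_def] by (intro borel_measurable_continuous_onI continuous_intros)

lemma distr_regroup:
  "distr lborel borel (regroup :: ('a::euclidean_space \<times> 'c::euclidean_space) \<times> ('b::euclidean_space \<times> 'e::euclidean_space) \<Rightarrow> _)
    = lborel" (is "distr _ _ ?r = _")
proof (rule measure_eqI)
  fix A assume "A \<in> sets (distr lborel borel ?r)"
  then have [measurable]: "A \<in> sets borel" by simp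
  have "emeasure (distr lborel borel ?r) A = (\<integral>\<^sup>+z. indicator A z \<partial>distr lborel borel ?r)"
    by (rule nn_integral_indicator[symmetric]) simp
  also have "\<dots> = (\<integral>\<^sup>+z. indicator A (regroup z) \<partial>lborel)"
    by (rule nn_integral_distr) auto
  also have "\<dots> = (\<integral>\<^sup>+z. indicator A z \<partial>lborel)"
    by (rule nn_integral_regroup) auto
  finally show "emeasure (distr lborel borel ?r) A = emeasure lborel A" by simp
qed simp

lemma AE_lborel_pair:
  fixes P :: "'a::euclidean_space \<Rightarrow> bool" and Q :: "'b::euclidean_space \<Rightarrow> bool"
  assumes "AE x in lborel. P x" "AE y in lborel. Q y"
  shows "AE p in lborel. P (fst p) \<and> Q (snd p)"
proof -
  obtain N where N: "{x \<in> space lborel. \<not> P x} \<subseteq> N" "N \<in> null_sets lborel"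
    using assms(1) unfolding eventually_ae_filter by blast
  obtain N' where N': "{y \<in> space lborel. \<not> Q y} \<subseteq> N'" "N' \<in> null_sets lborel"
    using assms(2) unfolding eventually_ae_filter by blast
  have [measurable]: "N \<in> sets borel" "N' \<in> sets borel" using N N' by (auto simp: null_sets_def)
  have "AE p in lborel \<Otimes>\<^sub>M lborel. fst p \<notin> N \<and> snd p \<notin> N'"
  proof (rule lborel_pair.AE_pair_measure)
    show "{p \<in> space (lborel \<Otimes>\<^sub>M lborel). fst p \<notin> N \<and> snd p \<notin> N'} \<in> sets (lborel \<Otimes>\<^sub>M lborel)" by measurable
    show "AE x in lborel. AE y in lborel. fst (x, y) \<notin> N \<and> snd (x, y) \<notin> N'"
      using AE_not_in[OF N(2)] AE_not_in[OF N'(2)] by auto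
  qed
  then have "AE p in lborel. fst p \<notin> N \<and> snd p \<notin> N'" by (simp only: lborel_prod)
  then show ?thesis by eventually_elim (use N(1) N'(1) in auto)
qed

lemma AE_lborel_regroup:
  fixes P :: "('a::euclidean_space \<times> 'c::euclidean_space) \<times> ('b::euclidean_space \<times> 'e::euclidean_space) \<Rightarrow> bool"
  assumes "AE z in lborel. P z"
  shows "AE p in lborel. P (regroup p)"
proof -
  obtain N where N: "{x \<in> space lborel. \<not> P x} \<subseteq> N" "N \<in> null_sets lborel"
    using assms unfolding eventually_ae_filter by blast
  have [measurable]: "N \<in> sets borel" using N by (auto simp: null_sets_def)
  have "AE z in distr lborel borel regroup. z \<notin> N"
    unfolding distr_regroup by (rule AE_not_in[OF N(2)])
  then have "AE p in lborel. regroup p \<notin> N" by (subst (asm) AE_distr_iff) auto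
  then show ?thesis by eventually_elim (use N(1) in auto)
qed

lemma AE_lebesgue_regroup:
  fixes P :: "'a::euclidean_space \<times> 'c::euclidean_space \<Rightarrow> bool" and Q :: "'b::euclidean_space \<times> 'e::euclidean_space \<Rightarrow> bool"
  assumes "AE z in lebesgue. P z" "AE z in lebesgue. Q z"
  shows "AE p in lebesgue. P (fst (regroup p)) \<and> Q (snd (regroup p))"
  using assms unfolding AE_completion_iff by (intro AE_lborel_regroup AE_lborel_pair)

lemma borel_version:
  fixes f :: "'a::euclidean_space \<Rightarrow> complex"
  assumes "integrable lebesgue f"
  shows "\<exists>f'. f' \<in> borel_measurable borel \<and> integrable lborel f' \<and> (AE z in lebesgue. f z = f' z) \<and>
    integral\<^sup>L lborel f' = integral\<^sup>L lebesgue f"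
proof -
  have meas: "f \<in> borel_measurable lebesgue" using assms by simp
  obtain a b where [measurable]: "a \<in> borel_measurable lborel" "b \<in> borel_measurable lborel"
    and ab: "AE z in lborel. Re (f z) = a z" "AE z in lborel. Im (f z) = b z"
    using completion_ex_borel_measurable_real[of "\<lambda>z. Re (f z)" lborel]
      completion_ex_borel_measurable_real[of "\<lambda>z. Im (f z)" lborel] meas by auto
  define f' where "f' z = complex_of_real (a z) + \<i> * complex_of_real (b z)" for z
  have [measurable]: "f' \<in> borel_measurable lborel" unfolding f'_def by measurable
  have m': "f' \<in> borel_measurable lebesgue" by (rule measurable_completion) simp
  have "AE z in lborel. f z = f' z"
    using ab by eventually_elim (simp add: f'_def complex_eq_iff)
  then have AE: "AE z in lebesgue. f z = f' z" by (rule AE_completion)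
  have "integrable lebesgue f'" using assms integrable_cong_AE[OF meas m' AE] by simp
  then have "integrable lborel f'" by (subst (asm) integrable_completion) auto
  moreover have "integral\<^sup>L lborel f' = integral\<^sup>L lebesgue f"
    using integral_cong_AE[OF meas m' AE] integral_completion[of f' lborel] by simp
  ultimately show ?thesis using AE by (intro exI[of _ f']) auto
qed

lemma lebesgue_measurable_AE_cong:
  fixes f g :: "'a::euclidean_space \<Rightarrow> complex"
  assumes g: "g \<in> borel_measurable lebesgue" and AE: "AE z in lebesgue. f z = g z"
  shows "f \<in> borel_measurable lebesgue"
proof (rule measurableI)
  fix A :: "complex set" assume A: "A \<in> sets borel"
  have gA: "g -` A \<inter> space lebesgue \<in> sets lebesgue" by (rule measurable_sets[OF g A])
  have ae: "AE z in lebesgue. z \<in> g -` A \<inter> space lebesgue \<longleftrightarrow> z \<in> f -` A \<inter> space lebesgue"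
    using AE by eventually_elim simp
  show "f -` A \<inter> space lebesgue \<in> sets lebesgue"
    by (rule completion.in_sets_AE[OF ae gA]) auto
qed simp

text \<open>The functions are Lebesgue measurable only, so Fubini's theorem is applied to Borel measurable
  versions of them.\<close>

lemma
  fixes p :: "'a::euclidean_space \<times> 'c::euclidean_space \<Rightarrow> complex" and q :: "'b::euclidean_space \<times> 'e::euclidean_space \<Rightarrow> complex"
  assumes p: "integrable lebesgue p" and q: "integrable lebesgue q"
  shows integrable_regroup_product: "integrable lebesgue (\<lambda>z. p (fst (regroup z)) * q (snd (regroup z)))"
    and integral_regroup_product:
      "(\<integral>z. p (fst (regroup z)) * q (snd (regroup z)) \<partial>lebesgue) = integral\<^sup>L lebesgue p * integral\<^sup>L lebesgue q"
proof -
  obtain p' where p': "p' \<in> borel_measurable borel" "integrable lborel p'" "AE z in lebesgue. p z = p' z"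
    "integral\<^sup>L lborel p' = integral\<^sup>L lebesgue p" using borel_version[OF p] by blast
  obtain q' where q': "q' \<in> borel_measurable borel" "integrable lborel q'" "AE z in lebesgue. q z = q' z"
    "integral\<^sup>L lborel q' = integral\<^sup>L lebesgue q" using borel_version[OF q] by blast
  note [measurable] = p'(1) q'(1)
  let ?h = "\<lambda>z. p (fst (regroup z)) * q (snd (regroup z))" and ?h' = "\<lambda>z. p' (fst (regroup z)) * q' (snd (regroup z))"
  let ?k = "\<lambda>y. p' (fst y) * q' (snd y)"
  have AE: "AE z in lebesgue. ?h z = ?h' z"
    using AE_lebesgue_regroup[OF p'(3) q'(3)] by eventually_elim simp
  have k_meas: "?k \<in> borel_measurable borel"
    by (intro borel_measurable_times borel_measurable_comp_continuous[OF p'(1)]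
        borel_measurable_comp_continuous[OF q'(1)] continuous_on_fst continuous_on_snd continuous_on_id)
  have k: "integrable (lborel \<Otimes>\<^sub>M lborel) ?k"
    by (rule lborel_pair.Fubini_integrable) (use k_meas p' q' in \<open>simp_all add: lborel_prod norm_mult\<close>)
  have "integral\<^sup>L (lborel \<Otimes>\<^sub>M lborel) ?k = (\<integral>x. \<integral>y. ?k (x, y) \<partial>lborel \<partial>lborel)"
    by (rule lborel_pair.integral_fst'[symmetric, OF k])
  then have k_int: "integral\<^sup>L lborel ?k = integral\<^sup>L lborel p' * integral\<^sup>L lborel q'"
    by (simp add: lborel_prod)
  have h'_meas: "?h' \<in> borel_measurable borel" by (rule measurable_compose[OF measurable_regroup k_meas])
  then have h'_leb: "?h' \<in> borel_measurable lebesgue" by (intro measurable_completion) simp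
  have h_leb: "?h \<in> borel_measurable lebesgue" by (rule lebesgue_measurable_AE_cong[OF h'_leb AE])
  have "integrable (distr lborel borel regroup) ?k" using k by (simp add: distr_regroup lborel_prod)
  then have "integrable lborel ?h'" by (subst (asm) integrable_distr_eq) (use k_meas in auto)
  then have h': "integrable lebesgue ?h'" by (subst integrable_completion) (use h'_meas in auto)
  then show "integrable lebesgue ?h" using integrable_cong_AE[OF h_leb h'_leb AE] by simp
  have "integral\<^sup>L lebesgue ?h = integral\<^sup>L lebesgue ?h'" by (rule integral_cong_AE[OF h_leb h'_leb AE])
  also have "\<dots> = integral\<^sup>L lborel ?h'" by (rule integral_completion) (use h'_meas in simp)
  also have "\<dots> = integral\<^sup>L (distr lborel borel regroup) ?k"
    by (rule integral_distr[symmetric]) (use k_meas in auto)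
  also have "\<dots> = integral\<^sup>L lebesgue p * integral\<^sup>L lebesgue q"
    by (simp only: distr_regroup k_int p'(4) q'(4))
  finally show "integral\<^sup>L lebesgue ?h = integral\<^sup>L lebesgue p * integral\<^sup>L lebesgue q" .
qed


section \<open>The density operator of a product symbol\<close>

theorem theorem7p4:
  fixes \<phi>1 \<phi>2 :: "(real ^ 'd) L2"
    and m1 m2 :: "(real ^ 'd) \<times> (real ^ 'd) \<Rightarrow> real"
    and m :: "((real ^ 'd) \<times> (real ^ 'd)) \<times> ((real ^ 'd) \<times> (real ^ 'd)) \<Rightarrow> real"
    and F :: "((real ^ 'd) \<times> (real ^ 'd)) \<times> ((real ^ 'd) \<times> (real ^ 'd))
                \<Rightarrow> ((real ^ 'd) \<times> (real ^ 'd)) L2"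
    and F1 F2 :: "(real ^ 'd) \<times> (real ^ 'd) \<Rightarrow> (real ^ 'd) L2"
  assumes "\<phi>1 \<otimes> \<phi>2 \<noteq> 0"
    and "integrable lebesgue m1" "\<exists>C. AE z in lebesgue. \<bar>m1 z\<bar> \<le> C" "AE z in lebesgue. 0 \<le> m1 z"
    and "integrable lebesgue m2" "\<exists>C. AE z in lebesgue. \<bar>m2 z\<bar> \<le> C" "AE z in lebesgue. 0 \<le> m2 z"
    and "(\<integral>z. m1 z \<partial>lebesgue) = 1 / (norm \<phi>1)\<^sup>2"
    and "(\<integral>z. m2 z \<partial>lebesgue) = 1 / (norm \<phi>2)\<^sup>2"
    and "m = (\<lambda>((x1, x2), (\<omega>1, \<omega>2)). m1 (x1, \<omega>1) * m2 (x2, \<omega>2))"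
    and "F = (\<lambda>(x, \<omega>). tf_shift x \<omega> (\<phi>1 \<otimes> \<phi>2))"
    and "F1 = (\<lambda>(x1, \<omega>1). tf_shift x1 \<omega>1 \<phi>1)"
    and "F2 = (\<lambda>(x2, \<omega>2). tf_shift x2 \<omega>2 \<phi>2)"
  shows "(\<forall>x1 x2 \<omega>1 \<omega>2. F ((x1, x2), (\<omega>1, \<omega>2)) = tf_shift x1 \<omega>1 \<phi>1 \<otimes> tf_shift x2 \<omega>2 \<phi>2) \<and>
    density_operator (multiplier lebesgue (\<lambda>z. complex_of_real (m z)) F F) \<and>
    density_operator (multiplier lebesgue (\<lambda>z. complex_of_real (m1 z)) F1 F1) \<and>
    density_operator (multiplier lebesgue (\<lambda>z. complex_of_real (m2 z)) F2 F2) \<and>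
    partial_trace_1 (multiplier lebesgue (\<lambda>z. complex_of_real (m z)) F F)
      = multiplier lebesgue (\<lambda>z. complex_of_real (m1 z)) F1 F1 \<and>
    partial_trace_2 (multiplier lebesgue (\<lambda>z. complex_of_real (m z)) F F)
      = multiplier lebesgue (\<lambda>z. complex_of_real (m2 z)) F2 F2"
proof -
  have F: "F ((x1, x2), (\<omega>1, \<omega>2)) = F1 (x1, \<omega>1) \<otimes> F2 (x2, \<omega>2)" for x1 x2 \<omega>1 \<omega>2
    using assms(11-13) by (simp add: tf_shift_tensor)
  have F': "F z = F1 (fst (regroup z)) \<otimes> F2 (snd (regroup z))" for z
    using F[of "fst (fst z)" "snd (fst z)" "fst (snd z)" "snd (snd z)"] by (simp add: regroup_def)
  have m': "m z = m1 (fst (regroup z)) * m2 (snd (regroup z))" for z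
    using assms(10) by (simp add: regroup_def case_prod_beta')
  have wm: "weakly_measurable lebesgue F" "weakly_measurable lebesgue F1" "weakly_measurable lebesgue F2"
    using assms(11-13) weakly_measurable_tf_shift by auto
  have norms: "norm (F z) = norm (\<phi>1 \<otimes> \<phi>2)" "norm (F1 z') = norm \<phi>1" "norm (F2 z'') = norm \<phi>2" for z z' z''
    using assms(11-13) by (simp_all add: norm_tf_shift case_prod_beta')
  have norm_prod: "norm (\<phi>1 \<otimes> \<phi>2) = norm \<phi>1 * norm \<phi>2" by (rule L2_tensor.norm_ten)
  have nz: "norm \<phi>1 \<noteq> 0" "norm \<phi>2 \<noteq> 0" using assms(1) norm_prod by auto
  have cint: "integrable lebesgue (\<lambda>z. complex_of_real (m1 z))" "integrable lebesgue (\<lambda>z. complex_of_real (m2 z))"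
    using assms(2,5) by auto
  have cm: "complex_of_real (m z) = complex_of_real (m1 (fst (regroup z))) * complex_of_real (m2 (snd (regroup z)))" for z
    by (simp add: m')
  have m_int: "integrable lebesgue (\<lambda>z. complex_of_real (m z))"
    unfolding cm by (rule integrable_regroup_product[OF cint])
  have "complex_of_real (\<integral>z. m z \<partial>lebesgue) = (\<integral>z. complex_of_real (m z) \<partial>lebesgue)"
    by (rule integral_complex_of_real[symmetric])
  also have "\<dots> = complex_of_real ((\<integral>z. m1 z \<partial>lebesgue) * (\<integral>z. m2 z \<partial>lebesgue))"
    unfolding cm integral_regroup_product[OF cint] by (simp add: integral_complex_of_real)
  finally have m_total: "(\<integral>z. m z \<partial>lebesgue) = (\<integral>z. m1 z \<partial>lebesgue) * (\<integral>z. m2 z \<partial>lebesgue)"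
    by (simp only: of_real_eq_iff)
  have m_nonneg: "AE z in lebesgue. 0 \<le> m z"
    using AE_lebesgue_regroup[OF assms(4,7)] by eventually_elim (simp add: m')
  let ?M = "multiplier lebesgue (\<lambda>z. complex_of_real (m z)) F F"
  let ?M1 = "multiplier lebesgue (\<lambda>z. complex_of_real (m1 z)) F1 F1"
  let ?M2 = "multiplier lebesgue (\<lambda>z. complex_of_real (m2 z)) F2 F2"
  have one: "(\<integral>z. m1 z \<partial>lebesgue) * (norm \<phi>1)\<^sup>2 = 1" "(\<integral>z. m2 z \<partial>lebesgue) * (norm \<phi>2)\<^sup>2 = 1"
    unfolding assms(8,9) using nz by (metis nonzero_divide_eq_eq power_not_zero)+
  have d: "density_operator ?M"
  proof (rule density_operator_multiplier[OF countable_onb _ m_nonneg wm(1) norms(1)])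
    show "integrable lebesgue m" using integrable_Re[OF m_int] by simp
    show "(\<integral>z. m z \<partial>lebesgue) * (norm (\<phi>1 \<otimes> \<phi>2))\<^sup>2 = 1"
      using arg_cong2[OF one, of times] by (simp add: m_total norm_prod power_mult_distrib mult_ac)
  qed
  have d1: "density_operator ?M1"
    by (rule density_operator_multiplier[OF _ assms(2,4) wm(2) norms(2) one(1)]) (rule countable_onb)
  have d2: "density_operator ?M2"
    by (rule density_operator_multiplier[OF _ assms(5,7) wm(3) norms(3) one(2)]) (rule countable_onb)
  note le = eq_refl[OF norms(1)] eq_refl[OF norms(2)] eq_refl[OF norms(3)]
  \<comment> \<open>Testing against product vectors, the integral of the product symbol factorizes.\<close>
  have product: "?M (f \<otimes> g) = ?M1 f \<otimes> ?M2 g" for f g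
  proof -
    have "cinner (?M (f \<otimes> g) - ?M1 f \<otimes> ?M2 g) (u \<otimes> v) = 0" for u v
    proof -
      let ?p = "\<lambda>z. complex_of_real (m1 z) * cinner f (F1 z) * cinner (F1 z) u"
      let ?q = "\<lambda>z. complex_of_real (m2 z) * cinner g (F2 z) * cinner (F2 z) v"
      have "cinner (?M (f \<otimes> g)) (u \<otimes> v) = (\<integral>z. ?p (fst (regroup z)) * ?q (snd (regroup z)) \<partial>lebesgue)"
        by (subst cinner_multiplier[OF m_int wm(1) le(1)]) (simp add: cm F' cinner_tensor mult_ac)
      also have "\<dots> = integral\<^sup>L lebesgue ?p * integral\<^sup>L lebesgue ?q"
        by (rule integral_regroup_product[OF integrable_multiplier[OF cint(1) wm(2) le(2)]
              integrable_multiplier[OF cint(2) wm(3) le(3)]])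
      also have "\<dots> = cinner (?M1 f \<otimes> ?M2 g) (u \<otimes> v)"
        by (simp only: cinner_tensor cinner_multiplier[OF cint(1) wm(2) le(2)] cinner_multiplier[OF cint(2) wm(3) le(3)])
      finally show ?thesis by (simp add: cinner_linear)
    qed
    then have "?M (f \<otimes> g) - ?M1 f \<otimes> ?M2 g = 0" by (rule tensor_dense)
    then show ?thesis by simp
  qed
  have tc: "?M \<in> trace_class" "?M1 \<in> trace_class" "?M2 \<in> trace_class" and tr: "trace ?M1 = 1" "trace ?M2 = 1"
    using d d1 d2 by (simp_all add: density_operator_def)
  have "partial_trace_1 ?M = ?M1"
    using partial_trace_1_product[OF tc(2,3,1) product] by (simp add: tr scaleC_one)
  moreover have "partial_trace_2 ?M = ?M2"
    using partial_trace_2_product[OF tc(2,3,1) product] by (simp add: tr scaleC_one)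
  moreover have "\<forall>x1 x2 \<omega>1 \<omega>2. F ((x1, x2), (\<omega>1, \<omega>2)) = tf_shift x1 \<omega>1 \<phi>1 \<otimes> tf_shift x2 \<omega>2 \<phi>2"
    using F assms(12,13) by simp
  ultimately show ?thesis using d d1 d2 by blast
qed

end
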